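(* (i) Let $f=h+P$ on $\mathbb{R}^n$, where either (a) $h(x)=l(Ax)$ and $P(x)=\min_{1\le i\le r}P_i(x)$, where $l:\mathbb{R}^m\to\mathbb{R}$ is strongly convex on any compact convex set and is twice continuously differentiable with a Lipschitz continuous gradient, $A\in\mathbb{R}^{m\times n}$, and $P_i$ are proper closed polyhedral functions for $i=1,\ldots,r$ (this covers, in particular, the $\ell_1$ regularized logistic regression problem); or (b) $h(x)=\frac12\|Ax-b\|^2$ with $A\in\mathbb{R}^{m\times n}$, $b\in\mathbb{R}^m$, and $P$ is the SCAD or the MCP regularizer. Let $L>0$ be a Lipschitz constant of $\nabla h$, let $0<\inf_{k\ge0}\gamma_k\le\sup_{k\ge0}\gamma_k<\frac1L$, and let $\{x^k\}$ be a sequence generated by the proximal gradient algorithm $$x^{k+1}\in\mathrm{Arg\,min}_{x\in\mathbb{R}^n}\left\{\langle\nabla h(x^k),x-x^k\rangle+\frac{1}{2\gamma_k}\|x-x^k\|^2+P(x)\right\},\quad k\ge0.$$ If $\inf f>-\infty$ and $\{x^k\}$ is bounded, then $\{x^k\}$ converges locally linearly to a stationary point of $f$. (ii) Let $f=h+P$ on $\mathbb{R}^n$ be coercive, where $h(x)=l(Ax)$ with $l$ and $A$ as in (a), and $P$ is a proper closed convex piecewise linear-quadratic function. Let $L>0$ be a Lipschitz constant of $\nabla h$, let $\beta\in[0,1)$ and $\alpha\in\left(0,\frac{2(1-\beta)}{L}\right)$, and let $\{x^k\}$ be generated by the inertial proximal algorithm iPiano with constant step-sizes: $x^{-1}=x^0$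 and, for $k\ge0$, $$x^{k+1}=\arg\min_{x\in\mathbb{R}^n}\left\{\left\langle\nabla h(x^k)-\frac{\beta}{\alpha}(x^k-x^{k-1}),x-x^k\right\rangle+\frac{1}{2\alpha}\|x-x^k\|^2+P(x)\right\}.$$ Then $\{x^k\}$ converges locally linearly to a stationary point of $f$.
   Context: Closed means lower semicontinuous; proper means never $-\infty$ and not identically $+\infty$; coercive means $f(x)\to\infty$ as $\|x\|\to\infty$. For a proper function $f$ and $x\in\mathrm{dom}\,f=\{x:f(x)<\infty\}$, the regular subdifferential is $\widehat\partial f(x)=\{v: \liminf_{z\to x,z\ne x}\frac{f(z)-f(x)-\langle v,z-x\rangle}{\|z-x\|}\ge 0\}$ and the (limiting) subdifferential $\partial f(x)$ is the set of $v$ for which there exist $x^t\to x$ with $f(x^t)\to f(x)$ and $v^t\to v$ with $v^t\in\widehat\partial f(x^t)$ for each $t$; $\partial f(x)=\emptyset$ if $x\notin\mathrm{dom}\,f$. A stationary point of $f$ is an $x$ with $0\in\partial f(x)$. $\mathrm{Arg\,min}$ denotes the set of minimizers, and $\arg\min$ the unique minimizer. A polyhedral function is one whose epigraph is a (convex) polyhedron. A proper closed function $F$ is piecewise linear-quadratic if $\mathrm{dom}\,F$ is a union of finitely many polyhedra, relative to each of which $F(x)=\frac12x^TMx+a^Tx+\tau$ for some symmetric $M$, $a\in\mathbb{R}^n$, $\tau\in\mathbb{R}$. The $\ell_1$ regularized logistic regression problem has $l(y)=\sum_{i=1}^m\log(1+\exp(b_iy_i))$ for some suitable $b\in\mathbb{R}^m$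 and $P(x)=\mu\|x\|_1$ with $\mu>0$. SCAD regularizer: $P(x)=\sum_{i=1}^n r(x_i)$ with, for $\lambda>0,\theta>2$, $r(t)=\lambda|t|$ if $|t|\le\lambda$; $r(t)=\frac{-t^2+2\theta\lambda|t|-\lambda^2}{2(\theta-1)}$ if $\lambda<|t|\le\theta\lambda$; $r(t)=\frac{(\theta+1)\lambda^2}{2}$ if $|t|>\theta\lambda$. MCP regularizer: $P(x)=\sum_{i=1}^n r(x_i)$ with, for $\lambda>0,\theta>0$, $r(t)=\lambda|t|-\frac{t^2}{2\theta}$ if $|t|\le\theta\lambda$; $r(t)=\frac{\theta\lambda^2}{2}$ if $|t|>\theta\lambda$. "$\{x^k\}$ converges locally linearly to $\bar x$" means $R$-linear convergence: $x^k\to\bar x$ and $\limsup_{k\to\infty}\sqrt[k]{\|x^k-\bar x\|}<1$. *)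

theory Defs
  imports "HOL-Analysis.Analysis"
begin

section \<open>Extended-real-valued functions\<close>

definition dom_fun :: "('a \<Rightarrow> ereal) \<Rightarrow> 'a set" where
  "dom_fun f = {x. f x < \<infinity>}"

definition proper_fun :: "('a \<Rightarrow> ereal) \<Rightarrow> bool" where
  "proper_fun f \<longleftrightarrow> (\<forall>x. f x \<noteq> -\<infinity>) \<and> (\<exists>x. f x \<noteq> \<infinity>)"

definition closed_fun :: "('a::euclidean_space \<Rightarrow> ereal) \<Rightarrow> bool" where
  "closed_fun f \<longleftrightarrow> (\<forall>x. f x \<le> Liminf (at x) f)"

definition coercive :: "('a::euclidean_space \<Rightarrow> ereal) \<Rightarrow> bool" where
  "coercive f \<longleftrightarrow> (f \<longlongrightarrow> \<infinity>) at_infinity"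

definition ereal_epigraph :: "('a \<Rightarrow> ereal) \<Rightarrow> ('a \<times> real) set" where
  "ereal_epigraph f = {(x, t). f x \<le> ereal t}"

definition convex_fun :: "('a::euclidean_space \<Rightarrow> ereal) \<Rightarrow> bool" where
  "convex_fun f \<longleftrightarrow> convex (ereal_epigraph f)"

definition polyhedral_fun :: "('a::euclidean_space \<Rightarrow> ereal) \<Rightarrow> bool" where
  "polyhedral_fun f \<longleftrightarrow> polyhedron (ereal_epigraph f)"

definition piecewise_linear_quadratic :: "(real^'n \<Rightarrow> ereal) \<Rightarrow> bool" where
  "piecewise_linear_quadratic F \<longleftrightarrow>
     proper_fun F \<and> closed_fun F \<and>
     (\<exists>\<C>. finite \<C> \<and> (\<forall>C\<in>\<C>. polyhedron C) \<and> dom_fun F = \<Union>\<C> \<and>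
        (\<forall>C\<in>\<C>. \<exists>(M :: real^'n^'n) a \<tau>. transpose M = M \<and>
           (\<forall>x\<in>C. F x = ereal (1/2 * (x \<bullet> (M *v x)) + a \<bullet> x + \<tau>))))"


section \<open>Subdifferentials and stationary points\<close>

text \<open>The functions \<open>f\<close> are meant to be proper, so that \<open>f x\<close> is finite on \<open>dom_fun f\<close>.\<close>

definition regular_subdifferential ::
    "('a::euclidean_space \<Rightarrow> ereal) \<Rightarrow> 'a \<Rightarrow> 'a set" where
  "regular_subdifferential f x = {v. x \<in> dom_fun f \<and>
     0 \<le> Liminf (at x) (\<lambda>z. (f z - f x - ereal (v \<bullet> (z - x))) / ereal (norm (z - x)))}"

definition subdifferential :: "('a::euclidean_space \<Rightarrow> ereal) \<Rightarrow> 'a \<Rightarrow> 'a set" where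
  "subdifferential f x = {v. x \<in> dom_fun f \<and>
     (\<exists>(y :: nat \<Rightarrow> 'a) w. y \<longlonglongrightarrow> x \<and> (\<lambda>t. f (y t)) \<longlonglongrightarrow> f x \<and> w \<longlonglongrightarrow> v \<and>
        (\<forall>t. w t \<in> regular_subdifferential f (y t)))}"

definition stationary_point :: "('a::euclidean_space \<Rightarrow> ereal) \<Rightarrow> 'a \<Rightarrow> bool" where
  "stationary_point f x \<longleftrightarrow> 0 \<in> subdifferential f x"


section \<open>The smooth part\<close>

definition gradient :: "('a::euclidean_space \<Rightarrow> real) \<Rightarrow> 'a \<Rightarrow> 'a" where
  "gradient f x = (THE D. GDERIV f x :> D)"

definition twice_continuously_differentiable :: "(real^'m \<Rightarrow> real) \<Rightarrow> bool" where
  "twice_continuously_differentiable l \<longleftrightarrow>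
     (\<forall>y. GDERIV l y :> gradient l y) \<and>
     (\<exists>H :: real^'m \<Rightarrow> real^'m^'m.
        (\<forall>y. (gradient l has_derivative (\<lambda>v. H y *v v)) (at y)) \<and> continuous_on UNIV H)"

definition strongly_convex_on :: "'a::euclidean_space set \<Rightarrow> ('a \<Rightarrow> real) \<Rightarrow> bool" where
  "strongly_convex_on S l \<longleftrightarrow>
     (\<exists>\<sigma>>0. convex_on S (\<lambda>y. l y - \<sigma> / 2 * (norm y)\<^sup>2))"

text \<open>The modulus of strong convexity may depend on the compact set.\<close>

definition admissible_loss :: "(real^'m \<Rightarrow> real) \<Rightarrow> bool" where
  "admissible_loss l \<longleftrightarrow>
     (\<forall>S. compact S \<and> convex S \<longrightarrow> strongly_convex_on S l) \<and>
     twice_continuously_differentiable l \<and>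
     (\<exists>K. K-lipschitz_on UNIV (gradient l))"

definition logistic_loss :: "real^'m \<Rightarrow> real^'m \<Rightarrow> real" where
  "logistic_loss b y = (\<Sum>i\<in>UNIV. ln (1 + exp (b $ i * y $ i)))"


section \<open>Regularizers\<close>

definition min_of_polyhedral :: "(real^'n \<Rightarrow> ereal) \<Rightarrow> bool" where
  "min_of_polyhedral P \<longleftrightarrow>
     (\<exists>(r::nat) Q. 1 \<le> r \<and>
        (\<forall>i\<in>{1..r}. proper_fun (Q i) \<and> closed_fun (Q i) \<and> polyhedral_fun (Q i)) \<and>
        P = (\<lambda>x. MIN i\<in>{1..r}. Q i x))"

definition l1_regularizer :: "real \<Rightarrow> real^'n \<Rightarrow> ereal" where
  "l1_regularizer \<mu> x = ereal (\<mu> * (\<Sum>i\<in>UNIV. \<bar>x $ i\<bar>))"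

definition scad_scalar :: "real \<Rightarrow> real \<Rightarrow> real \<Rightarrow> real" where
  "scad_scalar lam \<theta> t =
     (if \<bar>t\<bar> \<le> lam then lam * \<bar>t\<bar>
      else if \<bar>t\<bar> \<le> \<theta> * lam then (- t\<^sup>2 + 2 * \<theta> * lam * \<bar>t\<bar> - lam\<^sup>2) / (2 * (\<theta> - 1))
      else (\<theta> + 1) * lam\<^sup>2 / 2)"

definition mcp_scalar :: "real \<Rightarrow> real \<Rightarrow> real \<Rightarrow> real" where
  "mcp_scalar lam \<theta> t =
     (if \<bar>t\<bar> \<le> \<theta> * lam then lam * \<bar>t\<bar> - t\<^sup>2 / (2 * \<theta>)
      else \<theta> * lam\<^sup>2 / 2)"

definition is_scad :: "(real^'n \<Rightarrow> ereal) \<Rightarrow> bool" where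
  "is_scad P \<longleftrightarrow>
     (\<exists>lam \<theta>. lam > 0 \<and> \<theta> > 2 \<and> P = (\<lambda>x. ereal (\<Sum>i\<in>UNIV. scad_scalar lam \<theta> (x $ i))))"

definition is_mcp :: "(real^'n \<Rightarrow> ereal) \<Rightarrow> bool" where
  "is_mcp P \<longleftrightarrow>
     (\<exists>lam \<theta>. lam > 0 \<and> \<theta> > 0 \<and> P = (\<lambda>x. ereal (\<Sum>i\<in>UNIV. mcp_scalar lam \<theta> (x $ i))))"


section \<open>Algorithms\<close>

definition Arg_min_set :: "('a \<Rightarrow> ereal) \<Rightarrow> 'a set" where
  "Arg_min_set g = {z. is_arg_min g (\<lambda>_. True) z}"

definition prox_gradient_seq ::
    "('a::euclidean_space \<Rightarrow> real) \<Rightarrow> ('a \<Rightarrow> ereal) \<Rightarrow> (nat \<Rightarrow> real) \<Rightarrow> (nat \<Rightarrow> 'a) \<Rightarrow> bool" where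
  "prox_gradient_seq h P \<gamma> x \<longleftrightarrow>
     (\<forall>k. x (Suc k) \<in> Arg_min_set (\<lambda>z.
        ereal (gradient h (x k) \<bullet> (z - x k) + 1 / (2 * \<gamma> k) * (norm (z - x k))\<^sup>2) + P z))"

text \<open>The variable \<open>p\<close> is the previous iterate, with the convention that the iterate of
  index \<open>-1\<close> is \<open>x 0\<close>. Equality with a singleton says that the next iterate is the
  unique minimizer.\<close>

definition ipiano_seq ::
    "('a::euclidean_space \<Rightarrow> real) \<Rightarrow> ('a \<Rightarrow> ereal) \<Rightarrow> real \<Rightarrow> real \<Rightarrow> (nat \<Rightarrow> 'a) \<Rightarrow> bool" where
  "ipiano_seq h P \<alpha> \<beta> x \<longleftrightarrow>
     (\<forall>k. let p = (if k = 0 then x 0 else x (k - 1)) in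
        Arg_min_set (\<lambda>z.
          ereal ((gradient h (x k) - (\<beta> / \<alpha>) *\<^sub>R (x k - p)) \<bullet> (z - x k)
                 + 1 / (2 * \<alpha>) * (norm (z - x k))\<^sup>2) + P z) = {x (Suc k)})"

definition converges_locally_linearly ::
    "(nat \<Rightarrow> 'a::euclidean_space) \<Rightarrow> 'a \<Rightarrow> bool" where
  "converges_locally_linearly x xbar \<longleftrightarrow>
     x \<longlonglongrightarrow> xbar \<and> limsup (\<lambda>k. ereal (root k (norm (x k - xbar)))) < 1"


section \<open>Problem classes\<close>

definition setting_a ::
    "real^'n^'m \<Rightarrow> (real^'n \<Rightarrow> real) \<Rightarrow> (real^'n \<Rightarrow> ereal) \<Rightarrow> bool" where
  "setting_a A h P \<longleftrightarrow>
     (\<exists>l. admissible_loss l \<and> h = (\<lambda>x. l (A *v x))) \<and> min_of_polyhedral P"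

definition setting_b ::
    "real^'n^'m \<Rightarrow> (real^'n \<Rightarrow> real) \<Rightarrow> (real^'n \<Rightarrow> ereal) \<Rightarrow> bool" where
  "setting_b A h P \<longleftrightarrow>
     (\<exists>b. h = (\<lambda>x. 1/2 * (norm (A *v x - b))\<^sup>2)) \<and> (is_scad P \<or> is_mcp P)"

definition setting_ipiano ::
    "real^'n^'m \<Rightarrow> (real^'n \<Rightarrow> real) \<Rightarrow> (real^'n \<Rightarrow> ereal) \<Rightarrow> bool" where
  "setting_ipiano A h P \<longleftrightarrow>
     (\<exists>l. admissible_loss l \<and> h = (\<lambda>x. l (A *v x))) \<and>
     proper_fun P \<and> closed_fun P \<and> convex_fun P \<and> piecewise_linear_quadratic P"

end

theory Submission
  imports Defs
begin

text \<open>
  The domain of \<open>P\<close> is a union of finitely many relatively open convex pieces: relative interiors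
  of faces of polyhedra, or projections of such faces of an epigraph. On each piece \<open>P\<close>
  agrees with, or is at least dominated by, a quadratic or affine function \<open>q\<close>, and every value of \<open>P\<close> is attained by such a \<open>q\<close>. An iterate minimizes a
  model function over its piece, and because the piece is relatively open the first order
  condition is an equation: the gradient of \<open>F = h + q\<close> equals a residual \<open>v\<close> modulo the orthogonal
  complement of the space \<open>W\<close> of directions of the piece, and \<open>v\<close> has the size of the last steps.

  The heart of the matter is the Kurdyka-Lojasiewicz inequality with exponent one half,
  \<open>F x - F xb \<le> c * (norm v)\<^sup>2\<close>, near a critical point \<open>xb\<close> of \<open>F\<close> restricted to \<open>xb + W\<close>. Since no
  inequality constraints are left, this is linear algebra. Split \<open>x - xb = n + e\<close>, where \<open>n\<close>
  lies in the subspace of \<open>W\<close> along which \<open>F\<close> is constant and \<open>e\<close> is orthogonal to it; then \<open>norm e\<close> is bounded by a multiple of \<open>norm v\<close>, and \<open>F\<close>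
  grows at most like \<open>v \<bullet> e\<close>. This works for quadratic \<open>F\<close> without convexity
  (\<open>kl_half_along_quadratic\<close>) and for \<open>l (A x)\<close> plus a quadratic that is convex along \<open>W\<close>
  (\<open>kl_half_along_convex\<close>); these are the two kinds of pieces that occur.

  For both algorithms some quantity \<open>H k\<close>, the objective value plus possibly a multiple of the last
  squared step, decreases by at least a multiple of the squared steps. The limit of \<open>H\<close> equals the
  value \<open>F xb\<close> of every piece that is visited infinitely often near a cluster point \<open>xb\<close>, so the
  inequality bounds the gap between \<open>H\<close> and its limit by the squared steps
  (\<open>descent_scheme.gap_le_step\<close>). Decrease and gap together make the gap contract geometrically,
  hence also the steps, and the iterates converge \<open>R\<close>-linearly. The limit minimizes the limiting
  model function, which makes it stationary (\<open>descent_scheme.limit_stationary\<close>).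
\<close>

section \<open>Gradients, line restrictions and strong convexity\<close>

lemma gradient_eqI:
  assumes "GDERIV f x :> D"
  shows "gradient f x = D"
proof -
  have "D' = D" if "GDERIV f x :> D'" for D'
  proof -
    have "(\<lambda>h. h \<bullet> D') = (\<lambda>h. h \<bullet> D)"
      using that assms unfolding gderiv_def by (rule has_derivative_unique)
    then have "h \<bullet> (D' - D) = 0" for h
      by (simp add: fun_eq_iff inner_diff_right)
    then show ?thesis
      by (metis inner_eq_zero_iff right_minus_eq)
  qed
  then show ?thesis
    unfolding gradient_def using assms by blast
qed

lemma GDERIV_along_line:
  assumes "GDERIV f (x + t *\<^sub>R d) :> D"
  shows "((\<lambda>s. f (x + s *\<^sub>R d)) has_real_derivative d \<bullet> D) (at t)"
proof -
  have "((\<lambda>s. x + s *\<^sub>R d) has_derivative (\<lambda>s. s *\<^sub>R d)) (at t)"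
    by (auto intro!: derivative_eq_intros)
  from has_derivative_compose[OF this assms[unfolded gderiv_def]]
  show ?thesis
    unfolding has_field_derivative_def
    by (rule has_derivative_eq_rhs) (simp add: fun_eq_iff mult.commute)
qed

lemma GDERIV_compose_linear:
  fixes A :: "'a::euclidean_space \<Rightarrow> 'b::euclidean_space"
  assumes "linear A" and "\<And>y z. A y \<bullet> z = y \<bullet> A' z" and "GDERIV l (A x) :> D"
  shows "GDERIV (\<lambda>x. l (A x)) x :> A' D"
proof -
  have "(A has_derivative A) (at x)"
    using assms(1) by (simp add: linear_imp_has_derivative)
  from has_derivative_compose[OF this assms(3)[unfolded gderiv_def]]
  show ?thesis
    unfolding gderiv_def using assms(2) by simp
qed

lemma quadratic_upper_bound:
  fixes h :: "'a::euclidean_space \<Rightarrow> real"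
  assumes h: "\<And>z. GDERIV h z :> g z" and L: "L-lipschitz_on UNIV g"
  shows "h y \<le> h x + g x \<bullet> (y - x) + L / 2 * (norm (y - x))\<^sup>2"
proof -
  define d where "d = y - x"
  define \<phi> where "\<phi> t = h (x + t *\<^sub>R d) - t * (g x \<bullet> d) - L / 2 * t\<^sup>2 * (norm d)\<^sup>2" for t
  have "\<exists>D. (\<phi> has_real_derivative D) (at t) \<and> D \<le> 0" if "0 \<le> t" for t
  proof -
    let ?D = "d \<bullet> g (x + t *\<^sub>R d) - g x \<bullet> d - L * t * (norm d)\<^sup>2"
    have "norm (g (x + t *\<^sub>R d) - g x) \<le> L * (t * norm d)"
      using lipschitz_onD[OF L, of "x + t *\<^sub>R d" x] that by (simp add: dist_norm)
    then have "norm d * norm (g (x + t *\<^sub>R d) - g x) \<le> norm d * (L * (t * norm d))"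
      by (intro mult_left_mono) auto
    then have "d \<bullet> (g (x + t *\<^sub>R d) - g x) \<le> norm d * (L * (t * norm d))"
      using norm_cauchy_schwarz order_trans by blast
    then have "?D \<le> 0"
      by (simp add: inner_diff_right inner_commute[of "g x"] power2_eq_square mult_ac)
    moreover have "(\<phi> has_real_derivative ?D) (at t)"
    proof -
      have "((\<lambda>t. h (x + t *\<^sub>R d)) has_real_derivative d \<bullet> g (x + t *\<^sub>R d)) (at t)"
        by (rule GDERIV_along_line[OF h])
      then show ?thesis
        unfolding \<phi>_def by (auto intro!: derivative_eq_intros)
    qed
    ultimately show ?thesis
      by blast
  qed
  then have "\<phi> 1 \<le> \<phi> 0"
    using DERIV_nonpos_imp_nonincreasing[of 0 1 \<phi>] by simp
  then show ?thesis
    by (simp add: \<phi>_def d_def)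
qed

lemma convex_on_tangent:
  fixes \<phi> :: "'a::euclidean_space \<Rightarrow> real"
  assumes conv: "convex_on S \<phi>" and S: "x \<in> S" "y \<in> S" and D: "GDERIV \<phi> x :> D"
  shows "\<phi> x + D \<bullet> (y - x) \<le> \<phi> y"
proof -
  have "((\<lambda>s. \<phi> (x + s *\<^sub>R (y - x))) has_real_derivative (y - x) \<bullet> D) (at 0)"
    using D by (intro GDERIV_along_line) simp
  then have lim: "((\<lambda>s. (\<phi> (x + s *\<^sub>R (y - x)) - \<phi> x) / s) \<longlongrightarrow> (y - x) \<bullet> D) (at_right 0)"
    unfolding DERIV_def by (auto intro: tendsto_within_subset)
  have "(\<phi> (x + s *\<^sub>R (y - x)) - \<phi> x) / s \<le> \<phi> y - \<phi> x" if "0 < s" "s < 1" for s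
  proof -
    have "\<phi> ((1 - s) *\<^sub>R x + s *\<^sub>R y) \<le> (1 - s) * \<phi> x + s * \<phi> y"
      using convex_onD[OF conv, of s x y] S that by simp
    moreover have "(1 - s) *\<^sub>R x + s *\<^sub>R y = x + s *\<^sub>R (y - x)"
      by (simp add: algebra_simps)
    ultimately have "\<phi> (x + s *\<^sub>R (y - x)) - \<phi> x \<le> s * (\<phi> y - \<phi> x)"
      by (simp add: algebra_simps)
    then show ?thesis
      using that by (simp add: divide_le_eq mult.commute)
  qed
  then have "(y - x) \<bullet> D \<le> \<phi> y - \<phi> x"
    by (intro tendsto_upperbound[OF lim])
      (auto simp: eventually_at_right_field intro!: exI[of _ 1])
  then show ?thesis
    by (simp add: inner_commute)
qed

text \<open>Subtracting the quadratic turns strong convexity into convexity; its tangent inequality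
  then carries the quadratic as a surplus.\<close>

lemma strongly_convex_tangent:
  fixes l :: "'a::euclidean_space \<Rightarrow> real"
  assumes "strongly_convex_on S l" and l: "\<And>y. GDERIV l y :> dl y"
  shows "\<exists>\<sigma>>0. \<forall>x\<in>S. \<forall>y\<in>S. l x + dl x \<bullet> (y - x) + \<sigma> / 2 * (norm (y - x))\<^sup>2 \<le> l y"
proof -
  obtain \<sigma> where \<sigma>: "\<sigma> > 0" and conv: "convex_on S (\<lambda>y. l y - \<sigma> / 2 * (norm y)\<^sup>2)"
    using assms(1) unfolding strongly_convex_on_def by blast
  have "l x + dl x \<bullet> (y - x) + \<sigma> / 2 * (norm (y - x))\<^sup>2 \<le> l y" if "x \<in> S" "y \<in> S" for x y
  proof -
    have "GDERIV (\<lambda>y. l y - \<sigma> / 2 * (norm y)\<^sup>2) x :> dl x - \<sigma> *\<^sub>R x"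
      using l[of x] unfolding gderiv_def power2_norm_eq_inner
      by (auto intro!: derivative_eq_intros
          simp: inner_diff_right inner_commute algebra_simps fun_eq_iff)
    from convex_on_tangent[OF conv that this]
    show ?thesis
      by (simp add: power2_norm_eq_inner inner_diff_left inner_diff_right inner_commute algebra_simps)
  qed
  with \<sigma> show ?thesis
    by blast
qed

section \<open>The Kurdyka-Lojasiewicz inequality along a subspace\<close>

definition directions :: "'a::euclidean_space set \<Rightarrow> 'a set" where
  "directions D = span {z - z' | z z'. z \<in> D \<and> z' \<in> D}"

text \<open>The Kurdyka-Lojasiewicz inequality with exponent one half for \<open>F\<close> restricted to the affine
  subspaces \<open>xb + W\<close>. The vector \<open>v\<close> is any representative of the gradient modulo the orthogonal
  complement of \<open>W\<close>; a subgradient of \<open>F\<close> plus the indicator of a piece with directions \<open>W\<close>, taken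
  at a point of the piece, is one.\<close>

definition kl_half_along :: "('a::euclidean_space \<Rightarrow> real) \<Rightarrow> ('a \<Rightarrow> 'a) \<Rightarrow> 'a set \<Rightarrow> bool" where
  "kl_half_along F dF W \<longleftrightarrow>
     (\<forall>xb. (\<forall>w\<in>W. dF xb \<bullet> w = 0) \<longrightarrow>
        (\<exists>c\<ge>0. \<forall>x v. x - xb \<in> W \<and> norm (x - xb) \<le> 1 \<and> (\<forall>w\<in>W. (dF x - v) \<bullet> w = 0)
           \<longrightarrow> F x - F xb \<le> c * (norm v)\<^sup>2))"

lemma kl_half_alongE:
  assumes kl: "kl_half_along F dF W" and crit: "\<forall>w\<in>W. dF xb \<bullet> w = 0"
  obtains c where "0 \<le> c" "\<And>x v. x - xb \<in> W \<Longrightarrow> norm (x - xb) \<le> 1 \<Longrightarrow>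
    (\<forall>w\<in>W. (dF x - v) \<bullet> w = 0) \<Longrightarrow> F x - F xb \<le> c * (norm v)\<^sup>2"
proof -
  from kl[unfolded kl_half_along_def, THEN spec, THEN mp, OF crit] obtain c where
    "0 \<le> c" "\<forall>x v. x - xb \<in> W \<and> norm (x - xb) \<le> 1 \<and> (\<forall>w\<in>W. (dF x - v) \<bullet> w = 0)
      \<longrightarrow> F x - F xb \<le> c * (norm v)\<^sup>2"
    by (elim exE conjE)
  then show thesis
    by (intro that) blast+
qed

lemma orthogonal_split_in_subspace:
  fixes N W :: "'a::euclidean_space set"
  assumes "subspace N" "subspace W" "N \<subseteq> W" "d \<in> W"
  obtains n e where "n \<in> N" "e \<in> W" "\<And>u. u \<in> N \<Longrightarrow> e \<bullet> u = 0" "d = n + e"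
proof -
  obtain n e where ne: "n \<in> span N" "\<And>w. w \<in> span N \<Longrightarrow> orthogonal e w" "d = n + e"
    using orthogonal_subspace_decomp_exists[of N d] by blast
  have "span N = N"
    using assms(1) by simp
  moreover have "e \<in> W"
    using subspace_diff[OF assms(2,4), of n] ne assms(3) \<open>span N = N\<close> by auto
  ultimately show thesis
    using that[of n e] ne unfolding orthogonal_def by metis
qed

text \<open>Composing \<open>B\<close> with the orthogonal projection onto \<open>W\<close> gives a linear map that is injective on \<open>E\<close>,
  hence bounded below there, and projecting does not increase the norm of \<open>v\<close>.\<close>

lemma linear_bounded_below_on_complement:
  fixes B :: "'a::euclidean_space \<Rightarrow> 'a" and W :: "'a set"
  assumes B: "linear B" and W: "subspace W"
    and E: "subspace E" "E \<subseteq> W" "\<And>e. e \<in> E \<Longrightarrow> (\<forall>w\<in>W. B e \<bullet> w = 0) \<Longrightarrow> e = 0"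
  shows "\<exists>\<kappa>>0. \<forall>e\<in>E. \<forall>v. (\<forall>w\<in>W. (B e - v) \<bullet> w = 0) \<longrightarrow> \<kappa> * norm e \<le> norm v"
proof -
  obtain S where S: "S \<subseteq> W" "pairwise orthogonal S" "\<And>x. x \<in> S \<Longrightarrow> norm x = 1"
    "independent S" "span S = W"
    using orthonormal_basis_subspace[OF W] by metis
  have fS: "finite S"
    using S(4) independent_imp_finite by blast
  define T where "T e = (\<Sum>s\<in>S. (B e \<bullet> s) *\<^sub>R s)" for e
  have T_inner: "T e \<bullet> w = B e \<bullet> w" if "w \<in> W" for e w
  proof -
    have sT: "T e \<bullet> s = B e \<bullet> s" if "s \<in> S" for s
    proof -
      have "T e \<bullet> s = (\<Sum>r\<in>S. (B e \<bullet> r) * (r \<bullet> s))"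
        by (simp add: T_def inner_sum_left)
      also have "\<dots> = (\<Sum>r\<in>S. if r = s then B e \<bullet> s else 0)"
        using S(2,3) that
        by (intro sum.cong) (auto simp: pairwise_def orthogonal_def norm_eq_1)
      finally show ?thesis
        using fS that by simp
    qed
    have "w \<in> span S"
      using that S(5) by simp
    then have "(T e - B e) \<bullet> w = 0"
      by (induction rule: span_induct)
        (auto simp: subspace_def inner_add_right inner_diff_left sT)
    then show ?thesis
      by (simp add: inner_diff_left)
  qed
  have TW: "T e \<in> W" for e
    unfolding T_def using S(1) W by (auto intro!: subspace_sum subspace_scale)
  have "linear T"
    unfolding T_def using B
    by (intro linear_compose_sum ballI)
      (auto intro!: linearI simp: linear_add linear_scale inner_add_left algebra_simps)
  then have "bounded_linear T"
    by (simp add: linear_conv_bounded_linear)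
  moreover have "\<forall>e\<in>E. T e = 0 \<longrightarrow> e = 0"
    using E(3) T_inner by (metis inner_zero_left)
  ultimately obtain \<kappa> where \<kappa>: "\<kappa> > 0" "\<And>e. e \<in> E \<Longrightarrow> norm (T e) \<ge> \<kappa> * norm e"
    using injective_imp_isometric[of E T] E(1) closed_subspace by blast
  have "\<kappa> * norm e \<le> norm v" if e: "e \<in> E" and v: "\<forall>w\<in>W. (B e - v) \<bullet> w = 0" for e v
  proof -
    have "T e \<bullet> T e = v \<bullet> T e"
      using v T_inner[OF TW] TW by (simp add: inner_diff_left)
    then have "norm (T e) * norm (T e) \<le> norm v * norm (T e)"
      by (metis norm_cauchy_schwarz power2_norm_eq_inner power2_eq_square)
    then have "norm (T e) \<le> norm v"
      by (metis mult_le_cancel_right norm_ge_zero norm_zero order_le_less not_less)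
    with \<kappa>(2)[OF e] show ?thesis
      by linarith
  qed
  with \<kappa>(1) show ?thesis
    by blast
qed

text \<open>With \<open>N\<close> the kernel of the restricted form and \<open>x - xb = n + e\<close>, the increase of \<open>F\<close> is exactly
  half of \<open>B e \<bullet> e = v \<bullet> e\<close>, and \<open>B\<close> is bounded below on the orthogonal complement of \<open>N\<close> in \<open>W\<close>.\<close>

lemma kl_half_along_quadratic:
  fixes B :: "'a::euclidean_space \<Rightarrow> 'a"
  assumes B: "linear B" "\<And>x y. B x \<bullet> y = x \<bullet> B y" and W: "subspace W"
    and F: "\<And>x. F x = 1 / 2 * (x \<bullet> B x) + a \<bullet> x + \<tau>" and dF: "\<And>x. dF x = B x + a"
  shows "kl_half_along F dF W"
  unfolding kl_half_along_def
proof (intro allI impI)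
  fix xb assume crit: "\<forall>w\<in>W. dF xb \<bullet> w = 0"
  define N where "N = {n\<in>W. \<forall>w\<in>W. B n \<bullet> w = 0}"
  define E where "E = {e\<in>W. \<forall>n\<in>N. e \<bullet> n = 0}"
  have N: "subspace N" "N \<subseteq> W"
    using W B(1) unfolding N_def subspace_def
    by (auto simp: linear_add linear_scale linear_0 inner_add_left)
  have E: "subspace E" "E \<subseteq> W"
    using W unfolding E_def subspace_def by (auto simp: inner_add_left)
  have "e = 0" if "e \<in> E" "\<forall>w\<in>W. B e \<bullet> w = 0" for e
  proof -
    have "e \<in> N"
      using that by (auto simp: N_def E_def)
    then show ?thesis
      using that(1) by (auto simp: E_def)
  qed
  from linear_bounded_below_on_complement[OF B(1) W E this]
  obtain \<kappa> where \<kappa>: "\<kappa> > 0"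
    "\<And>e v. e \<in> E \<Longrightarrow> \<forall>w\<in>W. (B e - v) \<bullet> w = 0 \<Longrightarrow> \<kappa> * norm e \<le> norm v"
    by blast
  have "F x - F xb \<le> 1 / (2 * \<kappa>) * (norm v)\<^sup>2"
    if d: "x - xb \<in> W" and v: "\<forall>w\<in>W. (dF x - v) \<bullet> w = 0" for x v
  proof -
    obtain n e where ne: "n \<in> N" "e \<in> W" "\<And>u. u \<in> N \<Longrightarrow> e \<bullet> u = 0" "x - xb = n + e"
      using orthogonal_split_in_subspace[OF N(1) W N(2) d] by metis
    have Bn: "B n \<bullet> w = 0" if "w \<in> W" for w
      using ne(1) that by (auto simp: N_def)
    have nW: "n \<in> W"
      using ne(1) N(2) by blast
    have x: "x = xb + (n + e)"
      using ne(4) by (simp add: algebra_simps)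
    have Bx: "B x = B xb + B n + B e"
      by (simp add: x linear_add[OF B(1)])
    have Be: "(B e - v) \<bullet> w = 0" if "w \<in> W" for w
    proof -
      have "(B xb + a) \<bullet> w = 0" "(B x + a - v) \<bullet> w = 0"
        using that crit v by (auto simp: dF)
      with Bn[OF that] show ?thesis
        unfolding Bx by (simp add: inner_add_left inner_diff_left)
    qed
    have bound: "\<kappa> * norm e \<le> norm v"
      using \<kappa>(2)[of e v] Be ne by (auto simp: E_def)
    have "F x - F xb = 1 / 2 * (B e \<bullet> e)"
    proof -
      have "(B xb + a) \<bullet> (n + e) = 0"
        using crit W nW ne(2) by (auto simp: dF intro: subspace_add)
      moreover have "B n \<bullet> n = 0" "B n \<bullet> e = 0" "n \<bullet> B e = 0"
        using Bn[OF nW] Bn[OF ne(2)] B(2)[of n e] by auto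
      moreover have "xb \<bullet> B (n + e) = B xb \<bullet> (n + e)"
        using B(2) by metis
      ultimately show ?thesis
        unfolding F Bx unfolding x
        by (simp add: inner_add_left inner_add_right linear_add[OF B(1)] inner_commute
            algebra_simps)
    qed
    also have "B e \<bullet> e = v \<bullet> e"
      using Be[OF ne(2)] by (simp add: inner_diff_left)
    also have "v \<bullet> e \<le> norm v * norm e"
      by (rule norm_cauchy_schwarz)
    also have "norm v * norm e \<le> norm v * (norm v / \<kappa>)"
      using bound \<kappa>(1) by (intro mult_left_mono) (auto simp: field_simps)
    finally show ?thesis
      by (simp add: power2_eq_square field_simps)
  qed
  then show "\<exists>c\<ge>0. \<forall>x v. x - xb \<in> W \<and> norm (x - xb) \<le> 1 \<and> (\<forall>w\<in>W. (dF x - v) \<bullet> w = 0)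
      \<longrightarrow> F x - F xb \<le> c * (norm v)\<^sup>2"
    using \<kappa>(1) by (intro exI[of _ "1 / (2 * \<kappa>)"]) auto
qed

text \<open>If \<open>B n \<bullet> w\<close> did not vanish, the form would be negative at \<open>n + t w\<close> for a suitable \<open>t\<close> of the
  opposite sign.\<close>

lemma psd_null_vector:
  fixes B :: "'a::euclidean_space \<Rightarrow> 'a"
  assumes B: "linear B" "\<And>x y. B x \<bullet> y = x \<bullet> B y" and W: "subspace W"
    and psd: "\<And>w. w \<in> W \<Longrightarrow> 0 \<le> w \<bullet> B w"
    and n: "n \<in> W" "n \<bullet> B n = 0" and w: "w \<in> W"
  shows "B n \<bullet> w = 0"
proof (rule ccontr)
  define p where "p = B n \<bullet> w"
  define q where "q = w \<bullet> B w"
  assume "B n \<bullet> w \<noteq> 0"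
  then have p: "p \<noteq> 0"
    by (simp add: p_def)
  have q: "q \<ge> 0"
    using psd w by (simp add: q_def)
  define t where "t = - p / (q + 1)"
  have "0 \<le> (n + t *\<^sub>R w) \<bullet> B (n + t *\<^sub>R w)"
    using n w W by (intro psd) (auto intro: subspace_add subspace_scale)
  also have "\<dots> = 2 * t * p + t\<^sup>2 * q"
    using n(2) B(2)[of n w]
    by (simp add: linear_add[OF B(1)] linear_scale[OF B(1)] inner_add_left inner_add_right
        p_def q_def power2_eq_square inner_commute)
  also have "\<dots> = - (p\<^sup>2 * (q + 2)) / (q + 1)\<^sup>2"
  proof -
    have tq: "t * (q + 1) = - p"
      using q by (simp add: t_def)
    have "(2 * t * p + t\<^sup>2 * q) * (q + 1)\<^sup>2
        = 2 * (t * (q + 1)) * p * (q + 1) + (t * (q + 1))\<^sup>2 * q"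
      by (simp add: power2_eq_square algebra_simps)
    also have "\<dots> = - (p\<^sup>2 * (q + 2))"
      unfolding tq by (simp add: power2_eq_square algebra_simps)
    finally show ?thesis
      using q by (subst nonzero_eq_divide_eq) auto
  qed
  also have "\<dots> < 0"
    using p q by (intro divide_neg_pos) auto
  finally show False
    by simp
qed

lemma psd_form_coercive:
  fixes B :: "'a::euclidean_space \<Rightarrow> 'a" and A :: "'a \<Rightarrow> 'b::euclidean_space"
  assumes AB: "linear A" "linear B" and E: "subspace E"
    and pos: "\<And>e. e \<in> E \<Longrightarrow> e \<noteq> 0 \<Longrightarrow> 0 < e \<bullet> B e + \<sigma> * (norm (A e))\<^sup>2"
  shows "\<exists>\<kappa>>0. \<forall>e\<in>E. \<kappa> * (norm e)\<^sup>2 \<le> e \<bullet> B e + \<sigma> * (norm (A e))\<^sup>2"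
proof (cases "E \<subseteq> {0}")
  case True
  then show ?thesis
    using linear_0[OF AB(1)] by (intro exI[of _ 1]) auto
next
  case False
  define Q where "Q e = e \<bullet> B e + \<sigma> * (norm (A e))\<^sup>2" for e
  let ?K = "E \<inter> sphere 0 1"
  have scale: "Q e = (norm e)\<^sup>2 * Q (e /\<^sub>R norm e)" if "e \<noteq> 0" for e
    using that by (simp add: Q_def linear_scale[OF AB(1)] linear_scale[OF AB(2)]
        power2_eq_square field_simps)
  have "compact ?K"
    using closed_subspace[OF E] by (simp add: closed_Int_compact)
  moreover obtain z where "z \<in> E" "z \<noteq> 0"
    using False by blast
  then have "z /\<^sub>R norm z \<in> ?K"
    using E by (auto intro: subspace_scale)
  moreover have "continuous_on ?K Q"
    unfolding Q_def using AB
    by (intro continuous_intros linear_continuous_on_compose[OF continuous_on_id]) auto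
  ultimately obtain u where u: "u \<in> ?K" "\<And>e. e \<in> ?K \<Longrightarrow> Q u \<le> Q e"
    using continuous_attains_inf[of ?K Q] by blast
  have "Q u * (norm e)\<^sup>2 \<le> Q e" if "e \<in> E" for e
  proof (cases "e = 0")
    case True
    then show ?thesis
      by (simp add: Q_def linear_0[OF AB(1)])
  next
    case False
    then have "e /\<^sub>R norm e \<in> ?K"
      using that E by (auto intro: subspace_scale)
    then show ?thesis
      using mult_left_mono[OF u(2), of "e /\<^sub>R norm e" "(norm e)\<^sup>2"] scale[OF False]
      by (simp only: mult.commute) simp
  qed
  moreover have "Q u > 0"
    using pos[of u] u(1) by (fastforce simp: Q_def)
  ultimately show ?thesis
    unfolding Q_def by blast
qed

text \<open>Here \<open>F\<close> is constant along \<open>N\<close>, where both \<open>A\<close> and the quadratic form vanish, although \<open>F\<close> need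
  not be quadratic. On the complement the form \<open>e \<bullet> B e + \<sigma> * (norm (A e))\<^sup>2\<close> is positive definite,
  so \<open>F\<close> is strongly convex in the direction \<open>e\<close>. The growth inequality from \<open>xb\<close> to \<open>xb + e\<close> and
  the reverse one together bound \<open>norm e\<close> by \<open>norm v\<close>.\<close>

lemma kl_half_along_convex:
  fixes A :: "'a::euclidean_space \<Rightarrow> 'b::euclidean_space" and B :: "'a \<Rightarrow> 'a"
  assumes A: "linear A" "\<And>y z. A y \<bullet> z = y \<bullet> A' z"
    and l: "\<And>y. GDERIV l y :> dl y" "\<And>S. compact S \<Longrightarrow> convex S \<Longrightarrow> strongly_convex_on S l"
    and B: "linear B" "\<And>x y. B x \<bullet> y = x \<bullet> B y" and W: "subspace W"
    and psd: "\<And>w. w \<in> W \<Longrightarrow> 0 \<le> w \<bullet> B w"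
    and F: "\<And>x. F x = l (A x) + (1 / 2 * (x \<bullet> B x) + a \<bullet> x + \<tau>)"
    and dF: "\<And>x. dF x = A' (dl (A x)) + (B x + a)"
  shows "kl_half_along F dF W"
  unfolding kl_half_along_def
proof (intro allI impI)
  fix xb assume crit: "\<forall>w\<in>W. dF xb \<bullet> w = 0"
  define N where "N = {n\<in>W. A n = 0 \<and> (\<forall>w\<in>W. B n \<bullet> w = 0)}"
  define E where "E = {e\<in>W. \<forall>n\<in>N. e \<bullet> n = 0}"
  have N: "subspace N" "N \<subseteq> W"
    using W A(1) B(1) unfolding N_def subspace_def
    by (auto simp: linear_add linear_scale linear_0 inner_add_left)
  have E: "subspace E" "E \<subseteq> W"
    using W unfolding E_def subspace_def by (auto simp: inner_add_left)
  have "compact (A ` cball xb 1)" "convex (A ` cball xb 1)"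
    using A(1) by (auto intro!: compact_continuous_image linear_continuous_on
        convex_linear_image simp: linear_conv_bounded_linear)
  from strongly_convex_tangent[OF l(2)[OF this] l(1)] obtain \<sigma> where \<sigma>: "\<sigma> > 0"
    and tangent: "\<And>x y. x \<in> cball xb 1 \<Longrightarrow> y \<in> cball xb 1 \<Longrightarrow>
      l (A x) + dl (A x) \<bullet> (A y - A x) + \<sigma> / 2 * (norm (A y - A x))\<^sup>2 \<le> l (A y)"
    by blast
  have pos: "0 < e \<bullet> B e + \<sigma> * (norm (A e))\<^sup>2" if "e \<in> E" "e \<noteq> 0" for e
  proof (rule ccontr)
    assume neg: "\<not> ?thesis"
    have "0 \<le> e \<bullet> B e" "0 \<le> \<sigma> * (norm (A e))\<^sup>2"
      using psd that E(2) \<sigma> by auto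
    with neg have "e \<bullet> B e = 0" "\<sigma> * (norm (A e))\<^sup>2 = 0"
      by linarith+
    then have "e \<in> N"
      using psd_null_vector[OF B W psd, of e] that E(2) \<sigma> by (auto simp: N_def)
    then show False
      using that by (auto simp: E_def)
  qed
  obtain \<kappa> where \<kappa>: "\<kappa> > 0"
    "\<And>e. e \<in> E \<Longrightarrow> \<kappa> * (norm e)\<^sup>2 \<le> e \<bullet> B e + \<sigma> * (norm (A e))\<^sup>2"
    using psd_form_coercive[OF A(1) B(1) E(1) pos] by blast
  have growth: "F x + dF x \<bullet> (y - x) + 1 / 2 * (\<kappa> * (norm (y - x))\<^sup>2) \<le> F y"
    if "x \<in> cball xb 1" "y \<in> cball xb 1" "y - x \<in> E" for x y
  proof -
    have "dl (A x) \<bullet> (A y - A x) = A' (dl (A x)) \<bullet> (y - x)"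
      using A by (metis linear_diff inner_commute)
    moreover have "(norm (A y - A x)) = norm (A (y - x))"
      by (simp add: linear_diff[OF A(1)])
    moreover have "1 / 2 * (y \<bullet> B y) = 1 / 2 * (x \<bullet> B x) + B x \<bullet> (y - x)
        + 1 / 2 * ((y - x) \<bullet> B (y - x))"
      using B(2)[of x y]
      by (simp add: linear_diff[OF B(1)] inner_diff_left inner_diff_right inner_commute algebra_simps)
    ultimately show ?thesis
      using tangent[OF that(1,2)] \<kappa>(2)[OF that(3)] unfolding F dF
      by (simp add: inner_add_left inner_diff_right algebra_simps)
  qed
  have "F x - F xb \<le> 1 / \<kappa> * (norm v)\<^sup>2"
    if d: "x - xb \<in> W" and d1: "norm (x - xb) \<le> 1" and v: "\<forall>w\<in>W. (dF x - v) \<bullet> w = 0" for x v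
  proof -
    obtain n e where ne: "n \<in> N" "e \<in> W" "\<And>u. u \<in> N \<Longrightarrow> e \<bullet> u = 0" "x - xb = n + e"
      using orthogonal_split_in_subspace[OF N(1) W N(2) d] by metis
    have n: "n \<in> W" "A n = 0" "\<And>w. w \<in> W \<Longrightarrow> B n \<bullet> w = 0"
      using ne(1) by (auto simp: N_def)
    have x: "x = (xb + e) + n"
      using ne(4) by (simp add: algebra_simps)
    have "e \<in> E"
      using ne by (auto simp: E_def)
    then have eE: "e \<in> E" "- e \<in> E"
      using E(1) by (auto simp: subspace_neg)
    have Ax: "A x = A (xb + e)"
      by (simp add: x linear_add[OF A(1)] n(2))
    have "dF x = dF (xb + e) + B n"
      unfolding dF Ax by (simp add: x linear_add[OF B(1)] algebra_simps)
    then have dFe: "dF (xb + e) \<bullet> e = v \<bullet> e"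
      using v ne(2) n(3) by (simp add: inner_add_left inner_diff_left)
    have Fx: "F x = F (xb + e)"
    proof -
      have "dF xb \<bullet> n = 0"
        using crit n(1) by blast
      moreover have "A' (dl (A xb)) \<bullet> n = 0"
        using A(2)[of n] n(2) by (metis inner_commute inner_zero_left)
      ultimately have "(B xb + a) \<bullet> n = 0"
        by (simp add: dF inner_add_left)
      moreover have "B n \<bullet> n = 0" "B n \<bullet> e = 0" "n \<bullet> B e = 0" "xb \<bullet> B n = n \<bullet> B xb"
        using n(3)[OF n(1)] n(3)[OF ne(2)] B(2)[of n e] B(2)[of xb n]
        by (auto simp: inner_commute)
      ultimately show ?thesis
        unfolding F Ax unfolding x
        by (simp add: inner_add_left inner_add_right linear_add[OF B(1)] inner_commute
            algebra_simps)
    qed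
    have "n \<bullet> e = 0"
      using ne(3)[OF ne(1)] by (simp add: inner_commute)
    then have "(norm e)\<^sup>2 \<le> (norm (x - xb))\<^sup>2"
      unfolding ne(4) by (simp add: norm_add_Pythagorean orthogonal_def)
    then have "norm e \<le> norm (x - xb)"
      by (rule power2_le_imp_le) simp
    then have balls: "xb + e \<in> cball xb 1" "xb \<in> cball xb 1"
      using d1 by (auto simp: dist_norm)
    have up: "F (xb + e) - v \<bullet> e + 1 / 2 * (\<kappa> * (norm e)\<^sup>2) \<le> F xb"
      using growth[OF balls] eE dFe by simp
    have "F xb + 1 / 2 * (\<kappa> * (norm e)\<^sup>2) \<le> F (xb + e)"
      using growth[OF balls(2,1)] eE crit ne(2) by simp
    with up have "\<kappa> * (norm e)\<^sup>2 \<le> v \<bullet> e"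
      by linarith
    also have ve: "v \<bullet> e \<le> norm v * norm e"
      by (rule norm_cauchy_schwarz)
    finally have "\<kappa> * norm e \<le> norm v"
      by (cases "e = 0") (auto simp: power2_eq_square)
    then have "norm v * norm e \<le> norm v * (norm v / \<kappa>)"
      using \<kappa>(1) by (intro mult_left_mono) (auto simp: field_simps)
    moreover have "F x - F xb \<le> v \<bullet> e"
    proof -
      have "0 \<le> \<kappa> * (norm e)\<^sup>2"
        using \<kappa>(1) by simp
      with up show ?thesis
        unfolding Fx by linarith
    qed
    ultimately have "F x - F xb \<le> norm v * (norm v / \<kappa>)"
      using ve by linarith
    then show ?thesis
      by (simp add: power2_eq_square)
  qed
  then show "\<exists>c\<ge>0. \<forall>x v. x - xb \<in> W \<and> norm (x - xb) \<le> 1 \<and> (\<forall>w\<in>W. (dF x - v) \<bullet> w = 0)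
      \<longrightarrow> F x - F xb \<le> c * (norm v)\<^sup>2"
    using \<kappa>(1) by (intro exI[of _ "1 / \<kappa>"]) auto
qed

section \<open>First order conditions on relatively open pieces\<close>

lemma subspace_directions: "subspace (directions D)"
  by (simp add: directions_def)

lemma diff_closure_in_directions:
  assumes "x \<in> D" "y \<in> closure D"
  shows "x - y \<in> directions D"
proof -
  obtain s where s: "\<And>n. s n \<in> D" "s \<longlonglongrightarrow> y"
    using assms(2) unfolding closure_sequential by blast
  have "x - s n \<in> directions D" for n
    unfolding directions_def using s(1) assms(1) by (blast intro: span_base)
  moreover have "(\<lambda>n. x - s n) \<longlonglongrightarrow> x - y"
    by (intro tendsto_intros s)
  ultimately show ?thesis
    by (rule closed_sequentially[OF closed_subspace[OF subspace_directions]])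
qed

lemma rel_open_line:
  assumes D: "rel_open D" and x: "x \<in> D" and w: "w \<in> directions D"
  shows "\<exists>e>0. \<forall>s. \<bar>s\<bar> \<le> e \<longrightarrow> x + s *\<^sub>R w \<in> D"
proof -
  obtain r where r: "r > 0" "cball x r \<inter> affine hull D \<subseteq> D"
    using D x unfolding rel_open_def by (metis mem_rel_interior_cball)
  have "directions D \<subseteq> span {z - x | z. z \<in> D - {x}}"
    unfolding directions_def
  proof (rule span_minimal)
    have "z - x \<in> span {z - x | z. z \<in> D - {x}}" if "z \<in> D" for z
      using that by (cases "z = x") (auto intro: span_base span_zero)
    then show "{z - z' | z z'. z \<in> D \<and> z' \<in> D} \<subseteq> span {z - x | z. z \<in> D - {x}}"
      using span_diff by fastforce
  qed simp
  then have hull: "x + s *\<^sub>R w \<in> affine hull D" for s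
    using w x by (auto simp: affine_hull_span intro: span_scale)
  define e where "e = r / (norm w + 1)"
  have "x + s *\<^sub>R w \<in> D" if s: "\<bar>s\<bar> \<le> e" for s
  proof -
    have "\<bar>s\<bar> * norm w \<le> e * (norm w + 1)"
      using s by (intro mult_mono) auto
    also have "\<dots> = r"
      by (simp add: e_def add_nonneg_eq_0_iff)
    finally show ?thesis
      using r hull by (auto simp: dist_norm)
  qed
  moreover have "e > 0"
    using r(1) by (simp add: e_def add_nonneg_pos)
  ultimately show ?thesis
    by blast
qed

lemma first_order_rel_open:
  assumes D: "rel_open D" and x: "x \<in> D" and G: "GDERIV \<psi> x :> G"
    and min: "\<And>z. z \<in> D \<Longrightarrow> \<psi> x \<le> \<psi> z" and w: "w \<in> directions D"
  shows "G \<bullet> w = 0"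
proof -
  obtain e where e: "e > 0" "\<And>s. \<bar>s\<bar> \<le> e \<Longrightarrow> x + s *\<^sub>R w \<in> D"
    using rel_open_line[OF D x w] by blast
  have "((\<lambda>s. \<psi> (x + s *\<^sub>R w)) has_real_derivative w \<bullet> G) (at 0)"
    using G by (intro GDERIV_along_line) simp
  moreover have "\<forall>s. \<bar>0 - s\<bar> < e \<longrightarrow> \<psi> (x + 0 *\<^sub>R w) \<le> \<psi> (x + s *\<^sub>R w)"
    using min e(2) by simp
  ultimately have "w \<bullet> G = 0"
    using e(1) DERIV_local_min by blast
  then show ?thesis
    by (simp add: inner_commute)
qed

section \<open>Linear convergence of descent schemes\<close>

text \<open>A triple \<open>(D, q, dq)\<close> is a piece of \<open>P\<close> with a smooth function and its gradient. Asking only for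
  \<open>P z \<le> ereal (q z)\<close> on \<open>D\<close>, with equality for some piece at each point of the domain, admits
  minima of several functions.\<close>

definition kl_pieces ::
    "('a::euclidean_space \<Rightarrow> real) \<Rightarrow> ('a \<Rightarrow> 'a) \<Rightarrow> ('a \<Rightarrow> ereal) \<Rightarrow>
      ('a set \<times> ('a \<Rightarrow> real) \<times> ('a \<Rightarrow> 'a)) set \<Rightarrow> bool" where
  "kl_pieces h g P \<D> \<longleftrightarrow> finite \<D> \<and>
     (\<forall>(D, q, dq)\<in>\<D>. rel_open D \<and> (\<forall>z. GDERIV q z :> dq z) \<and>
        continuous_on UNIV dq \<and> (\<forall>z\<in>D. P z \<le> ereal (q z)) \<and>
        kl_half_along (\<lambda>z. h z + q z) (\<lambda>z. g z + dq z) (directions D)) \<and>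
     (\<forall>z. P z < \<infinity> \<longrightarrow> (\<exists>(D, q, dq)\<in>\<D>. z \<in> D \<and> P z = ereal (q z)))"

lemma converges_locally_linearly_geometric:
  fixes x :: "nat \<Rightarrow> 'a::euclidean_space"
  assumes \<tau>: "0 < \<tau>" "\<tau> < 1" and M: "0 < M"
    and step: "\<And>k. k \<ge> K \<Longrightarrow> norm (x (Suc k) - x k) \<le> M * \<tau> ^ k"
  shows "\<exists>xb. converges_locally_linearly x xb"
proof -
  define B where "B = M / (1 - \<tau>)"
  have B: "B > 0"
    using assms by (simp add: B_def)
  have B1: "B * (1 - \<tau>) = M"
    using \<tau> by (simp add: B_def)
  have dist: "norm (x (k + j) - x k) \<le> B * \<tau> ^ k * (1 - \<tau> ^ j)" if "k \<ge> K" for k j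
  proof (induction j)
    case (Suc j)
    have "norm (x (k + Suc j) - x k) \<le> norm (x (Suc (k + j)) - x (k + j)) + norm (x (k + j) - x k)"
      using norm_triangle_ineq[of "x (Suc (k + j)) - x (k + j)" "x (k + j) - x k"] by simp
    also have "\<dots> \<le> M * \<tau> ^ (k + j) + B * \<tau> ^ k * (1 - \<tau> ^ j)"
      using step[of "k + j"] Suc that by simp
    also have "\<dots> = B * \<tau> ^ k * (1 - \<tau> ^ Suc j)"
      unfolding B1[symmetric] by (simp add: power_add algebra_simps)
    finally show ?case .
  qed simp
  have dist': "norm (x (k + j) - x k) \<le> B * \<tau> ^ k" if "k \<ge> K" for k j
  proof -
    have "B * \<tau> ^ k * (1 - \<tau> ^ j) \<le> B * \<tau> ^ k * 1"
      using B \<tau> by (intro mult_left_mono) auto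
    with dist[OF that, of j] show ?thesis
      by simp
  qed
  have geom: "(\<lambda>k. B * \<tau> ^ k) \<longlonglongrightarrow> 0"
    using \<tau> by (auto intro!: tendsto_mult_right_zero LIMSEQ_power_zero)
  have "Cauchy x"
  proof (rule metric_CauchyI)
    fix e :: real assume "e > 0"
    then have "eventually (\<lambda>k. B * \<tau> ^ k < e / 2) sequentially"
      using geom by (intro order_tendstoD(2)) auto
    then obtain k0 where k0: "B * \<tau> ^ k < e / 2" if "k \<ge> k0" for k
      unfolding eventually_sequentially by blast
    define k where "k = max k0 K"
    have close: "dist (x n) (x k) < e / 2" if "n \<ge> k" for n
      using dist'[of k "n - k"] k0[of k] that by (simp add: k_def dist_norm)
    show "\<exists>N. \<forall>m\<ge>N. \<forall>n\<ge>N. dist (x m) (x n) < e"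
    proof (intro exI allI impI)
      fix m n assume "m \<ge> k" "n \<ge> k"
      then show "dist (x m) (x n) < e"
        using close[of m] close[of n] dist_triangle2[of "x m" "x n" "x k"] by linarith
    qed
  qed
  then obtain xb where xb: "x \<longlonglongrightarrow> xb"
    using Cauchy_convergent_iff convergent_def by blast
  have err: "norm (x k - xb) \<le> B * \<tau> ^ k" if "k \<ge> K" for k
  proof -
    have "(\<lambda>j. norm (x (k + j) - x k)) \<longlonglongrightarrow> norm (xb - x k)"
      using LIMSEQ_ignore_initial_segment[OF xb, of k] by (intro tendsto_intros) (simp add: add.commute)
    then have "norm (xb - x k) \<le> B * \<tau> ^ k"
      using dist'[OF that] by (intro LIMSEQ_le_const2) auto
    then show ?thesis
      by (simp add: norm_minus_commute)
  qed
  have "limsup (\<lambda>k. ereal (root k (norm (x k - xb)))) \<le> limsup (\<lambda>k. ereal (root k B * \<tau>))"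
  proof (rule Limsup_mono, unfold eventually_sequentially, intro exI allI impI)
    fix k assume k: "max 1 K \<le> k"
    then have "root k (norm (x k - xb)) \<le> root k (B * \<tau> ^ k)"
      using err[of k] by (intro real_root_le_mono) auto
    also have "\<dots> = root k B * \<tau>"
      using k \<tau> by (simp add: real_root_mult real_root_power_cancel)
    finally show "ereal (root k (norm (x k - xb))) \<le> ereal (root k B * \<tau>)"
      by simp
  qed
  also have "(\<lambda>k. root k B * \<tau>) \<longlonglongrightarrow> 1 * \<tau>"
    by (intro tendsto_intros LIMSEQ_root_const B)
  then have "limsup (\<lambda>k. ereal (root k B * \<tau>)) = ereal \<tau>"
    by (intro lim_imp_Limsup) auto
  finally have "limsup (\<lambda>k. ereal (root k (norm (x k - xb)))) < 1"
    using \<tau>(2) by (metis ereal_less_eq(3) less_ereal.simps(1) one_ereal_def order_le_less_trans)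
  with xb show ?thesis
    unfolding converges_locally_linearly_def by blast
qed

text \<open>The common form of both algorithms. The vector \<open>m k\<close> is the inertial term, \<open>D k\<close> a squared step
  length that dominates everything the residual of the first order condition is made of, and \<open>H k\<close>
  the quantity that decreases; it exceeds the objective value by at most \<open>C * D\<close>.\<close>

locale descent_scheme =
  fixes h :: "'a::euclidean_space \<Rightarrow> real" and g :: "'a \<Rightarrow> 'a" and L :: real and P :: "'a \<Rightarrow> ereal"
    and \<D> and x m :: "nat \<Rightarrow> 'a" and p \<gamma> H D :: "nat \<Rightarrow> real" and \<gamma>0 \<epsilon> C :: real
  assumes h_deriv: "\<And>z. GDERIV h z :> g z" and L: "L-lipschitz_on UNIV g"
    and pieces: "kl_pieces h g P \<D>"
    and closed: "closed_fun P" and P_not_minf: "\<And>z. P z \<noteq> -\<infinity>"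
    and bounded: "bounded (range x)" and \<gamma>0: "0 < \<gamma>0" "\<And>k. \<gamma>0 \<le> \<gamma> k"
    and P_x: "\<And>k. P (x k) = ereal (p k)"
    and minimal: "\<And>k z.
      ereal ((g (x k) - m k) \<bullet> (x (Suc k) - x k) + 1 / (2 * \<gamma> k) * (norm (x (Suc k) - x k))\<^sup>2)
        + P (x (Suc k))
      \<le> ereal ((g (x k) - m k) \<bullet> (z - x k) + 1 / (2 * \<gamma> k) * (norm (z - x k))\<^sup>2) + P z"
    and \<epsilon>: "0 < \<epsilon>" and C: "0 \<le> C"
    and decrease: "\<And>k. \<epsilon> * D k \<le> H k - H (Suc k)"
    and step: "\<And>k. (norm (x (Suc k) - x k))\<^sup>2 \<le> D k"
    and inertia: "\<And>k. (norm (m k))\<^sup>2 \<le> C * D k"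
    and value_le: "\<And>k. h (x k) + p k \<le> H k"
    and value_ge: "\<And>k. H (Suc k) \<le> h (x (Suc k)) + p (Suc k) + C * D k"
begin

lemma D_nonneg: "0 \<le> D k"
  using step[of k] zero_le_power2 order_trans by blast

lemma decseq_H: "decseq H"
  using decrease D_nonneg \<epsilon> by (intro decseq_SucI) (smt (verit) mult_nonneg_nonneg)

lemma h_cont: "continuous_on S h"
  using h_deriv unfolding gderiv_def
  by (intro continuous_at_imp_continuous_on ballI has_derivative_continuous) blast

lemma g_cont: "continuous_on S g"
  by (rule continuous_on_subset[OF lipschitz_on_continuous_on[OF L]]) simp

lemma piece_of_iterate:
  obtains S q dq where "(S, q, dq) \<in> \<D>" "x k \<in> S" "p k = q (x k)"
proof -
  have "P (x k) < \<infinity>"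
    by (simp add: P_x)
  then obtain t where "t \<in> \<D>" "case t of (S, q, dq) \<Rightarrow> x k \<in> S \<and> P (x k) = ereal (q (x k))"
    using pieces unfolding kl_pieces_def by blast
  then show thesis
    using that P_x[of k] by (cases t) auto
qed

lemma pieceD:
  assumes "(S, q, dq) \<in> \<D>"
  shows "rel_open S" "\<And>z. GDERIV q z :> dq z" "continuous_on UNIV dq"
    "\<And>z. z \<in> S \<Longrightarrow> P z \<le> ereal (q z)"
    "kl_half_along (\<lambda>z. h z + q z) (\<lambda>z. g z + dq z) (directions S)"
  using pieces assms unfolding kl_pieces_def by blast+

lemma piece_cont:
  assumes "(S, q, dq) \<in> \<D>"
  shows "continuous_on T q"
  using pieceD(2)[OF assms] unfolding gderiv_def
  by (intro continuous_at_imp_continuous_on ballI has_derivative_continuous) blast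

text \<open>The values of the objective along the iterates are supplied by finitely many continuous
  functions on a bounded set.\<close>

lemma values_bounded_below: "\<exists>b. \<forall>k. b \<le> H k"
proof -
  obtain R where R: "\<And>k. x k \<in> cball 0 R"
    using bounded unfolding bounded_iff by auto
  define V where "V = (\<Union>(S, q, dq)\<in>\<D>. (\<lambda>z. h z + q z) ` cball 0 R)"
  have "finite \<D>"
    using pieces unfolding kl_pieces_def by blast
  moreover have "bounded ((\<lambda>z. h z + q z) ` cball 0 R)" if "(S, q, dq) \<in> \<D>" for S q dq
    using piece_cont[OF that] h_cont
    by (intro compact_imp_bounded compact_continuous_image continuous_on_add) auto
  ultimately have "bounded V"
    unfolding V_def by (intro bounded_UN) auto
  then obtain b where b: "\<And>v. v \<in> V \<Longrightarrow> \<bar>v\<bar> \<le> b"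
    unfolding bounded_iff by auto
  have "- b \<le> H k" for k
  proof -
    obtain S q dq where "(S, q, dq) \<in> \<D>" "p k = q (x k)"
      using piece_of_iterate by metis
    then have "h (x k) + p k \<in> V"
      unfolding V_def using R[of k] by force
    then show ?thesis
      using b value_le[of k] by (smt (verit))
  qed
  then show ?thesis
    by blast
qed

definition Hlim :: real where "Hlim = lim H"

lemma H_tendsto: "H \<longlonglongrightarrow> Hlim" and H_ge: "Hlim \<le> H k"
proof -
  obtain b where "\<forall>k. b \<le> H k"
    using values_bounded_below by blast
  then obtain l where "H \<longlonglongrightarrow> l" "\<forall>k. l \<le> H k"
    using decseq_convergent[OF decseq_H, of b] by blast
  moreover from this have "Hlim = l"
    unfolding Hlim_def by (simp add: limI)
  ultimately show "H \<longlonglongrightarrow> Hlim" "Hlim \<le> H k"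
    by auto
qed

lemma D_tendsto: "D \<longlonglongrightarrow> 0"
proof (rule tendsto_sandwich[of "\<lambda>_. 0" _ _ "\<lambda>k. (H k - H (Suc k)) / \<epsilon>"])
  have "(\<lambda>k. (H k - H (Suc k)) / \<epsilon>) \<longlonglongrightarrow> (Hlim - Hlim) / \<epsilon>"
    using \<epsilon> by (intro tendsto_intros H_tendsto LIMSEQ_Suc) auto
  then show "(\<lambda>k. (H k - H (Suc k)) / \<epsilon>) \<longlonglongrightarrow> 0"
    by simp
  show "\<forall>\<^sub>F k in sequentially. D k \<le> (H k - H (Suc k)) / \<epsilon>"
    using decrease \<epsilon> by (auto simp: field_simps)
qed (auto simp: D_nonneg)

lemma tendsto_zero_if_square_le:
  fixes a :: "nat \<Rightarrow> 'a"
  assumes "\<And>k. (norm (a k))\<^sup>2 \<le> c * D k"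
  shows "a \<longlonglongrightarrow> 0"
proof -
  have "(\<lambda>k. sqrt (c * D k)) \<longlonglongrightarrow> sqrt (c * 0)"
    by (intro tendsto_intros D_tendsto)
  then have "(\<lambda>k. sqrt (c * D k)) \<longlonglongrightarrow> 0"
    by simp
  moreover have "\<forall>k. norm (a k) \<le> sqrt (c * D k)"
    using assms real_le_rsqrt by blast
  ultimately show ?thesis
    using Lim_null_comparison[of a "\<lambda>k. sqrt (c * D k)" sequentially]
    by (simp add: always_eventually)
qed

lemma step_tendsto: "(\<lambda>k. x (Suc k) - x k) \<longlonglongrightarrow> 0"
  by (rule tendsto_zero_if_square_le[of _ 1]) (simp add: step)

lemma m_tendsto: "m \<longlonglongrightarrow> 0"
  using inertia by (rule tendsto_zero_if_square_le)

lemma values_tendsto: "(\<lambda>k. h (x k) + p k) \<longlonglongrightarrow> Hlim"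
proof -
  have "(\<lambda>k. h (x (Suc k)) + p (Suc k)) \<longlonglongrightarrow> Hlim"
  proof (rule tendsto_sandwich[of "\<lambda>k. H (Suc k) - C * D k" _ _ "\<lambda>k. H (Suc k)"])
    have "(\<lambda>k. H (Suc k) - C * D k) \<longlonglongrightarrow> Hlim - C * 0"
      by (intro tendsto_intros LIMSEQ_Suc H_tendsto D_tendsto)
    then show "(\<lambda>k. H (Suc k) - C * D k) \<longlonglongrightarrow> Hlim"
      by simp
    show "\<forall>\<^sub>F k in sequentially. H (Suc k) - C * D k \<le> h (x (Suc k)) + p (Suc k)"
      using value_ge by (auto simp: algebra_simps)
    show "\<forall>\<^sub>F k in sequentially. h (x (Suc k)) + p (Suc k) \<le> H (Suc k)"
      by (intro always_eventually allI value_le)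
  qed (rule LIMSEQ_Suc[OF H_tendsto])
  then show ?thesis
    by (rule LIMSEQ_imp_Suc)
qed

text \<open>The gradient of the objective at the new iterate minus the gradient of the model function
  there.\<close>

definition residual :: "nat \<Rightarrow> 'a" where
  "residual k = g (x (Suc k)) - g (x k) + m k - (1 / \<gamma> k) *\<^sub>R (x (Suc k) - x k)"

lemma residual_bound: "\<exists>c\<ge>0. \<forall>k. (norm (residual k))\<^sup>2 \<le> c * D k"
proof -
  define c where "c = L + sqrt C + 1 / \<gamma>0"
  have L0: "L \<ge> 0"
    using L by (rule lipschitz_on_nonneg)
  have "norm (residual k) \<le> c * sqrt (D k)" for k
  proof -
    have s: "norm (x (Suc k) - x k) \<le> sqrt (D k)"
      by (intro real_le_rsqrt step)
    have "norm (g (x (Suc k)) - g (x k)) \<le> L * norm (x (Suc k) - x k)"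
      using lipschitz_onD[OF L] by (simp add: dist_norm)
    also have "\<dots> \<le> L * sqrt (D k)"
      using s L0 by (rule mult_left_mono)
    finally have 1: "norm (g (x (Suc k)) - g (x k)) \<le> L * sqrt (D k)" .
    have 2: "norm (m k) \<le> sqrt C * sqrt (D k)"
      using inertia[of k] by (metis real_le_rsqrt real_sqrt_mult)
    have "norm ((1 / \<gamma> k) *\<^sub>R (x (Suc k) - x k)) = 1 / \<gamma> k * norm (x (Suc k) - x k)"
      using \<gamma>0(1) \<gamma>0(2)[of k] by simp
    also have "\<dots> \<le> 1 / \<gamma>0 * sqrt (D k)"
      using \<gamma>0(1) \<gamma>0(2)[of k] s by (intro mult_mono) (auto simp: frac_le)
    finally have 3: "norm ((1 / \<gamma> k) *\<^sub>R (x (Suc k) - x k)) \<le> 1 / \<gamma>0 * sqrt (D k)" .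
    have "norm (residual k) \<le> norm (g (x (Suc k)) - g (x k)) + norm (m k)
        + norm ((1 / \<gamma> k) *\<^sub>R (x (Suc k) - x k))"
      unfolding residual_def by (meson norm_triangle_ineq norm_triangle_ineq4 order_trans add_right_mono)
    with 1 2 3 show ?thesis
      by (simp add: c_def algebra_simps)
  qed
  then have "(norm (residual k))\<^sup>2 \<le> c\<^sup>2 * D k" for k
    using power_mono[of "norm (residual k)" "c * sqrt (D k)" 2] D_nonneg
    by (simp add: power_mult_distrib)
  then show ?thesis
    by (intro exI[of _ "c\<^sup>2"]) auto
qed

lemma first_order_iterate:
  assumes piece: "(S, q, dq) \<in> \<D>" and S: "x (Suc k) \<in> S" "p (Suc k) = q (x (Suc k))"
    and w: "w \<in> directions S"
  shows "(g (x (Suc k)) + dq (x (Suc k)) - residual k) \<bullet> w = 0"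
proof -
  define u where "u = g (x k) - m k"
  define \<psi> where "\<psi> z = u \<bullet> (z - x k) + 1 / (2 * \<gamma> k) * ((z - x k) \<bullet> (z - x k)) + q z" for z
  define y where "y = x (Suc k)"
  have "(\<psi> has_derivative (\<lambda>d. u \<bullet> d + 1 / (2 * \<gamma> k) * (2 * ((y - x k) \<bullet> d)) + d \<bullet> dq y)) (at y)"
    unfolding \<psi>_def using pieceD(2)[OF piece, of y] \<gamma>0(1) \<gamma>0(2)[of k] unfolding gderiv_def
    by (auto intro!: derivative_eq_intros simp: inner_commute algebra_simps)
  moreover have "(\<lambda>d. u \<bullet> d + 1 / (2 * \<gamma> k) * (2 * ((y - x k) \<bullet> d)) + d \<bullet> dq y)
      = (\<lambda>d. d \<bullet> (u + (1 / \<gamma> k) *\<^sub>R (y - x k) + dq y))"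
    by (auto simp: fun_eq_iff inner_add_right inner_commute)
  ultimately have "GDERIV \<psi> y :> u + (1 / \<gamma> k) *\<^sub>R (y - x k) + dq y"
    unfolding gderiv_def by simp
  moreover have "\<psi> y \<le> \<psi> z" if "z \<in> S" for z
  proof -
    have "ereal (u \<bullet> (y - x k) + 1 / (2 * \<gamma> k) * (norm (y - x k))\<^sup>2) + ereal (q y)
        \<le> ereal (u \<bullet> (z - x k) + 1 / (2 * \<gamma> k) * (norm (z - x k))\<^sup>2) + P z"
      using minimal[of k z] P_x[of "Suc k"] S(2) by (simp add: u_def y_def)
    also have "\<dots> \<le> ereal (u \<bullet> (z - x k) + 1 / (2 * \<gamma> k) * (norm (z - x k))\<^sup>2) + ereal (q z)"
      using pieceD(4)[OF piece that] by (intro add_left_mono)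
    finally show ?thesis
      by (simp add: \<psi>_def power2_norm_eq_inner)
  qed
  ultimately have "(u + (1 / \<gamma> k) *\<^sub>R (y - x k) + dq y) \<bullet> w = 0"
    using first_order_rel_open[OF pieceD(1)[OF piece]] S(1) w unfolding y_def by blast
  moreover have "g (x (Suc k)) + dq (x (Suc k)) - residual k = u + (1 / \<gamma> k) *\<^sub>R (y - x k) + dq y"
    by (simp add: residual_def u_def y_def)
  ultimately show ?thesis
    by simp
qed

text \<open>If no constant worked, there would be iterates with arbitrarily large ratio of gap to squared
  step. Infinitely many of them lie in one piece and a subsequence of these converges to some \<open>xb\<close>.
  The residuals tend to zero, so \<open>xb\<close> is critical along the piece; and \<open>F xb\<close> is the limit of \<open>H\<close> by
  continuity of \<open>F\<close>. Hence the inequality at \<open>xb\<close> contradicts the large ratios.\<close>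

lemma gap_le_step: "\<exists>c>0. \<forall>\<^sub>F k in sequentially. H (Suc k) - Hlim \<le> c * D k"
proof (rule ccontr)
  assume contra: "\<not> ?thesis"
  have "\<exists>k>N. H (Suc k) - Hlim > real n * D k" for n N :: nat
  proof (rule ccontr)
    assume "\<not> ?thesis"
    then have *: "H (Suc k) - Hlim \<le> real n * D k" if "k > N" for k
      using that by (meson not_less)
    have **: "H (Suc k) - Hlim \<le> real (Suc n) * D k" if "k > N" for k
      using *[OF that] mult_right_mono[OF _ D_nonneg, of "real n" "real (Suc n)" k] by linarith
    have "\<forall>\<^sub>F k in sequentially. H (Suc k) - Hlim \<le> real (Suc n) * D k"
      using eventually_gt_at_top[of N] by (rule eventually_mono) (rule **)
    with contra show False
      by (metis of_nat_0_less_iff zero_less_Suc)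
  qed
  then have "\<exists>r. \<forall>n. H (Suc (r n)) - Hlim > real n * D (r n) \<and> r n < r (Suc n)"
    by (intro dependent_nat_choice) blast+
  then obtain r where r: "\<And>n. H (Suc (r n)) - Hlim > real n * D (r n)" and "strict_mono r"
    by (metis strict_mono_Suc_iff)
  have "finite \<D>"
    using pieces unfolding kl_pieces_def by blast
  define uses :: "nat \<Rightarrow> 'a set \<times> ('a \<Rightarrow> real) \<times> ('a \<Rightarrow> 'a) \<Rightarrow> bool"
    where "uses n = (\<lambda>(S, q, dq). x (Suc (r n)) \<in> S \<and> p (Suc (r n)) = q (x (Suc (r n))))" for n
  have "\<forall>n\<in>UNIV. \<exists>b\<in>\<D>. uses n b"
  proof
    fix n
    obtain S q dq where "(S, q, dq) \<in> \<D>" "x (Suc (r n)) \<in> S" "p (Suc (r n)) = q (x (Suc (r n)))"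
      by (rule piece_of_iterate)
    then show "\<exists>b\<in>\<D>. uses n b"
      by (intro bexI[of _ "(S, q, dq)"]) (auto simp: uses_def)
  qed
  then have "\<exists>b\<in>\<D>. infinite {n \<in> UNIV. uses n b}"
    using \<open>finite \<D>\<close> by (intro pigeonhole_infinite_rel infinite_UNIV_nat)
  then obtain S q dq where piece: "(S, q, dq) \<in> \<D>"
    and inf: "infinite {n. x (Suc (r n)) \<in> S \<and> p (Suc (r n)) = q (x (Suc (r n)))}"
    by (auto simp: uses_def)
  define s where "s = enumerate {n. x (Suc (r n)) \<in> S \<and> p (Suc (r n)) = q (x (Suc (r n)))}"
  have s: "strict_mono s" "\<And>n. x (Suc (r (s n))) \<in> S" "\<And>n. p (Suc (r (s n))) = q (x (Suc (r (s n))))"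
    using strict_mono_enumerate[OF inf] enumerate_in_set[OF inf] by (auto simp: s_def)
  have "bounded (range (\<lambda>n. x (Suc (r (s n)))))"
    using bounded by (rule bounded_subset) auto
  then obtain xb t where t: "strict_mono t" "((\<lambda>n. x (Suc (r (s n)))) \<circ> t) \<longlonglongrightarrow> xb"
    using bounded_imp_convergent_subsequence by blast
  (* Three successive extractions: bad ratios, a common piece, convergence. *)
  define u where "u n = r (s (t n))" for n
  have u: "strict_mono u"
    using \<open>strict_mono r\<close> s(1) t(1) unfolding u_def strict_mono_def by blast
  have big: "H (Suc (u n)) - Hlim > real n * D (u n)" for n
  proof -
    have "n \<le> s (t n)"
      using s(1) t(1) by (meson order_trans seq_suble)
    then have "real n * D (u n) \<le> real (s (t n)) * D (u n)"
      using D_nonneg by (intro mult_right_mono) auto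
    then show ?thesis
      using r[of "s (t n)"] by (simp add: u_def)
  qed
  define y where "y n = x (Suc (u n))" for n
  have "y = (\<lambda>n. x (Suc (r (s n)))) \<circ> t"
    by (auto simp: y_def u_def)
  then have y: "y \<longlonglongrightarrow> xb" "\<And>n. y n \<in> S" "\<And>n. p (Suc (u n)) = q (y n)"
    using t(2) s(2,3) by (auto simp: u_def)
  obtain c where c: "c \<ge> 0" "\<And>k. (norm (residual k))\<^sup>2 \<le> c * D k"
    using residual_bound by blast
  have "residual \<longlonglongrightarrow> 0"
    using c(2) by (rule tendsto_zero_if_square_le)
  from LIMSEQ_subseq_LIMSEQ[OF this u] have res: "(\<lambda>n. residual (u n)) \<longlonglongrightarrow> 0"
    by (simp add: comp_def)
  have "isCont g xb" "isCont dq xb"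
    using g_cont[of UNIV] pieceD(3)[OF piece] by (auto simp: continuous_on_eq_continuous_at)
  then have gq: "(\<lambda>n. g (y n) + dq (y n)) \<longlonglongrightarrow> g xb + dq xb"
    using isCont_tendsto_compose[OF _ y(1)] by (intro tendsto_add)
  have crit: "\<forall>w\<in>directions S. (g xb + dq xb) \<bullet> w = 0"
  proof
    fix w assume w: "w \<in> directions S"
    have "(\<lambda>n. (g (y n) + dq (y n) - residual (u n)) \<bullet> w) \<longlonglongrightarrow> (g xb + dq xb - 0) \<bullet> w"
      by (intro tendsto_intros gq res)
    moreover have "(g (y n) + dq (y n) - residual (u n)) \<bullet> w = 0" for n
      using first_order_iterate[OF piece, of "u n" w] y(2,3) w by (simp add: y_def)
    ultimately show "(g xb + dq xb) \<bullet> w = 0"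
      using LIMSEQ_unique[OF tendsto_const] by fastforce
  qed
  obtain c' where c': "c' \<ge> 0" and kl: "\<And>z v. z - xb \<in> directions S \<Longrightarrow> norm (z - xb) \<le> 1 \<Longrightarrow>
      (\<forall>w\<in>directions S. (g z + dq z - v) \<bullet> w = 0) \<Longrightarrow>
      (h z + q z) - (h xb + q xb) \<le> c' * (norm v)\<^sup>2"
    by (rule kl_half_alongE[OF pieceD(5)[OF piece] crit]) (rule that)
  have "xb \<in> closure S"
    using y(1,2) unfolding closure_sequential by blast
  have "isCont h xb" "isCont q xb"
    using h_cont[of UNIV] piece_cont[OF piece, of UNIV] by (auto simp: continuous_on_eq_continuous_at)
  then have "(\<lambda>n. h (y n) + q (y n)) \<longlonglongrightarrow> h xb + q xb"
    using isCont_tendsto_compose[OF _ y(1)] by (intro tendsto_add)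
  moreover have "(\<lambda>n. h (y n) + q (y n)) \<longlonglongrightarrow> Hlim"
    using LIMSEQ_subseq_LIMSEQ[OF LIMSEQ_Suc[OF values_tendsto] u] y(3) by (simp add: y_def comp_def)
  ultimately have Fxb: "h xb + q xb = Hlim"
    by (rule LIMSEQ_unique)
  have "\<forall>\<^sub>F n in sequentially. dist (y n) xb < 1"
    using y(1) by (rule tendstoD) simp
  then have "\<forall>\<^sub>F n in sequentially. dist (y n) xb < 1 \<and> real n \<ge> c' * c + C"
    using eventually_ge_at_top[of "nat \<lceil>c' * c + C\<rceil>"]
    by eventually_elim (auto simp: nat_le_iff ceiling_le_iff)
  then have "\<exists>n. dist (y n) xb < 1 \<and> real n \<ge> c' * c + C"
    by (rule eventually_happens'[OF sequentially_bot])
  then obtain n where n: "dist (y n) xb < 1" "real n \<ge> c' * c + C"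
    by blast
  have "h (y n) + q (y n) - Hlim \<le> c' * (norm (residual (u n)))\<^sup>2"
    unfolding Fxb[symmetric]
  proof (rule kl)
    show "y n - xb \<in> directions S"
      using y(2) \<open>xb \<in> closure S\<close> by (rule diff_closure_in_directions)
    show "norm (y n - xb) \<le> 1"
      using n(1) by (simp add: dist_norm)
    show "\<forall>w\<in>directions S. (g (y n) + dq (y n) - residual (u n)) \<bullet> w = 0"
      using first_order_iterate[OF piece] y(2,3) by (simp add: y_def)
  qed
  also have "\<dots> \<le> c' * (c * D (u n))"
    using c' c(2) by (intro mult_left_mono)
  finally have "H (Suc (u n)) - Hlim \<le> (c' * c + C) * D (u n)"
    using value_ge[of "u n"] y(3)[of n] by (simp add: y_def algebra_simps)
  also have "\<dots> \<le> real n * D (u n)"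
    using n(2) D_nonneg by (intro mult_right_mono)
  finally show False
    using big[of n] by simp
qed

text \<open>The gap \<open>E\<close> satisfies \<open>\<epsilon> * E (Suc k) \<le> c * (E k - E (Suc k))\<close>, a contraction with factor
  \<open>c / (c + \<epsilon>)\<close>, and \<open>\<epsilon>\<close> times a squared step is at most the gap.\<close>

lemma geometric_steps:
  "\<exists>M \<tau> K. 0 < M \<and> 0 < \<tau> \<and> \<tau> < 1 \<and> (\<forall>k\<ge>K. norm (x (Suc k) - x k) \<le> M * \<tau> ^ k)"
proof -
  obtain c K where c: "c > 0" "\<And>k. k \<ge> K \<Longrightarrow> H (Suc k) - Hlim \<le> c * D k"
    using gap_le_step unfolding eventually_sequentially by blast
  define E where "E k = H k - Hlim" for k
  define \<rho> where "\<rho> = c / (c + \<epsilon>)"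
  have \<rho>: "0 < \<rho>" "\<rho> < 1"
    using c(1) \<epsilon> by (auto simp: \<rho>_def)
  have E0: "0 \<le> E k" for k
    using H_ge by (simp add: E_def)
  have ED: "\<epsilon> * D k \<le> E k - E (Suc k)" for k
    using decrease[of k] by (simp add: E_def)
  have contract: "E (Suc k) \<le> \<rho> * E k" if "k \<ge> K" for k
  proof -
    have "\<epsilon> * E (Suc k) \<le> \<epsilon> * (c * D k)"
      using c(2)[OF that] \<epsilon> by (simp add: E_def)
    also have "\<dots> = c * (\<epsilon> * D k)"
      by simp
    also have "\<dots> \<le> c * (E k - E (Suc k))"
      using c(1) ED by (intro mult_left_mono) auto
    finally have "(c + \<epsilon>) * E (Suc k) \<le> c * E k"
      by (simp add: algebra_simps)
    then show ?thesis
      using c(1) \<epsilon> by (simp add: \<rho>_def field_simps)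
  qed
  have geo: "E k * \<rho> ^ K \<le> E K * \<rho> ^ k" if "k \<ge> K" for k
    using that
  proof (induction k rule: dec_induct)
    case (step k)
    have "E (Suc k) * \<rho> ^ K \<le> (\<rho> * E k) * \<rho> ^ K"
      using contract step \<rho> by (intro mult_right_mono) auto
    also have "\<dots> \<le> \<rho> * (E K * \<rho> ^ k)"
      using step \<rho> by (simp add: mult.assoc)
    finally show ?case
      by (simp add: algebra_simps)
  qed simp
  (* The summand 1 keeps M positive when the gap is already zero. *)
  define M where "M = (E K + 1) / (\<epsilon> * \<rho> ^ K)"
  have M: "M > 0"
    using E0[of K] \<epsilon> \<rho> by (simp add: M_def add_nonneg_pos)
  have "norm (x (Suc k) - x k) \<le> sqrt M * sqrt \<rho> ^ k" if "k \<ge> K" for k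
  proof -
    have "\<epsilon> * (norm (x (Suc k) - x k))\<^sup>2 \<le> \<epsilon> * D k"
      using step \<epsilon> by simp
    also have "\<dots> \<le> E k"
      using ED[of k] E0[of "Suc k"] by linarith
    finally have "(\<epsilon> * (norm (x (Suc k) - x k))\<^sup>2) * \<rho> ^ K \<le> E k * \<rho> ^ K"
      using \<rho> by (intro mult_right_mono) auto
    also have "\<dots> \<le> E K * \<rho> ^ k"
      by (rule geo[OF that])
    also have "\<dots> \<le> (E K + 1) * \<rho> ^ k"
      using \<rho> by (intro mult_right_mono) auto
    finally have "(norm (x (Suc k) - x k))\<^sup>2 \<le> M * \<rho> ^ k"
      using \<epsilon> \<rho> by (simp add: M_def field_simps)
    then have "norm (x (Suc k) - x k) \<le> sqrt (M * \<rho> ^ k)"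
      by (rule real_le_rsqrt)
    then show ?thesis
      by (simp add: real_sqrt_mult real_sqrt_power)
  qed
  then show ?thesis
    using \<rho> M by (intro exI[of _ "sqrt M"] exI[of _ "sqrt \<rho>"] exI[of _ K]) auto
qed

end

section \<open>Stationarity of the limit\<close>

lemma zero_regular_subdifferentialI:
  fixes f :: "'a::euclidean_space \<Rightarrow> ereal"
  assumes fx: "f x = ereal r" and le: "\<And>z. ereal (r - c * (norm (z - x))\<^sup>2) \<le> f z"
  shows "0 \<in> regular_subdifferential f x"
proof -
  have "((\<lambda>z. ereal (- c * norm (z - x))) \<longlongrightarrow> ereal (- c * norm (x - x))) (at x)"
    by (intro tendsto_intros)
  from lim_imp_Liminf[OF at_neq_bot this]
  have "0 = Liminf (at x) (\<lambda>z. ereal (- c * norm (z - x)))"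
    by simp
  also have "\<dots> \<le> Liminf (at x) (\<lambda>z. (f z - f x - ereal (0 \<bullet> (z - x))) / ereal (norm (z - x)))"
  proof (rule Liminf_mono)
    have "ereal (- c * norm (z - x)) \<le> (f z - f x - ereal (0 \<bullet> (z - x))) / ereal (norm (z - x))"
      if "z \<noteq> x" for z
    proof -
      have n: "norm (z - x) > 0"
        using that by simp
      show ?thesis
      proof (cases "f z")
        case (real s)
        then have "r - c * (norm (z - x))\<^sup>2 \<le> s"
          using le[of z] by simp
        then have "- c * norm (z - x) * norm (z - x) \<le> s - r"
          by (simp add: power2_eq_square)
        then show ?thesis
          using n by (simp add: real fx field_simps)
      next
        case PInf
        then show ?thesis
          using n by (simp add: fx)
      next
        case MInf
        then show ?thesis
          using le[of z] by simp
      qed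
    qed
    then show "\<forall>\<^sub>F z in at x. ereal (- c * norm (z - x))
        \<le> (f z - f x - ereal (0 \<bullet> (z - x))) / ereal (norm (z - x))"
      by (auto simp: eventually_at_filter)
  qed
  finally show ?thesis
    using fx by (simp add: regular_subdifferential_def dom_fun_def)
qed

lemma regular_subdifferential_subset: "regular_subdifferential f x \<subseteq> subdifferential f x"
proof
  fix v assume v: "v \<in> regular_subdifferential f x"
  then have "x \<in> dom_fun f"
    by (simp add: regular_subdifferential_def)
  moreover have "\<exists>y w. y \<longlonglongrightarrow> x \<and> (\<lambda>t::nat. f (y t)) \<longlonglongrightarrow> f x \<and> w \<longlonglongrightarrow> v \<and>
      (\<forall>t. w t \<in> regular_subdifferential f (y t))"
    using v by (intro exI[of _ "\<lambda>_. x"] exI[of _ "\<lambda>_. v"]) simp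
  ultimately show "v \<in> subdifferential f x"
    by (simp add: subdifferential_def)
qed

lemma closed_fun_sequence_le:
  assumes "closed_fun P" and x: "x \<longlonglongrightarrow> xb" and p: "\<And>k. P (x k) = ereal (p k)" "p \<longlonglongrightarrow> r"
  shows "P xb \<le> ereal r"
proof (rule dense_le)
  fix c assume c: "c < P xb"
  then have "c < Liminf (at xb) P"
    using assms(1) unfolding closed_fun_def by (meson order_less_le_trans)
  then have "\<forall>\<^sub>F z in at xb. c < P z"
    using less_LiminfD by blast
  then have "\<forall>\<^sub>F z in nhds xb. c < P z"
    using c by (auto simp: eventually_nhds_conv_at)
  then have "\<forall>\<^sub>F k in sequentially. c < P (x k)"
    using x by (rule eventually_compose_filterlim)
  then have "\<forall>\<^sub>F k in sequentially. c \<le> ereal (p k)"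
    by eventually_elim (simp add: p(1))
  moreover have "(\<lambda>k. ereal (p k)) \<longlonglongrightarrow> ereal r"
    using p(2) by simp
  ultimately show "c \<le> ereal r"
    by (intro tendsto_lowerbound[of _ _ sequentially]) auto
qed

context descent_scheme
begin

text \<open>Passing to the limit in the minimality of the iterates, with the quadratic enlarged to the
  common step size \<open>\<gamma>0\<close>, shows that \<open>xb\<close> minimizes the limiting model function. So the objective
  lies above its value at \<open>xb\<close> minus a quadratic, and zero is already a regular subgradient.\<close>

lemma limit_stationary:
  assumes x: "x \<longlonglongrightarrow> xb"
  shows "stationary_point (\<lambda>z. ereal (h z) + P z) xb"
proof -
  define r where "r = Hlim - h xb"
  have "isCont h xb" "isCont g xb"
    using h_cont[of UNIV] g_cont[of UNIV] by (auto simp: continuous_on_eq_continuous_at)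
  then have hx: "(\<lambda>k. h (x k)) \<longlonglongrightarrow> h xb" and gx: "(\<lambda>k. g (x k)) \<longlonglongrightarrow> g xb"
    using isCont_tendsto_compose[OF _ x] by auto
  have "(\<lambda>k. h (x k) + p k - h (x k)) \<longlonglongrightarrow> r"
    unfolding r_def by (intro tendsto_diff values_tendsto hx)
  then have p: "p \<longlonglongrightarrow> r"
    by simp
  have Pxb: "P xb \<le> ereal r"
    using closed_fun_sequence_le[OF closed x P_x p] .
  have lower: "r \<le> g xb \<bullet> (z - xb) + 1 / (2 * \<gamma>0) * (norm (z - xb))\<^sup>2 + s"
    if z: "P z = ereal s" for z s
  proof (rule LIMSEQ_le)
    show "(\<lambda>k. (g (x k) - m k) \<bullet> (x (Suc k) - x k) + p (Suc k)) \<longlonglongrightarrow> r"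
    proof -
      have "(\<lambda>k. (g (x k) - m k) \<bullet> (x (Suc k) - x k) + p (Suc k)) \<longlonglongrightarrow> (g xb - 0) \<bullet> 0 + r"
        by (intro tendsto_intros gx m_tendsto step_tendsto LIMSEQ_Suc p)
      then show ?thesis
        by simp
    qed
    show "(\<lambda>k. (g (x k) - m k) \<bullet> (z - x k) + 1 / (2 * \<gamma>0) * (norm (z - x k))\<^sup>2 + s)
        \<longlonglongrightarrow> g xb \<bullet> (z - xb) + 1 / (2 * \<gamma>0) * (norm (z - xb))\<^sup>2 + s"
    proof -
      have "(\<lambda>k. (g (x k) - m k) \<bullet> (z - x k) + 1 / (2 * \<gamma>0) * (norm (z - x k))\<^sup>2 + s)
          \<longlonglongrightarrow> (g xb - 0) \<bullet> (z - xb) + 1 / (2 * \<gamma>0) * (norm (z - xb))\<^sup>2 + s"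
        by (intro tendsto_intros gx m_tendsto x)
      then show ?thesis
        by simp
    qed
    have "(g (x k) - m k) \<bullet> (x (Suc k) - x k) + p (Suc k)
        \<le> (g (x k) - m k) \<bullet> (z - x k) + 1 / (2 * \<gamma>0) * (norm (z - x k))\<^sup>2 + s" for k
    proof -
      have "(g (x k) - m k) \<bullet> (x (Suc k) - x k) + 1 / (2 * \<gamma> k) * (norm (x (Suc k) - x k))\<^sup>2 + p (Suc k)
          \<le> (g (x k) - m k) \<bullet> (z - x k) + 1 / (2 * \<gamma> k) * (norm (z - x k))\<^sup>2 + s"
        using minimal[of k z] by (simp add: P_x z)
      moreover have "0 \<le> 1 / (2 * \<gamma> k) * (norm (x (Suc k) - x k))\<^sup>2"
        using \<gamma>0(1) \<gamma>0(2)[of k] by simp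
      moreover have "1 / (2 * \<gamma> k) * (norm (z - x k))\<^sup>2 \<le> 1 / (2 * \<gamma>0) * (norm (z - x k))\<^sup>2"
        using \<gamma>0(1) \<gamma>0(2)[of k] by (intro mult_right_mono) (auto simp: frac_le)
      ultimately show ?thesis
        by linarith
    qed
    then show "\<exists>N. \<forall>k\<ge>N. (g (x k) - m k) \<bullet> (x (Suc k) - x k) + p (Suc k)
        \<le> (g (x k) - m k) \<bullet> (z - x k) + 1 / (2 * \<gamma>0) * (norm (z - x k))\<^sup>2 + s"
      by blast
  qed
  obtain s0 where s0: "P xb = ereal s0" "s0 \<le> r"
    using Pxb P_not_minf[of xb] by (cases "P xb") auto
  have "ereal (h xb + s0 - (1 / (2 * \<gamma>0) + L / 2) * (norm (z - xb))\<^sup>2) \<le> ereal (h z) + P z" for z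
  proof (cases "P z")
    case (real s)
    have "- h z \<le> - h xb + (- g xb) \<bullet> (z - xb) + L / 2 * (norm (z - xb))\<^sup>2"
    proof (rule quadratic_upper_bound)
      show "GDERIV (\<lambda>z. - h z) z :> - g z" for z
        using h_deriv by (rule GDERIV_minus)
      show "L-lipschitz_on UNIV (\<lambda>z. - g z)"
        using L by (simp add: lipschitz_on_def dist_norm norm_minus_commute)
    qed
    with lower[OF real] s0(2) show ?thesis
      by (simp add: real algebra_simps)
  next
    case MInf
    then show ?thesis
      using P_not_minf[of z] by simp
  qed simp
  then have "0 \<in> regular_subdifferential (\<lambda>z. ereal (h z) + P z) xb"
    by (intro zero_regular_subdifferentialI) (auto simp: s0)
  then show ?thesis
    unfolding stationary_point_def using regular_subdifferential_subset by blast
qed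

text \<open>The index shift matters because the rate is expressed by the \<open>k\<close>-th root of the
  \<open>k\<close>-th error, and because the starting point of an algorithm may lie outside the domain.\<close>

theorem converges_shifted:
  assumes y: "\<And>k. y (Suc k) = x k"
  shows "\<exists>xb. stationary_point (\<lambda>z. ereal (h z) + P z) xb \<and> converges_locally_linearly y xb"
proof -
  obtain M \<tau> K where *: "0 < M" "0 < \<tau>" "\<tau> < 1" "\<And>k. k \<ge> K \<Longrightarrow> norm (x (Suc k) - x k) \<le> M * \<tau> ^ k"
    using geometric_steps by blast
  have "norm (y (Suc k) - y k) \<le> (M / \<tau>) * \<tau> ^ k" if k: "k \<ge> Suc K" for k
  proof (cases k)
    case (Suc j)
    then show ?thesis
      using *(4)[of j] k *(2) by (simp add: y)
  qed (use k in simp)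
  then obtain xb where xb: "converges_locally_linearly y xb"
    using converges_locally_linearly_geometric[of \<tau> "M / \<tau>" "Suc K" y] *(1-3) by auto
  then have "(\<lambda>k. y (Suc k)) \<longlonglongrightarrow> xb"
    unfolding converges_locally_linearly_def by (intro LIMSEQ_Suc) simp
  then have "x \<longlonglongrightarrow> xb"
    by (simp add: y)
  with limit_stationary xb show ?thesis
    by blast
qed

end

section \<open>Proximal gradient and iPiano as descent schemes\<close>

lemma proper_minimizer_finite:
  assumes "proper_fun P" and min: "\<And>z. ereal (a y) + P y \<le> ereal (a z) + P z"
  shows "P y = ereal (real_of_ereal (P y))"
proof -
  obtain z where z: "P z \<noteq> \<infinity>" "\<And>z. P z \<noteq> -\<infinity>"
    using assms(1) unfolding proper_fun_def by blast
  then have "P y \<noteq> \<infinity>"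
    using min[of z] by (cases "P z"; cases "P y") auto
  then show ?thesis
    using z(2)[of y] by (cases "P y") auto
qed

text \<open>Comparing the new iterate with the old one and using the quadratic upper bound gives a decrease of
  the objective itself by \<open>1 / (2 * \<gamma> k) - L / 2\<close> times the squared step. An upper bound \<open>\<gamma>1\<close> of the
  step sizes that is still below \<open>1 / L\<close> makes this factor uniformly positive.\<close>

theorem prox_gradient_converges:
  fixes h :: "'a::euclidean_space \<Rightarrow> real"
  assumes h: "\<And>z. GDERIV h z :> g z" and L: "L > 0" "L-lipschitz_on UNIV g"
    and pieces: "kl_pieces h g P \<D>" and P: "closed_fun P" "proper_fun P"
    and \<gamma>: "0 < (INF k. ereal (\<gamma> k))" "(SUP k. ereal (\<gamma> k)) < ereal (1 / L)"
    and x: "prox_gradient_seq h P \<gamma> x" "bounded (range x)"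
  shows "\<exists>xb. stationary_point (\<lambda>z. ereal (h z) + P z) xb \<and> converges_locally_linearly x xb"
proof -
  obtain \<gamma>0 where "0 < ereal \<gamma>0" "ereal \<gamma>0 < (INF k. ereal (\<gamma> k))"
    using ereal_dense2[OF \<gamma>(1)] by blast
  then have \<gamma>0: "0 < \<gamma>0" "\<gamma>0 \<le> \<gamma> k" for k
    using less_INF_D[of "ereal \<gamma>0" "\<lambda>k. ereal (\<gamma> k)" UNIV k] by auto
  obtain \<gamma>1 where "(SUP k. ereal (\<gamma> k)) < ereal \<gamma>1" "ereal \<gamma>1 < ereal (1 / L)"
    using ereal_dense2[OF \<gamma>(2)] by blast
  then have \<gamma>1: "\<gamma> k \<le> \<gamma>1" "\<gamma>1 < 1 / L" for k
    using SUP_lessD[of "\<lambda>k. ereal (\<gamma> k)" UNIV "ereal \<gamma>1" k] by auto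
  have \<gamma>1_pos: "\<gamma>1 > 0"
    using \<gamma>0 \<gamma>1(1) by (meson order_less_le_trans)
  have min: "ereal (g (x k) \<bullet> (x (Suc k) - x k) + 1 / (2 * \<gamma> k) * (norm (x (Suc k) - x k))\<^sup>2) + P (x (Suc k))
      \<le> ereal (g (x k) \<bullet> (z - x k) + 1 / (2 * \<gamma> k) * (norm (z - x k))\<^sup>2) + P z" for k z
    using x(1) gradient_eqI[OF h] unfolding prox_gradient_seq_def Arg_min_set_def is_arg_min_linorder
    by simp
  define p where "p k = real_of_ereal (P (x (Suc k)))" for k
  have p: "P (x (Suc k)) = ereal (p k)" for k
    unfolding p_def using P(2) min by (rule proper_minimizer_finite)
  define \<epsilon> where "\<epsilon> = (1 / \<gamma>1 - L) / 2"
  have \<epsilon>: "\<epsilon> > 0"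
    using \<gamma>1(2) \<gamma>1_pos L(1) by (simp add: \<epsilon>_def field_simps)
  interpret descent_scheme h g L P \<D> "\<lambda>k. x (Suc k)" "\<lambda>_. 0" p "\<lambda>k. \<gamma> (Suc k)"
    "\<lambda>k. h (x (Suc k)) + p k" "\<lambda>k. (norm (x (Suc (Suc k)) - x (Suc k)))\<^sup>2" \<gamma>0 \<epsilon> 0
  proof
    show "bounded (range (\<lambda>k. x (Suc k)))"
      using x(2) by (rule bounded_subset) auto
    fix k
    let ?d = "x (Suc (Suc k)) - x (Suc k)"
    have "g (x (Suc k)) \<bullet> ?d + 1 / (2 * \<gamma> (Suc k)) * (norm ?d)\<^sup>2 + p (Suc k) \<le> p k"
      using min[of "Suc k" "x (Suc k)"] by (simp add: p)
    moreover have "h (x (Suc (Suc k))) \<le> h (x (Suc k)) + g (x (Suc k)) \<bullet> ?d + L / 2 * (norm ?d)\<^sup>2"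
      by (rule quadratic_upper_bound[OF h L(2)])
    moreover have "(\<epsilon> + L / 2) * (norm ?d)\<^sup>2 \<le> 1 / (2 * \<gamma> (Suc k)) * (norm ?d)\<^sup>2"
    proof (rule mult_right_mono)
      have "1 / \<gamma>1 \<le> 1 / \<gamma> (Suc k)"
        using \<gamma>0 \<gamma>1(1) by (meson frac_le order_less_le_trans order_refl zero_le_one)
      then show "\<epsilon> + L / 2 \<le> 1 / (2 * \<gamma> (Suc k))"
        by (simp add: \<epsilon>_def field_simps)
    qed simp
    ultimately show "\<epsilon> * (norm ?d)\<^sup>2
        \<le> h (x (Suc k)) + p k - (h (x (Suc (Suc k))) + p (Suc k))"
      by (simp add: distrib_right)
  qed (use h L pieces P p \<gamma>0 \<epsilon> min in \<open>auto simp: proper_fun_def\<close>)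
  show ?thesis
    by (rule converges_shifted) simp
qed

lemma convex_fun_combination:
  assumes "convex_fun P" "P a = ereal r" "P b = ereal s" "0 \<le> t" "t \<le> 1"
  shows "P ((1 - t) *\<^sub>R a + t *\<^sub>R b) \<le> ereal ((1 - t) * r + t * s)"
proof -
  have "(1 - t) *\<^sub>R (a, r) + t *\<^sub>R (b, s) \<in> ereal_epigraph P"
    using assms unfolding convex_fun_def by (intro convexD_alt) (auto simp: ereal_epigraph_def)
  then show ?thesis
    by (simp add: ereal_epigraph_def)
qed

text \<open>Comparing the minimizer with points on the segment towards \<open>w\<close> gains
  \<open>c * (1 - t)\<close> times the squared distance, and \<open>t\<close> tends to zero.\<close>

lemma strong_minimizer:
  fixes y0 :: "'a::euclidean_space"
  assumes conv: "convex_fun P" and fin: "P y = ereal r" "P w = ereal s"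
    and min: "\<And>z. ereal (u \<bullet> (y - y0) + c * (norm (y - y0))\<^sup>2) + P y
      \<le> ereal (u \<bullet> (z - y0) + c * (norm (z - y0))\<^sup>2) + P z"
  shows "u \<bullet> (y - y0) + c * (norm (y - y0))\<^sup>2 + r + c * (norm (w - y))\<^sup>2
    \<le> u \<bullet> (w - y0) + c * (norm (w - y0))\<^sup>2 + s"
proof -
  define \<phi> where "\<phi> z = u \<bullet> (z - y0) + c * (norm (z - y0))\<^sup>2" for z
  have "\<phi> y + r + c * (1 - t) * (norm (w - y))\<^sup>2 \<le> \<phi> w + s" if t: "0 < t" "t < 1" for t
  proof -
    let ?z = "(1 - t) *\<^sub>R y + t *\<^sub>R w"
    have "ereal (\<phi> y + r) \<le> ereal (\<phi> ?z) + P ?z"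
      using min[of ?z] by (simp add: \<phi>_def fin)
    also have "\<dots> \<le> ereal (\<phi> ?z) + ereal ((1 - t) * r + t * s)"
      using t by (intro add_left_mono convex_fun_combination conv fin) auto
    finally have "\<phi> y + r \<le> \<phi> ?z + (1 - t) * r + t * s"
      by simp
    also have "\<phi> ?z = (1 - t) * \<phi> y + t * \<phi> w - c * (t * (1 - t) * (norm (w - y))\<^sup>2)"
    proof -
      have z: "?z - y0 = (1 - t) *\<^sub>R (y - y0) + t *\<^sub>R (w - y0)"
        by (simp add: algebra_simps)
      have wy: "w - y = (w - y0) - (y - y0)"
        by simp
      show ?thesis
        unfolding \<phi>_def z wy power2_norm_eq_inner
        by (simp add: inner_add_left inner_add_right inner_diff_left[of "w - y0"]
            inner_diff_right[of _ "w - y0"] inner_commute[of "w - y0" "y - y0"]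
            algebra_simps del: diff_diff_eq2 diff_diff_eq add_diff_cancel_right)
    qed
    finally have "t * (\<phi> y + r + c * (1 - t) * (norm (w - y))\<^sup>2) \<le> t * (\<phi> w + s)"
      by (simp add: algebra_simps)
    then show ?thesis
      using t(1) by simp
  qed
  then have "\<forall>\<^sub>F t in at_right 0. \<phi> y + r + c * (1 - t) * (norm (w - y))\<^sup>2 \<le> \<phi> w + s"
    by (auto simp: eventually_at_right_field intro!: exI[of _ 1])
  moreover have "((\<lambda>t. \<phi> y + r + c * (1 - t) * (norm (w - y))\<^sup>2)
      \<longlongrightarrow> \<phi> y + r + c * (1 - 0) * (norm (w - y))\<^sup>2) (at_right 0)"
    by (intro tendsto_intros)
  ultimately have "\<phi> y + r + c * (1 - 0) * (norm (w - y))\<^sup>2 \<le> \<phi> w + s"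
    by (intro tendsto_upperbound) auto
  then show ?thesis
    by (simp add: \<phi>_def)
qed

text \<open>Convexity of \<open>P\<close> doubles the quadratic gain of the minimization step. Splitting the inertial term
  by Young's inequality, the two last squared steps enter with coefficients whose sum is
  \<open>1 / \<alpha> - L / 2 - \<beta> / \<alpha> = 2 * \<epsilon>\<close>, positive exactly by the bound on \<open>\<alpha>\<close>; adding \<open>c\<close> times the squared
  step to the objective distributes this surplus evenly over both. Coercivity keeps the iterates
  in a bounded sublevel set.\<close>

theorem ipiano_converges:
  fixes h :: "'a::euclidean_space \<Rightarrow> real"
  assumes h: "\<And>z. GDERIV h z :> g z" and L: "L > 0" "L-lipschitz_on UNIV g"
    and pieces: "kl_pieces h g P \<D>" and P: "closed_fun P" "proper_fun P" "convex_fun P"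
    and \<beta>: "0 \<le> \<beta>" and \<alpha>: "0 < \<alpha>" "\<alpha> < 2 * (1 - \<beta>) / L"
    and coercive: "coercive (\<lambda>z. ereal (h z) + P z)" and x: "ipiano_seq h P \<alpha> \<beta> x"
  shows "\<exists>xb. stationary_point (\<lambda>z. ereal (h z) + P z) xb \<and> converges_locally_linearly x xb"
proof -
  define m where "m k = (\<beta> / \<alpha>) *\<^sub>R (x (Suc k) - x k)" for k
  have "x (Suc k) \<in> Arg_min_set (\<lambda>z.
          ereal ((gradient h (x k) - (\<beta> / \<alpha>) *\<^sub>R (x k - (if k = 0 then x 0 else x (k - 1)))) \<bullet> (z - x k)
                 + 1 / (2 * \<alpha>) * (norm (z - x k))\<^sup>2) + P z)" for k
    using x unfolding ipiano_seq_def Let_def by blast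
  then have min0: "ereal ((g (x k) - (\<beta> / \<alpha>) *\<^sub>R (x k - (if k = 0 then x 0 else x (k - 1)))) \<bullet> (x (Suc k) - x k)
          + 1 / (2 * \<alpha>) * (norm (x (Suc k) - x k))\<^sup>2) + P (x (Suc k))
      \<le> ereal ((g (x k) - (\<beta> / \<alpha>) *\<^sub>R (x k - (if k = 0 then x 0 else x (k - 1)))) \<bullet> (z - x k)
          + 1 / (2 * \<alpha>) * (norm (z - x k))\<^sup>2) + P z" for k z
    unfolding Arg_min_set_def is_arg_min_linorder gradient_eqI[OF h] by blast
  have min: "ereal ((g (x (Suc k)) - m k) \<bullet> (x (Suc (Suc k)) - x (Suc k))
          + 1 / (2 * \<alpha>) * (norm (x (Suc (Suc k)) - x (Suc k)))\<^sup>2) + P (x (Suc (Suc k)))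
      \<le> ereal ((g (x (Suc k)) - m k) \<bullet> (z - x (Suc k)) + 1 / (2 * \<alpha>) * (norm (z - x (Suc k)))\<^sup>2) + P z"
    for k z
    using min0[of "Suc k" z] by (simp add: m_def)
  define p where "p k = real_of_ereal (P (x (Suc k)))" for k
  have p: "P (x (Suc k)) = ereal (p k)" for k
    unfolding p_def using P(2) min0 by (rule proper_minimizer_finite)
  define \<epsilon> where "\<epsilon> = (1 / \<alpha> - L / 2 - \<beta> / \<alpha>) / 2"
  have "\<alpha> * (2 * \<epsilon>) = 1 - \<beta> - L * \<alpha> / 2"
    using \<alpha>(1) by (simp add: \<epsilon>_def field_simps)
  also have "\<dots> > 0"
    using \<alpha> L(1) by (simp add: field_simps)
  finally have \<epsilon>: "\<epsilon> > 0"
    using \<alpha>(1) by (simp add: zero_less_mult_iff)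
  (* The part beta / (2 alpha) pays for the inertial term, epsilon is half of the surplus. *)
  define c where "c = \<beta> / (2 * \<alpha>) + \<epsilon>"
  have c: "c \<ge> 0"
    using \<beta> \<alpha> \<epsilon> by (simp add: c_def)
  define H where "H k = h (x (Suc k)) + p k + c * (norm (x (Suc k) - x k))\<^sup>2" for k
  define D where "D k = (norm (x (Suc (Suc k)) - x (Suc k)))\<^sup>2 + (norm (x (Suc k) - x k))\<^sup>2" for k
  define C where "C = (\<beta> / \<alpha>)\<^sup>2 + c"
  have dec: "\<epsilon> * D k \<le> H k - H (Suc k)" for k
  proof -
    let ?d = "x (Suc (Suc k)) - x (Suc k)" and ?e = "x (Suc k) - x k"
    have "(g (x (Suc k)) - m k) \<bullet> ?d + 1 / (2 * \<alpha>) * (norm ?d)\<^sup>2 + p (Suc k) + 1 / (2 * \<alpha>) * (norm ?d)\<^sup>2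
        \<le> p k"
      using strong_minimizer[OF P(3) p p min, of k k] by (simp add: norm_minus_commute)
    moreover have "h (x (Suc (Suc k))) \<le> h (x (Suc k)) + g (x (Suc k)) \<bullet> ?d + L / 2 * (norm ?d)\<^sup>2"
      by (rule quadratic_upper_bound[OF h L(2)])
    moreover have "m k \<bullet> ?d \<le> \<beta> / (2 * \<alpha>) * ((norm ?d)\<^sup>2 + (norm ?e)\<^sup>2)"
    proof -
      have "?e \<bullet> ?d \<le> norm ?e * norm ?d"
        by (rule norm_cauchy_schwarz)
      also have "\<dots> \<le> 1 / 2 * ((norm ?d)\<^sup>2 + (norm ?e)\<^sup>2)"
        using sum_squares_bound[of "norm ?e" "norm ?d"] by simp
      finally have "\<beta> / \<alpha> * (?e \<bullet> ?d) \<le> \<beta> / \<alpha> * (1 / 2 * ((norm ?d)\<^sup>2 + (norm ?e)\<^sup>2))"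
        using \<beta> \<alpha> by (intro mult_left_mono) auto
      also have "\<dots> = \<beta> / (2 * \<alpha>) * ((norm ?d)\<^sup>2 + (norm ?e)\<^sup>2)"
        by simp
      finally show ?thesis
        unfolding m_def inner_scaleR_left .
    qed
    moreover have "1 / (2 * \<alpha>) = \<epsilon> + L / 4 + \<beta> / (2 * \<alpha>)"
      using \<alpha>(1) by (simp add: \<epsilon>_def field_simps)
    then have "1 / (2 * \<alpha>) * (norm ?d)\<^sup>2
        = \<epsilon> * (norm ?d)\<^sup>2 + L / 4 * (norm ?d)\<^sup>2 + \<beta> / (2 * \<alpha>) * (norm ?d)\<^sup>2"
      by (simp only: distrib_right)
    ultimately show ?thesis
      unfolding H_def D_def c_def inner_diff_left distrib_left distrib_right by linarith
  qed
  have "H k \<le> H 0" for k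
  proof (induction k)
    case (Suc k)
    have "0 \<le> \<epsilon> * D k"
      using \<epsilon> by (simp add: D_def)
    then show ?case
      using dec[of k] Suc by linarith
  qed simp
  then have level: "h (x (Suc k)) + p k \<le> H 0" for k
    using c by (smt (verit) H_def zero_le_mult_iff zero_le_power2)
  have "\<forall>\<^sub>F z in at_infinity. ereal (H 0) < ereal (h z) + P z"
    using coercive unfolding coercive_def by (rule order_tendstoD) simp
  then obtain R where R: "\<And>z. norm z \<ge> R \<Longrightarrow> ereal (H 0) < ereal (h z) + P z"
    unfolding eventually_at_infinity by blast
  have "norm (x (Suc k)) \<le> R" for k
    using R[of "x (Suc k)"] level[of k] by (force simp: p)
  then have bdd: "bounded (range (\<lambda>k. x (Suc k)))"
    unfolding bounded_iff by blast
  interpret descent_scheme h g L P \<D> "\<lambda>k. x (Suc k)" m p "\<lambda>_. \<alpha>" H D \<alpha> \<epsilon> C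
  proof
    fix k
    show "(norm (m k))\<^sup>2 \<le> C * D k"
    proof -
      have "(norm (m k))\<^sup>2 = (\<beta> / \<alpha>)\<^sup>2 * (norm (x (Suc k) - x k))\<^sup>2"
        by (simp add: m_def power_mult_distrib power_divide)
      also have "\<dots> \<le> C * D k"
        using c by (intro mult_mono) (auto simp: C_def D_def)
      finally show ?thesis .
    qed
    show "H (Suc k) \<le> h (x (Suc (Suc k))) + p (Suc k) + C * D k"
    proof -
      have "c * (norm (x (Suc (Suc k)) - x (Suc k)))\<^sup>2 \<le> C * D k"
        using c by (intro mult_mono) (auto simp: C_def D_def)
      then show ?thesis
        by (simp add: H_def)
    qed
  qed (use h L pieces P p \<alpha> \<epsilon> c min dec bdd in \<open>auto simp: proper_fun_def D_def H_def C_def\<close>)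
  show ?thesis
    by (rule converges_shifted) simp
qed

section \<open>Pieces of polyhedral and piecewise quadratic functions\<close>

text \<open>The smallest face through the point: if the point were on its relative boundary, a facet would be
  a smaller one.\<close>

lemma polyhedron_point_in_rel_interior_face:
  fixes S :: "'a::euclidean_space set"
  assumes S: "polyhedron S" and x: "x \<in> S"
  obtains F where "F face_of S" "x \<in> rel_interior F"
proof -
  let ?\<F> = "{F. F face_of S \<and> x \<in> F}"
  have "finite ?\<F>"
    by (rule finite_subset[OF _ finite_polyhedron_faces[OF S]]) auto
  moreover have "S \<in> ?\<F>"
    using x S by (simp add: face_of_refl polyhedron_imp_convex)
  ultimately obtain F where F: "F \<in> ?\<F>" "\<And>G. G \<in> ?\<F> \<Longrightarrow> G \<subseteq> F \<Longrightarrow> F = G"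
    using finite_has_minimal[of ?\<F>] by blast
  have "x \<in> rel_interior F"
  proof (rule ccontr)
    assume "x \<notin> rel_interior F"
    moreover have "polyhedron F"
      using F(1) S face_of_polyhedron_polyhedron by blast
    ultimately obtain G where G: "G facet_of F" "x \<in> G"
      using F(1) rel_boundary_of_polyhedron[of F] by blast
    then have "G face_of S"
      using F(1) facet_of_imp_face_of face_of_trans by blast
    then have "F = G"
      using F(2)[of G] G facet_of_imp_subset by blast
    with G(1) show False
      by simp
  qed
  with F(1) that show thesis
    by blast
qed

lemma rel_open_rel_interior_face:
  fixes F :: "'a::euclidean_space set"
  assumes "F face_of S"
  shows "rel_open (rel_interior F)"
  using face_of_imp_convex[OF assms] by (simp add: rel_open_def rel_interior_rel_interior)

lemma GDERIV_quadratic: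
  fixes B :: "'a::euclidean_space \<Rightarrow> 'a"
  assumes B: "linear B" "\<And>x y. B x \<bullet> y = x \<bullet> B y"
  shows "GDERIV (\<lambda>z. 1 / 2 * (z \<bullet> B z) + a \<bullet> z + \<tau>) x :> B x + a"
proof -
  have "(B has_derivative B) (at x)"
    using B(1) by (simp add: linear_imp_has_derivative)
  then have "((\<lambda>z. 1 / 2 * (z \<bullet> B z) + a \<bullet> z + \<tau>) has_derivative
      (\<lambda>d. 1 / 2 * (x \<bullet> B d + d \<bullet> B x) + a \<bullet> d)) (at x)"
    by (auto intro!: derivative_eq_intros)
  moreover have "(\<lambda>d. 1 / 2 * (x \<bullet> B d + d \<bullet> B x) + a \<bullet> d) = (\<lambda>d. d \<bullet> (B x + a))"
    using B(2)[of x] by (auto simp: fun_eq_iff inner_add_right inner_commute)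
  ultimately show ?thesis
    unfolding gderiv_def by simp
qed

text \<open>Pieces are described by the data of a quadratic function; this turns the data into the function
  together with its gradient.\<close>

definition quadratic_piece ::
    "('a::euclidean_space \<Rightarrow> 'a) \<Rightarrow> 'a \<Rightarrow> real \<Rightarrow> ('a \<Rightarrow> real) \<times> ('a \<Rightarrow> 'a)" where
  "quadratic_piece B a \<tau> = (\<lambda>z. 1 / 2 * (z \<bullet> B z) + a \<bullet> z + \<tau>, \<lambda>z. B z + a)"

definition selfadjoint :: "('a::euclidean_space \<Rightarrow> 'a) \<Rightarrow> bool" where
  "selfadjoint B \<longleftrightarrow> linear B \<and> (\<forall>x y. B x \<bullet> y = x \<bullet> B y)"

lemma quadratic_piece_system:
  fixes P :: "'a::euclidean_space \<Rightarrow> ereal"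
  assumes fin: "finite \<Q>"
    and piece: "\<And>D B a \<tau>. (D, B, a, \<tau>) \<in> \<Q> \<Longrightarrow> rel_open D \<and> selfadjoint B \<and>
      (\<forall>z\<in>D. P z \<le> ereal (1 / 2 * (z \<bullet> B z) + a \<bullet> z + \<tau>)) \<and>
      kl_half_along (\<lambda>z. h z + (1 / 2 * (z \<bullet> B z) + a \<bullet> z + \<tau>)) (\<lambda>z. g z + (B z + a)) (directions D)"
    and cover: "\<And>z. P z < \<infinity> \<Longrightarrow>
      \<exists>(D, B, a, \<tau>)\<in>\<Q>. z \<in> D \<and> P z = ereal (1 / 2 * (z \<bullet> B z) + a \<bullet> z + \<tau>)"
  shows "\<exists>\<D>. kl_pieces h g P \<D>"
proof -
  define \<D> where "\<D> = (\<lambda>(D, B, a, \<tau>). (D, quadratic_piece B a \<tau>)) ` \<Q>"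
  have "kl_pieces h g P \<D>"
    unfolding kl_pieces_def
  proof (intro conjI)
    show "finite \<D>"
      using fin by (simp add: \<D>_def)
    show "\<forall>(D, q, dq)\<in>\<D>. rel_open D \<and> (\<forall>z. GDERIV q z :> dq z) \<and> continuous_on UNIV dq \<and>
        (\<forall>z\<in>D. P z \<le> ereal (q z)) \<and>
        kl_half_along (\<lambda>z. h z + q z) (\<lambda>z. g z + dq z) (directions D)"
    proof (clarsimp simp: \<D>_def quadratic_piece_def simp del: inner_add_right)
      fix D B a \<tau> assume Q: "(D, B, a, \<tau>) \<in> \<Q>"
      then have B: "linear B" "\<And>x y. B x \<bullet> y = x \<bullet> B y"
        using piece[OF Q] unfolding selfadjoint_def by blast+
      have "continuous_on UNIV B"
        using B(1) by (simp add: linear_continuous_on linear_conv_bounded_linear)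
      then show "rel_open D \<and> (\<forall>z. GDERIV (\<lambda>z. z \<bullet> B z / 2 + a \<bullet> z + \<tau>) z :> B z + a) \<and>
          continuous_on UNIV (\<lambda>z. B z + a) \<and> (\<forall>z\<in>D. P z \<le> ereal (z \<bullet> B z / 2 + a \<bullet> z + \<tau>)) \<and>
          kl_half_along (\<lambda>z. h z + (z \<bullet> B z / 2 + a \<bullet> z + \<tau>)) (\<lambda>z. g z + (B z + a)) (directions D)"
        using piece[OF Q] GDERIV_quadratic[OF B, of a \<tau>] by (auto intro!: continuous_intros)
    qed
    show "\<forall>z. P z < \<infinity> \<longrightarrow> (\<exists>(D, q, dq)\<in>\<D>. z \<in> D \<and> P z = ereal (q z))"
    proof (intro allI impI)
      fix z assume "P z < \<infinity>"
      then obtain D B a \<tau> where "(D, B, a, \<tau>) \<in> \<Q>" "z \<in> D"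
        "P z = ereal (1 / 2 * (z \<bullet> B z) + a \<bullet> z + \<tau>)"
        using cover by blast
      then show "\<exists>(D, q, dq)\<in>\<D>. z \<in> D \<and> P z = ereal (q z)"
        by (intro bexI[of _ "(D, quadratic_piece B a \<tau>)"])
          (force simp: \<D>_def quadratic_piece_def)+
    qed
  qed
  then show ?thesis
    by blast
qed

text \<open>The polyhedra may overlap; the quadratic functions agree there because each of them is equal
  to \<open>P\<close>.\<close>

definition polyhedral_cover ::
    "('a::euclidean_space \<Rightarrow> ereal) \<Rightarrow> ('a set \<times> ('a \<Rightarrow> 'a) \<times> 'a \<times> real) set \<Rightarrow> bool" where
  "polyhedral_cover P \<C> \<longleftrightarrow> finite \<C> \<and> dom_fun P \<subseteq> (\<Union>(C, B, a, \<tau>)\<in>\<C>. C) \<and>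
     (\<forall>(C, B, a, \<tau>)\<in>\<C>. polyhedron C \<and> selfadjoint B \<and>
        (\<forall>z\<in>C. P z = ereal (1 / 2 * (z \<bullet> B z) + a \<bullet> z + \<tau>)))"

lemma kl_pieces_of_cover:
  fixes P :: "'a::euclidean_space \<Rightarrow> ereal"
  assumes cover: "polyhedral_cover P \<C>"
    and kl: "\<And>D B a \<tau>. rel_open D \<Longrightarrow> selfadjoint B \<Longrightarrow>
      (\<forall>z\<in>D. P z = ereal (1 / 2 * (z \<bullet> B z) + a \<bullet> z + \<tau>)) \<Longrightarrow>
      kl_half_along (\<lambda>z. h z + (1 / 2 * (z \<bullet> B z) + a \<bullet> z + \<tau>)) (\<lambda>z. g z + (B z + a)) (directions D)"
  shows "\<exists>\<D>. kl_pieces h g P \<D>"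
proof -
  define \<Q> where "\<Q> = (\<Union>(C, B, a, \<tau>)\<in>\<C>. (\<lambda>F. (rel_interior F, B, a, \<tau>)) ` {F. F face_of C})"
  have C: "polyhedron C" "selfadjoint B" "\<forall>z\<in>C. P z = ereal (1 / 2 * (z \<bullet> B z) + a \<bullet> z + \<tau>)"
    if "(C, B, a, \<tau>) \<in> \<C>" for C B a \<tau>
    using cover that unfolding polyhedral_cover_def by blast+
  show ?thesis
  proof (rule quadratic_piece_system)
    show "finite \<Q>"
      unfolding \<Q>_def using cover C(1)
      by (auto simp: polyhedral_cover_def intro!: finite_polyhedron_faces)
    fix D B a \<tau> assume "(D, B, a, \<tau>) \<in> \<Q>"
    then obtain C F where CF: "(C, B, a, \<tau>) \<in> \<C>" "F face_of C" "D = rel_interior F"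
      unfolding \<Q>_def by auto
    have "D \<subseteq> C"
      using CF(2,3) face_of_imp_subset rel_interior_subset by blast
    then have eq: "\<forall>z\<in>D. P z = ereal (1 / 2 * (z \<bullet> B z) + a \<bullet> z + \<tau>)"
      using C(3)[OF CF(1)] by blast
    moreover have "rel_open D"
      using CF(2,3) rel_open_rel_interior_face by blast
    ultimately show "rel_open D \<and> selfadjoint B \<and>
      (\<forall>z\<in>D. P z \<le> ereal (1 / 2 * (z \<bullet> B z) + a \<bullet> z + \<tau>)) \<and>
      kl_half_along (\<lambda>z. h z + (1 / 2 * (z \<bullet> B z) + a \<bullet> z + \<tau>)) (\<lambda>z. g z + (B z + a)) (directions D)"
      using kl C(2)[OF CF(1)] by (intro conjI) auto
  next
    fix z assume "P z < \<infinity>"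
    then have "z \<in> (\<Union>(C, B, a, \<tau>)\<in>\<C>. C)"
      using cover unfolding polyhedral_cover_def dom_fun_def by blast
    then obtain C B a \<tau> where CB: "(C, B, a, \<tau>) \<in> \<C>" "z \<in> C"
      by auto
    obtain F where F: "F face_of C" "z \<in> rel_interior F"
      using polyhedron_point_in_rel_interior_face[OF C(1)[OF CB(1)] CB(2)] .
    then have "(rel_interior F, B, a, \<tau>) \<in> \<Q>"
      unfolding \<Q>_def using CB(1) by force
    then show "\<exists>(D, B, a, \<tau>)\<in>\<Q>. z \<in> D \<and> P z = ereal (1 / 2 * (z \<bullet> B z) + a \<bullet> z + \<tau>)"
      using F(2) C(3)[OF CB(1)] CB(2) by (intro bexI[of _ "(rel_interior F, B, a, \<tau>)"]) auto
  qed
qed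

lemma closed_fun_of_cover:
  fixes P :: "'a::euclidean_space \<Rightarrow> ereal"
  assumes cover: "polyhedral_cover P \<C>"
  shows "closed_fun P"
  unfolding closed_fun_def le_Liminf_iff
proof (intro allI impI)
  fix x c assume c: "c < P x"
  have "\<forall>\<^sub>F z in at x. z \<in> C \<longrightarrow> c < P z" if CB: "(C, B, a, \<tau>) \<in> \<C>" for C B a \<tau>
  proof -
    have C: "polyhedron C" "selfadjoint B" "\<forall>z\<in>C. P z = ereal (1 / 2 * (z \<bullet> B z) + a \<bullet> z + \<tau>)"
      using cover CB unfolding polyhedral_cover_def by blast+
    show ?thesis
    proof (cases "x \<in> C")
      case True
      have "continuous_on UNIV B"
        using C(2) unfolding selfadjoint_def
        by (simp add: linear_continuous_on linear_conv_bounded_linear)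
      then have "isCont B x"
        by (simp add: continuous_on_eq_continuous_at)
      then have "((\<lambda>z. ereal (1 / 2 * (z \<bullet> B z) + a \<bullet> z + \<tau>)) \<longlongrightarrow>
          ereal (1 / 2 * (x \<bullet> B x) + a \<bullet> x + \<tau>)) (at x)"
        unfolding isCont_def by (intro tendsto_intros)
      moreover have "c < ereal (1 / 2 * (x \<bullet> B x) + a \<bullet> x + \<tau>)"
        using c C(3) True by simp
      ultimately have "\<forall>\<^sub>F z in at x. c < ereal (1 / 2 * (z \<bullet> B z) + a \<bullet> z + \<tau>)"
        by (rule order_tendstoD(1))
      then show ?thesis
        by (rule eventually_mono) (use C(3) in auto)
    next
      case False
      have "open (- C)"
        using C(1) polyhedron_imp_closed by blast
      then have "\<forall>\<^sub>F z in at x. z \<in> - C"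
        using False by (intro topological_tendstoD[OF tendsto_ident_at]) auto
      then show ?thesis
        by (rule eventually_mono) simp
    qed
  qed
  then have "\<forall>\<^sub>F z in at x. \<forall>t\<in>\<C>. case t of (C, B, a, \<tau>) \<Rightarrow> z \<in> C \<longrightarrow> c < P z"
    using cover unfolding polyhedral_cover_def by (intro eventually_ball_finite) auto
  then show "\<forall>\<^sub>F z in at x. c < P z"
  proof (rule eventually_mono)
    fix z assume *: "\<forall>t\<in>\<C>. case t of (C, B, a, \<tau>) \<Rightarrow> z \<in> C \<longrightarrow> c < P z"
    show "c < P z"
    proof (cases "P z < \<infinity>")
      case True
      then have "z \<in> (\<Union>(C, B, a, \<tau>)\<in>\<C>. C)"
        using cover unfolding polyhedral_cover_def dom_fun_def by blast
      with * show ?thesis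
        by auto
    next
      case False
      moreover have "c < \<infinity>"
        using c ereal_less_eq(1)[of "P x"] by (rule less_le_trans)
      ultimately show ?thesis
        by (simp add: not_less)
    qed
  qed
qed

text \<open>Convexity at the midpoint of \<open>x + e w\<close> and \<open>x - e w\<close>; both points stay in the relatively open
  piece.\<close>

lemma psd_along_directions:
  fixes P :: "'a::euclidean_space \<Rightarrow> ereal"
  assumes conv: "convex_fun P" and D: "rel_open D" and B: "selfadjoint B"
    and P: "\<forall>z\<in>D. P z = ereal (1 / 2 * (z \<bullet> B z) + a \<bullet> z + \<tau>)" and w: "w \<in> directions D"
  shows "0 \<le> w \<bullet> B w"
proof (cases "D = {}")
  case True
  then have "w = 0"
    using w by (simp add: directions_def)
  then show ?thesis
    by simp
next
  case False
  then obtain x where x: "x \<in> D"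
    by blast
  have B': "linear B" "\<And>x y. B x \<bullet> y = x \<bullet> B y"
    using B unfolding selfadjoint_def by blast+
  obtain e where e: "e > 0" "\<And>s. \<bar>s\<bar> \<le> e \<Longrightarrow> x + s *\<^sub>R w \<in> D"
    using rel_open_line[OF D x w] by blast
  define q where "q z = 1 / 2 * (z \<bullet> B z) + a \<bullet> z + \<tau>" for z
  have q: "P (x + s *\<^sub>R w) = ereal (q (x + s *\<^sub>R w))" if "\<bar>s\<bar> \<le> e" for s
    using e(2)[OF that] P by (simp add: q_def)
  have "P ((1 - 1 / 2) *\<^sub>R (x + e *\<^sub>R w) + (1 / 2) *\<^sub>R (x + (- e) *\<^sub>R w))
      \<le> ereal ((1 - 1 / 2) * q (x + e *\<^sub>R w) + 1 / 2 * q (x + (- e) *\<^sub>R w))"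
    using e(1) by (intro convex_fun_combination conv q) auto
  moreover have "(1 - 1 / 2) *\<^sub>R (x + e *\<^sub>R w) + (1 / 2) *\<^sub>R (x + (- e) *\<^sub>R w) = x"
    by (simp add: algebra_simps flip: scaleR_add_left)
  ultimately have "q x \<le> 1 / 2 * q (x + e *\<^sub>R w) + 1 / 2 * q (x + (- e) *\<^sub>R w)"
    using q[of 0] e(1) by simp
  also have "\<dots> = q x + e\<^sup>2 / 2 * (w \<bullet> B w)"
    unfolding q_def
    by (simp add: linear_add[OF B'(1)] linear_diff[OF B'(1)] linear_scale[OF B'(1)] inner_add_left
        inner_add_right inner_diff_left inner_diff_right power2_eq_square field_simps)
  finally show ?thesis
    using e(1) by (simp add: zero_le_mult_iff)
qed

text \<open>A face whose relative interior passes through a point of the graph cannot contain the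
  vertical direction, since the epigraph has nothing below the graph. Hence it lies in a
  non-vertical hyperplane, and projecting it down gives a piece on which the function is affine.\<close>

lemma polyhedral_fun_pieces:
  fixes Q :: "'a::euclidean_space \<Rightarrow> ereal"
  assumes Q: "polyhedral_fun Q" "\<And>z. Q z \<noteq> -\<infinity>"
  obtains \<A> where "finite \<A>"
    "\<And>D a \<tau>. (D, a, \<tau>) \<in> \<A> \<Longrightarrow> rel_open D \<and> (\<forall>z\<in>D. Q z \<le> ereal (a \<bullet> z + \<tau>))"
    "\<And>z. Q z < \<infinity> \<Longrightarrow> \<exists>(D, a, \<tau>)\<in>\<A>. z \<in> D \<and> Q z = ereal (a \<bullet> z + \<tau>)"
proof -
  define E where "E = ereal_epigraph Q"
  have E: "polyhedron E"
    using Q(1) by (simp add: polyhedral_fun_def E_def)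
  define graphic where
    "graphic F b \<longleftrightarrow> (\<forall>(u, r)\<in>rel_interior F. r = fst b \<bullet> u + snd b)" for F :: "('a \<times> real) set" and b :: "'a \<times> real"
  define \<G> where "\<G> = {F. F face_of E \<and> (\<exists>b. graphic F b)}"
  define sel where "sel F = (SOME b. graphic F b)" for F
  have sel: "graphic F (sel F)" if "F \<in> \<G>" for F
    unfolding sel_def using that by (auto simp: \<G>_def intro: someI_ex)
  define \<A> where "\<A> = (\<lambda>F. (fst ` rel_interior F, sel F)) ` \<G>"
  show thesis
  proof (rule that[of \<A>])
    have "finite \<G>"
      by (rule finite_subset[OF _ finite_polyhedron_faces[OF E]]) (auto simp: \<G>_def)
    then show "finite \<A>"
      by (simp add: \<A>_def)
  next
    fix D a \<tau> assume "(D, a, \<tau>) \<in> \<A>"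
    then obtain F where F: "F \<in> \<G>" "D = fst ` rel_interior F" "sel F = (a, \<tau>)"
      unfolding \<A>_def by auto
    have "convex F"
      using F(1) face_of_imp_convex unfolding \<G>_def by blast
    then have "rel_open D"
      unfolding rel_open_def F(2)
      by (simp add: rel_interior_convex_linear_image[OF linear_fst, symmetric]
          convex_rel_interior rel_interior_rel_interior)
    moreover have "Q z \<le> ereal (a \<bullet> z + \<tau>)" if "z \<in> D" for z
    proof -
      obtain r where r: "(z, r) \<in> rel_interior F"
        using \<open>z \<in> D\<close> F(2) by auto
      moreover have "rel_interior F \<subseteq> E"
        using F(1) face_of_imp_subset rel_interior_subset unfolding \<G>_def by blast
      ultimately have "Q z \<le> ereal r"
        by (auto simp: E_def ereal_epigraph_def)
      also have "r = a \<bullet> z + \<tau>"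
        using sel[OF F(1)] r F(3) by (auto simp: graphic_def)
      finally show ?thesis .
    qed
    ultimately show "rel_open D \<and> (\<forall>z\<in>D. Q z \<le> ereal (a \<bullet> z + \<tau>))"
      by blast
  next
    fix z assume "Q z < \<infinity>"
    then obtain t where t: "Q z = ereal t"
      using Q(2)[of z] by (cases "Q z") auto
    then have "(z, t) \<in> E"
      by (simp add: E_def ereal_epigraph_def)
    then obtain F where F: "F face_of E" "(z, t) \<in> rel_interior F"
      using polyhedron_point_in_rel_interior_face[OF E] by blast
    let ?V = "directions (rel_interior F)"
    have vertical: "(0, 1) \<notin> ?V"
    proof
      assume "(0, 1) \<in> ?V"
      then obtain e where e: "e > 0" "\<And>s. \<bar>s\<bar> \<le> e \<Longrightarrow> (z, t) + s *\<^sub>R (0, 1) \<in> rel_interior F"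
        using rel_open_line[OF rel_open_rel_interior_face[OF F(1)] F(2)] by blast
      have "(z, t - e) \<in> rel_interior F"
        using e(2)[of "- e"] e(1) by simp
      then have "(z, t - e) \<in> E"
        using face_of_imp_subset[OF F(1)] rel_interior_subset by blast
      then show False
        using t e(1) by (simp add: E_def ereal_epigraph_def)
    qed
    obtain y n where yn: "y \<in> span ?V" "\<And>w. w \<in> span ?V \<Longrightarrow> orthogonal n w" "(0, 1) = y + n"
      using orthogonal_subspace_decomp_exists[of ?V "(0, 1)"] by blast
    have span_V: "span ?V = ?V"
      using subspace_directions by simp
    have "n \<noteq> 0"
      using yn vertical span_V by auto
    moreover have "snd n = n \<bullet> (0, 1)"
      by (simp add: inner_prod_def)
    then have "snd n = n \<bullet> n"
      using yn(2)[OF yn(1)] unfolding yn(3) by (simp add: inner_add_right orthogonal_def)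
    ultimately have n: "snd n > 0"
      by simp
    define b where "b = (- (fst n /\<^sub>R snd n), t + (fst n \<bullet> z) / snd n)"
    have "r = fst b \<bullet> u + snd b" if "(u, r) \<in> rel_interior F" for u r
    proof -
      have "(u, r) - (z, t) \<in> ?V"
        unfolding directions_def using that F(2) by (intro span_base) blast
      then have "n \<bullet> ((u, r) - (z, t)) = 0"
        using yn(2) span_V by (simp add: orthogonal_def)
      then have "fst n \<bullet> (u - z) + snd n * (r - t) = 0"
        by (simp add: inner_prod_def)
      then have "snd n * r = snd n * t - fst n \<bullet> (u - z)"
        by (simp add: algebra_simps)
      then have "r = (snd n * t - fst n \<bullet> (u - z)) / snd n"
        using n by (simp add: nonzero_eq_divide_eq mult.commute)
      also have "\<dots> = fst b \<bullet> u + snd b"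
        using n by (simp add: b_def inner_diff_right diff_divide_distrib divide_inverse[of _ "snd n"]
            algebra_simps)
      finally show ?thesis .
    qed
    then have "graphic F b"
      by (auto simp: graphic_def)
    then have FG: "F \<in> \<G>"
      unfolding \<G>_def using F(1) by blast
    then have "(fst ` rel_interior F, sel F) \<in> \<A>"
      by (simp add: \<A>_def)
    moreover have "t = fst (sel F) \<bullet> z + snd (sel F)"
      using sel[OF FG] F(2) by (auto simp: graphic_def)
    moreover have "z \<in> fst ` rel_interior F"
      using F(2) by force
    ultimately show "\<exists>(D, a, \<tau>)\<in>\<A>. z \<in> D \<and> Q z = ereal (a \<bullet> z + \<tau>)"
      unfolding t by (intro bexI[of _ "(fst ` rel_interior F, sel F)"]) (auto split: prod.split)
  qed
qed

lemma closed_fun_Min: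
  fixes Q :: "'i \<Rightarrow> 'a::euclidean_space \<Rightarrow> ereal"
  assumes I: "finite I" "I \<noteq> {}" and Q: "\<And>i. i \<in> I \<Longrightarrow> closed_fun (Q i)"
  shows "closed_fun (\<lambda>x. MIN i\<in>I. Q i x)"
  unfolding closed_fun_def le_Liminf_iff
proof (intro allI impI)
  fix x c assume "c < (MIN i\<in>I. Q i x)"
  then have "\<forall>i\<in>I. \<forall>\<^sub>F z in at x. c < Q i z"
    using Q I unfolding closed_fun_def le_Liminf_iff by auto
  then have "\<forall>\<^sub>F z in at x. \<forall>i\<in>I. c < Q i z"
    using I(1) by (simp add: eventually_ball_finite)
  then show "\<forall>\<^sub>F z in at x. c < (MIN i\<in>I. Q i z)"
    by (rule eventually_mono) (use I in auto)
qed

lemma min_of_polyhedral_properties: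
  fixes P :: "real^'n \<Rightarrow> ereal"
  assumes P: "min_of_polyhedral P"
    and kl: "\<And>W a \<tau>. subspace W \<Longrightarrow> kl_half_along (\<lambda>z. h z + (a \<bullet> z + \<tau>)) (\<lambda>z. g z + a) W"
  shows "closed_fun P" "proper_fun P" "\<exists>\<D>. kl_pieces h g P \<D>"
proof -
  obtain r :: nat and Q where r: "1 \<le> r"
    and Q: "\<And>i. i \<in> {1..r} \<Longrightarrow> proper_fun (Q i) \<and> closed_fun (Q i) \<and> polyhedral_fun (Q i)"
    and PQ: "P = (\<lambda>x. MIN i\<in>{1..r}. Q i x)"
    using P unfolding min_of_polyhedral_def by blast
  have P_le: "P z \<le> Q i z" if "i \<in> {1..r}" for i z
    unfolding PQ using that by (intro Min_le) auto
  have P_eq: "\<exists>i\<in>{1..r}. P z = Q i z" for z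
  proof -
    have "P z \<in> (\<lambda>i. Q i z) ` {1..r}"
      unfolding PQ using r by (intro Min_in) auto
    then show ?thesis
      by blast
  qed
  show "closed_fun P"
    unfolding PQ using r Q by (intro closed_fun_Min) auto
  have "P z \<noteq> -\<infinity>" for z
    using P_eq[of z] Q unfolding proper_fun_def by metis
  moreover obtain z where "Q 1 z \<noteq> \<infinity>"
    using Q[of 1] r unfolding proper_fun_def by auto
  then have "P z \<noteq> \<infinity>"
    using P_le[of 1 z] r by auto
  ultimately show "proper_fun P"
    unfolding proper_fun_def by blast
  have "\<forall>i\<in>{1..r}. \<exists>\<A>. finite \<A> \<and>
      (\<forall>D a \<tau>. (D, a, \<tau>) \<in> \<A> \<longrightarrow> rel_open D \<and> (\<forall>z\<in>D. Q i z \<le> ereal (a \<bullet> z + \<tau>))) \<and>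
      (\<forall>z. Q i z < \<infinity> \<longrightarrow> (\<exists>(D, a, \<tau>)\<in>\<A>. z \<in> D \<and> Q i z = ereal (a \<bullet> z + \<tau>)))"
  proof
    fix i assume "i \<in> {1..r}"
    then have Qi: "polyhedral_fun (Q i)" "\<And>z. Q i z \<noteq> -\<infinity>"
      using Q[of i] unfolding proper_fun_def by blast+
    show "\<exists>\<A>. finite \<A> \<and>
      (\<forall>D a \<tau>. (D, a, \<tau>) \<in> \<A> \<longrightarrow> rel_open D \<and> (\<forall>z\<in>D. Q i z \<le> ereal (a \<bullet> z + \<tau>))) \<and>
      (\<forall>z. Q i z < \<infinity> \<longrightarrow> (\<exists>(D, a, \<tau>)\<in>\<A>. z \<in> D \<and> Q i z = ereal (a \<bullet> z + \<tau>)))"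
      by (rule polyhedral_fun_pieces[OF Qi]) blast
  qed
  from bchoice[OF this] obtain \<A> where all: "\<forall>i\<in>{1..r}. finite (\<A> i) \<and>
      (\<forall>D a \<tau>. (D, a, \<tau>) \<in> \<A> i \<longrightarrow> rel_open D \<and> (\<forall>z\<in>D. Q i z \<le> ereal (a \<bullet> z + \<tau>))) \<and>
      (\<forall>z. Q i z < \<infinity> \<longrightarrow> (\<exists>(D, a, \<tau>)\<in>\<A> i. z \<in> D \<and> Q i z = ereal (a \<bullet> z + \<tau>)))"
    by (elim exE)
  have \<A>: "finite (\<A> i)"
    "\<And>D a \<tau>. (D, a, \<tau>) \<in> \<A> i \<Longrightarrow> rel_open D \<and> (\<forall>z\<in>D. Q i z \<le> ereal (a \<bullet> z + \<tau>))"
    "\<And>z. Q i z < \<infinity> \<Longrightarrow> \<exists>(D, a, \<tau>)\<in>\<A> i. z \<in> D \<and> Q i z = ereal (a \<bullet> z + \<tau>)"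
    if "i \<in> {1..r}" for i
    using bspec[OF all that] by blast+
  define \<Q> where "\<Q> = (\<Union>i\<in>{1..r}. (\<lambda>(D, a, \<tau>). (D, \<lambda>_::real^'n. 0 :: real^'n, a, \<tau>)) ` \<A> i)"
  show "\<exists>\<D>. kl_pieces h g P \<D>"
  proof (rule quadratic_piece_system)
    show "finite \<Q>"
      unfolding \<Q>_def using \<A>(1) by blast
    fix D B a \<tau> assume "(D, B, a, \<tau>) \<in> \<Q>"
    then obtain i where i: "i \<in> {1..r}" "(D, a, \<tau>) \<in> \<A> i" and B: "B = (\<lambda>_. 0)"
      unfolding \<Q>_def by auto
    have "P z \<le> ereal (a \<bullet> z + \<tau>)" if "z \<in> D" for z
      using P_le[OF i(1)] \<A>(2)[OF i] that order_trans by blast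
    then show "rel_open D \<and> selfadjoint B \<and>
      (\<forall>z\<in>D. P z \<le> ereal (1 / 2 * (z \<bullet> B z) + a \<bullet> z + \<tau>)) \<and>
      kl_half_along (\<lambda>z. h z + (1 / 2 * (z \<bullet> B z) + a \<bullet> z + \<tau>)) (\<lambda>z. g z + (B z + a)) (directions D)"
      using \<A>(2)[OF i] kl[OF subspace_directions] unfolding B
      by (simp add: selfadjoint_def linear_zero)
  next
    fix z assume z: "P z < \<infinity>"
    obtain i where i: "i \<in> {1..r}" "P z = Q i z"
      using P_eq by blast
    then obtain D a \<tau> where "(D, a, \<tau>) \<in> \<A> i" "z \<in> D" "Q i z = ereal (a \<bullet> z + \<tau>)"
      using \<A>(3)[of i z] z by auto
    moreover from this have "(D, \<lambda>_. 0, a, \<tau>) \<in> \<Q>"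
      unfolding \<Q>_def using i(1) by force
    ultimately show "\<exists>(D, B, a, \<tau>)\<in>\<Q>. z \<in> D \<and> P z = ereal (1 / 2 * (z \<bullet> B z) + a \<bullet> z + \<tau>)"
      using i(2) by (intro bexI[of _ "(D, \<lambda>_. 0, a, \<tau>)"]) auto
  qed
qed

section \<open>The problem classes\<close>

lemma inner_matrix_transpose: "(A *v y) \<bullet> z = y \<bullet> (transpose A *v z)"
  for A :: "real^'n^'m"
  by (metis dot_lmul_matrix inner_commute transpose_matrix_vector)

lemma admissible_lossD:
  assumes "admissible_loss l"
  shows "GDERIV l y :> gradient l y" "compact S \<Longrightarrow> convex S \<Longrightarrow> strongly_convex_on S l"
  using assms unfolding admissible_loss_def twice_continuously_differentiable_def by blast+

lemma GDERIV_loss: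
  fixes A :: "real^'n^'m"
  assumes "admissible_loss l"
  shows "GDERIV (\<lambda>x. l (A *v x)) x :> transpose A *v gradient l (A *v x)"
  by (rule GDERIV_compose_linear[OF matrix_vector_mul_linear inner_matrix_transpose
        admissible_lossD(1)[OF assms]])

lemma kl_half_along_loss:
  fixes A :: "real^'n^'m"
  assumes l: "admissible_loss l" and B: "selfadjoint B" and W: "subspace W"
    and psd: "\<And>w. w \<in> W \<Longrightarrow> 0 \<le> w \<bullet> B w"
  shows "kl_half_along (\<lambda>z. l (A *v z) + (1 / 2 * (z \<bullet> B z) + a \<bullet> z + \<tau>))
    (\<lambda>z. gradient (\<lambda>x. l (A *v x)) z + (B z + a)) W"
proof (rule kl_half_along_convex)
  show "linear ((*v) A)"
    by (rule matrix_vector_mul_linear)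
  show "\<And>y z. (A *v y) \<bullet> z = y \<bullet> (transpose A *v z)"
    by (rule inner_matrix_transpose)
  show "gradient (\<lambda>x. l (A *v x)) z + (B z + a) = transpose A *v gradient l (A *v z) + (B z + a)" for z
    using gradient_eqI[OF GDERIV_loss[OF l]] by simp
  show "linear B" "\<And>x y. B x \<bullet> y = x \<bullet> B y"
    using B unfolding selfadjoint_def by blast+
  show "\<And>y. GDERIV l y :> gradient l y"
    "\<And>S. compact S \<Longrightarrow> convex S \<Longrightarrow> strongly_convex_on S l"
    using admissible_lossD[OF l] by blast+
qed (rule W psd refl | assumption)+

lemma selfadjoint_matrix:
  fixes M :: "real^'n^'n"
  assumes "transpose M = M"
  shows "selfadjoint ((*v) M)"
  unfolding selfadjoint_def using inner_matrix_transpose[of M] assms by (simp add: matrix_vector_mul_linear)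

lemma piecewise_linear_quadratic_cover:
  fixes P :: "real^'n \<Rightarrow> ereal"
  assumes "piecewise_linear_quadratic P"
  shows "\<exists>\<C>. polyhedral_cover P \<C>"
proof -
  obtain \<S> where \<S>: "finite \<S>" "\<forall>C\<in>\<S>. polyhedron C" "dom_fun P = \<Union>\<S>"
    and quad: "\<forall>C\<in>\<S>. \<exists>(M :: real^'n^'n) a \<tau>. transpose M = M \<and>
      (\<forall>x\<in>C. P x = ereal (1/2 * (x \<bullet> (M *v x)) + a \<bullet> x + \<tau>))"
    using assms unfolding piecewise_linear_quadratic_def by blast
  from quad have "\<forall>C\<in>\<S>. \<exists>m. transpose (fst m) = fst m \<and>
      (\<forall>x\<in>C. P x = ereal (1/2 * (x \<bullet> (fst m *v x)) + fst (snd m) \<bullet> x + snd (snd m)))"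
    by simp
  from bchoice[OF this] obtain m where m: "\<And>C. C \<in> \<S> \<Longrightarrow> transpose (fst (m C)) = fst (m C)"
    "\<And>C x. C \<in> \<S> \<Longrightarrow> x \<in> C \<Longrightarrow>
      P x = ereal (1/2 * (x \<bullet> (fst (m C) *v x)) + fst (snd (m C)) \<bullet> x + snd (snd (m C)))"
    by blast
  have "polyhedral_cover P ((\<lambda>C. (C, (*v) (fst (m C)), snd (m C))) ` \<S>)"
    unfolding polyhedral_cover_def
  proof (intro conjI)
    show "dom_fun P \<subseteq> (\<Union>(C, B, a, \<tau>)\<in>(\<lambda>C. (C, (*v) (fst (m C)), snd (m C))) ` \<S>. C)"
      using \<S>(3) by (auto split: prod.splits)
    show "\<forall>(C, B, a, \<tau>)\<in>(\<lambda>C. (C, (*v) (fst (m C)), snd (m C))) ` \<S>. polyhedron C \<and> selfadjoint B \<and>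
        (\<forall>z\<in>C. P z = ereal (1 / 2 * (z \<bullet> B z) + a \<bullet> z + \<tau>))"
    proof -
      have "polyhedron C \<and> selfadjoint ((*v) (fst (m C))) \<and> (\<forall>z\<in>C. P z =
          ereal (1 / 2 * (z \<bullet> (fst (m C) *v z)) + fst (snd (m C)) \<bullet> z + snd (snd (m C))))"
        if "C \<in> \<S>" for C
        using \<S>(2) m(1)[OF that] m(2)[OF that] selfadjoint_matrix that by blast
      then show ?thesis
        by (auto split: prod.splits)
    qed
  qed (use \<S>(1) in simp)
  then show ?thesis
    by blast
qed

lemma polyhedron_component_interval:
  fixes s lo hi :: real
  assumes S: "S = {lo..hi} \<or> S = {lo..}"
  shows "polyhedron {x :: real^'n. s * x $ i \<in> S}"
proof -
  have ax: "axis i s \<bullet> x = s * x $ i" for x :: "real^'n"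
    by (simp add: inner_axis')
  have "polyhedron {x :: real^'n. axis i s \<bullet> x \<ge> lo}" "polyhedron {x :: real^'n. axis i s \<bullet> x \<le> hi}"
    by (rule polyhedron_halfspace_ge, rule polyhedron_halfspace_le)
  then have "polyhedron {x :: real^'n. s * x $ i \<ge> lo}"
    "polyhedron ({x :: real^'n. s * x $ i \<ge> lo} \<inter> {x. s * x $ i \<le> hi})"
    unfolding ax by auto
  with S show ?thesis
    by (auto simp: Collect_conj_eq)
qed

text \<open>A polyhedron of the cover is given by a choice, for every coordinate, of a piece of \<open>r\<close> on the
  nonnegative half line and of a sign; evenness of \<open>r\<close> transports the piece to the negative half
  line.\<close>

lemma even_separable_cover:
  fixes r :: "real \<Rightarrow> real" and K :: "(real set \<times> real \<times> real \<times> real) set"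
  assumes even: "\<And>t. r (- t) = r t" and K: "finite K" "\<And>t. 0 \<le> t \<Longrightarrow> \<exists>(S, _)\<in>K. t \<in> S"
    and S: "\<And>S m c d. (S, m, c, d) \<in> K \<Longrightarrow> (\<exists>lo hi. S = {lo..hi} \<or> S = {lo..}) \<and>
      (\<forall>t\<in>S. r t = 1 / 2 * m * t\<^sup>2 + c * t + d)"
  shows "\<exists>\<C>. polyhedral_cover (\<lambda>x :: real^'n. ereal (\<Sum>i\<in>UNIV. r (x $ i))) \<C>"
proof -
  define K' where "K' = K \<times> {1, -1 :: real}"
  define C where "C \<sigma> = {x :: real^'n. \<forall>i. snd (\<sigma> i) * x $ i \<in> fst (fst (\<sigma> i))}"
    for \<sigma> :: "'n \<Rightarrow> (real set \<times> real \<times> real \<times> real) \<times> real"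
  define B where "B \<sigma> = (\<lambda>x. \<chi> i. fst (snd (fst (\<sigma> i))) * x $ i)"
    for \<sigma> :: "'n \<Rightarrow> (real set \<times> real \<times> real \<times> real) \<times> real"
  define a where "a \<sigma> = (\<chi> i. snd (\<sigma> i) * fst (snd (snd (fst (\<sigma> i)))))"
    for \<sigma> :: "'n \<Rightarrow> (real set \<times> real \<times> real \<times> real) \<times> real"
  define \<tau> where "\<tau> \<sigma> = (\<Sum>i\<in>UNIV. snd (snd (snd (fst (\<sigma> i)))))"
    for \<sigma> :: "'n \<Rightarrow> (real set \<times> real \<times> real \<times> real) \<times> real"
  define \<Sigma> where "\<Sigma> = {\<sigma> :: 'n \<Rightarrow> _. \<forall>i. \<sigma> i \<in> K'}"
  have "\<Sigma> = (UNIV :: 'n set) \<rightarrow>\<^sub>E K'"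
    by (auto simp: \<Sigma>_def PiE_def Pi_def)
  then have fin: "finite \<Sigma>"
    using K(1) by (auto simp: K'_def intro!: finite_PiE)
  have r: "r t = 1 / 2 * m * t\<^sup>2 + s * c * t + d"
    if "((S, m, c, d), s) \<in> K'" "s * t \<in> S" for S m c d s t
  proof -
    have s: "s = 1 \<or> s = -1" and "(S, m, c, d) \<in> K"
      using that(1) by (auto simp: K'_def)
    then have "r (s * t) = 1 / 2 * m * (s * t)\<^sup>2 + c * (s * t) + d"
      using assms(4) that(2) by blast
    with s show ?thesis
      using even[of t] by auto
  qed
  have "polyhedral_cover (\<lambda>x. ereal (\<Sum>i\<in>UNIV. r (x $ i))) ((\<lambda>\<sigma>. (C \<sigma>, B \<sigma>, a \<sigma>, \<tau> \<sigma>)) ` \<Sigma>)"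
    unfolding polyhedral_cover_def
  proof (intro conjI)
    show "finite ((\<lambda>\<sigma>. (C \<sigma>, B \<sigma>, a \<sigma>, \<tau> \<sigma>)) ` \<Sigma>)"
      using fin by simp
    have "x \<in> (\<Union>\<sigma>\<in>\<Sigma>. C \<sigma>)" for x
    proof -
      have "\<exists>k. k \<in> K' \<and> snd k * x $ i \<in> fst (fst k)" for i
      proof (cases "0 \<le> x $ i")
        case True
        then obtain S m where "(S, m) \<in> K" "x $ i \<in> S"
          using K(2) by blast
        then show ?thesis
          by (intro exI[of _ "((S, m), 1)"]) (simp add: K'_def)
      next
        case False
        then obtain S m where "(S, m) \<in> K" "- x $ i \<in> S"
          using K(2)[of "- x $ i"] by auto
        then show ?thesis
          by (intro exI[of _ "((S, m), -1)"]) (simp add: K'_def)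
      qed
      then obtain \<sigma> where "\<forall>i. \<sigma> i \<in> K' \<and> snd (\<sigma> i) * x $ i \<in> fst (fst (\<sigma> i))"
        by metis
      then show ?thesis
        by (auto simp: \<Sigma>_def C_def)
    qed
    then show "dom_fun (\<lambda>x. ereal (\<Sum>i\<in>UNIV. r (x $ i)))
        \<subseteq> (\<Union>(C, B, a, \<tau>)\<in>(\<lambda>\<sigma>. (C \<sigma>, B \<sigma>, a \<sigma>, \<tau> \<sigma>)) ` \<Sigma>. C)"
      by auto
    have "polyhedron (C \<sigma>) \<and> selfadjoint (B \<sigma>) \<and>
        (\<forall>z\<in>C \<sigma>. ereal (\<Sum>i\<in>UNIV. r (z $ i)) = ereal (1 / 2 * (z \<bullet> B \<sigma> z) + a \<sigma> \<bullet> z + \<tau> \<sigma>))"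
      if \<sigma>: "\<sigma> \<in> \<Sigma>" for \<sigma>
    proof (intro conjI ballI)
      have "polyhedron {x :: real^'n. snd (\<sigma> i) * x $ i \<in> fst (fst (\<sigma> i))}" for i
      proof -
        obtain T m c d where T: "fst (\<sigma> i) = (T, m, c, d)"
          by (cases "fst (\<sigma> i)") auto
        have "fst (\<sigma> i) \<in> K"
          using \<sigma> by (auto simp: \<Sigma>_def K'_def mem_Times_iff)
        then have "\<exists>lo hi. T = {lo..hi} \<or> T = {lo..}"
          using S unfolding T by blast
        then show ?thesis
          using polyhedron_component_interval[of T _ _ "snd (\<sigma> i)" i] unfolding T by auto
      qed
      moreover have "C \<sigma> = (\<Inter>i. {x. snd (\<sigma> i) * x $ i \<in> fst (fst (\<sigma> i))})"
        by (auto simp: C_def)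
      ultimately show "polyhedron (C \<sigma>)"
        by (auto intro!: polyhedron_Inter)
      show "selfadjoint (B \<sigma>)"
        unfolding selfadjoint_def B_def
        by (auto intro!: linearI sum.cong simp: vec_eq_iff inner_vec_def algebra_simps)
    next
      fix z assume z: "z \<in> C \<sigma>"
      have "r (z $ i) = 1 / 2 * (z $ i * B \<sigma> z $ i) + a \<sigma> $ i * z $ i + snd (snd (snd (fst (\<sigma> i))))" for i
      proof -
        obtain T m c d s where si: "\<sigma> i = ((T, m, c, d), s)"
          by (metis prod.collapse)
        then have "r (z $ i) = 1 / 2 * m * (z $ i)\<^sup>2 + s * c * z $ i + d"
          using \<sigma> z by (intro r) (auto simp: \<Sigma>_def C_def dest!: spec[of _ i])
        then show ?thesis
          by (simp add: B_def a_def si power2_eq_square)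
      qed
      then show "ereal (\<Sum>i\<in>UNIV. r (z $ i)) = ereal (1 / 2 * (z \<bullet> B \<sigma> z) + a \<sigma> \<bullet> z + \<tau> \<sigma>)"
        by (simp add: inner_vec_def \<tau>_def sum.distrib sum_distrib_left)
    qed
    then show "\<forall>(C, B, a, \<tau>)\<in>(\<lambda>\<sigma>. (C \<sigma>, B \<sigma>, a \<sigma>, \<tau> \<sigma>)) ` \<Sigma>. polyhedron C \<and> selfadjoint B \<and>
        (\<forall>z\<in>C. ereal (\<Sum>i\<in>UNIV. r (z $ i)) = ereal (1 / 2 * (z \<bullet> B z) + a \<bullet> z + \<tau>))"
      by auto
  qed
  then show ?thesis
    by blast
qed

lemma scad_cover:
  assumes "is_scad (P :: real^'n \<Rightarrow> ereal)"
  shows "\<exists>\<C>. polyhedral_cover P \<C>"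
proof -
  obtain lam \<theta> where lam: "lam > 0" "\<theta> > 2"
    and P: "P = (\<lambda>x. ereal (\<Sum>i\<in>UNIV. scad_scalar lam \<theta> (x $ i)))"
    using assms unfolding is_scad_def by blast
  define K where "K = {({0..lam}, 0, lam, 0),
      ({lam..\<theta> * lam}, - 1 / (\<theta> - 1), \<theta> * lam / (\<theta> - 1), - lam\<^sup>2 / (2 * (\<theta> - 1))),
      ({\<theta> * lam..}, 0, 0, (\<theta> + 1) * lam\<^sup>2 / 2)}"
  have w: "lam < \<theta> * lam"
    using lam by simp
  show ?thesis
    unfolding P
  proof (rule even_separable_cover[where K = K])
    show "scad_scalar lam \<theta> (- t) = scad_scalar lam \<theta> t" for t
      by (simp add: scad_scalar_def)
    show "finite K"
      by (simp add: K_def)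
    show "\<exists>(S, _)\<in>K. t \<in> S" if "0 \<le> t" for t
      using that by (auto simp: K_def)
    have mid: "1 / 2 * (- 1 / (\<theta> - 1)) * t\<^sup>2 + \<theta> * lam / (\<theta> - 1) * t + - lam\<^sup>2 / (2 * (\<theta> - 1))
        = (- t\<^sup>2 + 2 * \<theta> * lam * t - lam\<^sup>2) / (2 * (\<theta> - 1))" for t
    proof -
      have "1 / 2 * (- 1 / D) * t\<^sup>2 + \<theta> * lam / D * t + - lam\<^sup>2 / (2 * D)
          = (- t\<^sup>2 + 2 * \<theta> * lam * t - lam\<^sup>2) / (2 * D)" if "D \<noteq> 0" for D
        using that by (simp add: field_simps)
      from this[of "\<theta> - 1"] lam show ?thesis
        by linarith
    qed
    have at_lam: "(- lam\<^sup>2 + 2 * \<theta> * lam * lam - lam\<^sup>2) / (2 * (\<theta> - 1)) = lam * lam"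
    proof -
      have "- lam\<^sup>2 + 2 * \<theta> * lam * lam - lam\<^sup>2 = lam * lam * (2 * (\<theta> - 1))"
        by (simp add: algebra_simps power2_eq_square)
      then show ?thesis
        using lam by (subst nonzero_divide_eq_eq) auto
    qed
    have at_w: "(- (\<theta> * lam)\<^sup>2 + 2 * \<theta> * lam * (\<theta> * lam) - lam\<^sup>2) / (2 * (\<theta> - 1)) = (\<theta> + 1) * lam\<^sup>2 / 2"
    proof -
      have "- (\<theta> * lam)\<^sup>2 + 2 * \<theta> * lam * (\<theta> * lam) - lam\<^sup>2 = (\<theta> + 1) * lam\<^sup>2 / 2 * (2 * (\<theta> - 1))"
        by (simp add: algebra_simps power2_eq_square)
      then show ?thesis
        using lam by (subst nonzero_divide_eq_eq) auto
    qed
    have low: "scad_scalar lam \<theta> t = lam * t" if "0 \<le> t" "t \<le> lam" for t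
      using that by (simp add: scad_scalar_def)
    have middle: "scad_scalar lam \<theta> t = (- t\<^sup>2 + 2 * \<theta> * lam * t - lam\<^sup>2) / (2 * (\<theta> - 1))"
      if "lam \<le> t" "t \<le> \<theta> * lam" for t
    proof (cases "t = lam")
      case True
      then show ?thesis
        using at_lam lam low[of lam] by simp
    next
      case False
      then show ?thesis
        using that lam by (simp add: scad_scalar_def)
    qed
    have high: "scad_scalar lam \<theta> t = (\<theta> + 1) * lam\<^sup>2 / 2" if "\<theta> * lam \<le> t" for t
    proof (cases "t = \<theta> * lam")
      case True
      then show ?thesis
        using at_w middle[of t] w by simp
    next
      case False
      then have "\<not> \<bar>t\<bar> \<le> \<theta> * lam" "\<not> \<bar>t\<bar> \<le> lam"
        using that w by linarith+
      then show ?thesis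
        by (simp add: scad_scalar_def)
    qed
    fix S m c d assume "(S, m, c, d) \<in> K"
    then consider "S = {0..lam}" "m = 0" "c = lam" "d = 0"
      | "S = {lam..\<theta> * lam}" "m = - 1 / (\<theta> - 1)" "c = \<theta> * lam / (\<theta> - 1)" "d = - lam\<^sup>2 / (2 * (\<theta> - 1))"
      | "S = {\<theta> * lam..}" "m = 0" "c = 0" "d = (\<theta> + 1) * lam\<^sup>2 / 2"
      by (auto simp: K_def)
    then show "(\<exists>lo hi. S = {lo..hi} \<or> S = {lo..}) \<and>
        (\<forall>t\<in>S. scad_scalar lam \<theta> t = 1 / 2 * m * t\<^sup>2 + c * t + d)"
    proof cases
      case 1
      with low show ?thesis
        by auto
    next
      case 2
      have "\<exists>lo hi. S = {lo..hi} \<or> S = {lo..}"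
        using 2(1) by blast
      moreover have "\<forall>t\<in>S. scad_scalar lam \<theta> t = 1 / 2 * m * t\<^sup>2 + c * t + d"
        unfolding 2 mid using middle by auto
      ultimately show ?thesis
        by blast
    next
      case 3
      have "\<exists>lo hi. S = {lo..hi} \<or> S = {lo..}"
        using 3(1) by blast
      moreover have "\<forall>t\<in>S. scad_scalar lam \<theta> t = 1 / 2 * m * t\<^sup>2 + c * t + d"
        unfolding 3 using high by auto
      ultimately show ?thesis
        by blast
    qed
  qed
qed

lemma mcp_cover:
  assumes "is_mcp (P :: real^'n \<Rightarrow> ereal)"
  shows "\<exists>\<C>. polyhedral_cover P \<C>"
proof -
  obtain lam \<theta> where lam: "lam > 0" "\<theta> > 0"
    and P: "P = (\<lambda>x. ereal (\<Sum>i\<in>UNIV. mcp_scalar lam \<theta> (x $ i)))"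
    using assms unfolding is_mcp_def by blast
  define K where "K = {({0..\<theta> * lam}, - 1 / \<theta>, lam, 0), ({\<theta> * lam..}, 0, 0, \<theta> * lam\<^sup>2 / 2)}"
  have w: "0 < \<theta> * lam"
    using lam by simp
  show ?thesis
    unfolding P
  proof (rule even_separable_cover[where K = K])
    show "mcp_scalar lam \<theta> (- t) = mcp_scalar lam \<theta> t" for t
      by (simp add: mcp_scalar_def)
    show "finite K"
      by (simp add: K_def)
    show "\<exists>(S, _)\<in>K. t \<in> S" if "0 \<le> t" for t
      using that by (auto simp: K_def)
    have low: "mcp_scalar lam \<theta> t = 1 / 2 * (- 1 / \<theta>) * t\<^sup>2 + lam * t + 0" if "0 \<le> t" "t \<le> \<theta> * lam" for t
      using that lam by (simp add: mcp_scalar_def)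
    have high: "mcp_scalar lam \<theta> t = 1 / 2 * 0 * t\<^sup>2 + 0 * t + \<theta> * lam\<^sup>2 / 2" if "\<theta> * lam \<le> t" for t
    proof (cases "t = \<theta> * lam")
      case True
      then show ?thesis
        using w lam by (simp add: mcp_scalar_def power2_eq_square field_simps)
    next
      case False
      then have "\<not> \<bar>t\<bar> \<le> \<theta> * lam"
        using that by linarith
      then show ?thesis
        by (simp add: mcp_scalar_def)
    qed
    fix S m c d assume "(S, m, c, d) \<in> K"
    then consider "S = {0..\<theta> * lam}" "m = - 1 / \<theta>" "c = lam" "d = 0"
      | "S = {\<theta> * lam..}" "m = 0" "c = 0" "d = \<theta> * lam\<^sup>2 / 2"
      by (auto simp: K_def)
    then show "(\<exists>lo hi. S = {lo..hi} \<or> S = {lo..}) \<and>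
        (\<forall>t\<in>S. mcp_scalar lam \<theta> t = 1 / 2 * m * t\<^sup>2 + c * t + d)"
    proof cases
      case 1
      have "\<exists>lo hi. S = {lo..hi} \<or> S = {lo..}"
        using 1(1) by blast
      with low show ?thesis
        unfolding 1 by (simp del: times_divide_eq_right)
    next
      case 2
      have "\<exists>lo hi. S = {lo..hi} \<or> S = {lo..}"
        using 2(1) by blast
      with high show ?thesis
        unfolding 2 by simp
    qed
  qed
qed

lemma setting_a_model:
  fixes A :: "real^'n^'m"
  assumes "setting_a A h P"
  shows "GDERIV h z :> gradient h z" "closed_fun P" "proper_fun P" "\<exists>\<D>. kl_pieces h (gradient h) P \<D>"
proof -
  obtain l where l: "admissible_loss l" "h = (\<lambda>x. l (A *v x))" and P: "min_of_polyhedral P"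
    using assms unfolding setting_a_def by blast
  show "GDERIV h z :> gradient h z"
    unfolding l(2) using GDERIV_loss[OF l(1), of A z] gradient_eqI by metis
  have zero: "selfadjoint (\<lambda>_. 0 :: real^'n)"
    by (simp add: selfadjoint_def linear_zero)
  have "kl_half_along (\<lambda>z. h z + (a \<bullet> z + \<tau>)) (\<lambda>z. gradient h z + a) W" if "subspace W" for W a \<tau>
    using kl_half_along_loss[OF l(1) zero that, of A a \<tau>] unfolding l(2) by simp
  from min_of_polyhedral_properties[OF P this]
  show "closed_fun P" "proper_fun P" "\<exists>\<D>. kl_pieces h (gradient h) P \<D>"
    by blast+
qed

text \<open>The sum of the least squares loss and a quadratic piece is quadratic, and possibly concave in some
  directions.\<close>

lemma setting_b_model:
  fixes A :: "real^'n^'m"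
  assumes "setting_b A h P"
  shows "GDERIV h z :> gradient h z" "closed_fun P" "proper_fun P" "\<exists>\<D>. kl_pieces h (gradient h) P \<D>"
proof -
  obtain b where h: "h = (\<lambda>x. 1/2 * (norm (A *v x - b))\<^sup>2)" and P: "is_scad P \<or> is_mcp P"
    using assms unfolding setting_b_def by blast
  have sq: "GDERIV (\<lambda>y. 1/2 * (norm (y - b))\<^sup>2) y :> y - b" for y
    unfolding gderiv_def power2_norm_eq_inner
    by (auto intro!: derivative_eq_intros simp: inner_commute)
  have deriv: "GDERIV h z :> transpose A *v (A *v z - b)" for z
    unfolding h
    by (rule GDERIV_compose_linear[OF matrix_vector_mul_linear inner_matrix_transpose sq])
  have grad: "gradient h z = transpose A *v (A *v z - b)" for z
    using deriv by (rule gradient_eqI)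
  show "GDERIV h z :> gradient h z"
    using deriv grad by simp
  obtain \<C> where cover: "polyhedral_cover P \<C>"
    using P scad_cover mcp_cover by blast
  then show "closed_fun P"
    by (rule closed_fun_of_cover)
  show "proper_fun P"
    using P unfolding proper_fun_def is_scad_def is_mcp_def by auto
  show "\<exists>\<D>. kl_pieces h (gradient h) P \<D>"
  proof (rule kl_pieces_of_cover[OF cover])
    fix D and B :: "real^'n \<Rightarrow> real^'n" and a \<tau>
    assume B: "selfadjoint B"
    show "kl_half_along (\<lambda>z. h z + (1 / 2 * (z \<bullet> B z) + a \<bullet> z + \<tau>)) (\<lambda>z. gradient h z + (B z + a))
      (directions D)"
    proof (rule kl_half_along_quadratic)
      have B': "linear B" "\<And>x y. B x \<bullet> y = x \<bullet> B y"
        using B unfolding selfadjoint_def by blast+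
      show "linear (\<lambda>z. transpose A *v (A *v z) + B z)"
        using B'(1) by (intro linear_compose_add)
          (auto simp: matrix_vector_mul_assoc matrix_vector_mul_linear)
      show "(transpose A *v (A *v x) + B x) \<bullet> y = x \<bullet> (transpose A *v (A *v y) + B y)" for x y
        using B'(2)[of x y] inner_matrix_transpose[of A x "A *v y"] inner_matrix_transpose[of A y "A *v x"]
        by (simp add: inner_add_left inner_add_right inner_commute)
      show "h z + (1 / 2 * (z \<bullet> B z) + a \<bullet> z + \<tau>) = 1 / 2 * (z \<bullet> (transpose A *v (A *v z) + B z))
          + (a - transpose A *v b) \<bullet> z + (\<tau> + 1 / 2 * (b \<bullet> b))" for z
        using inner_matrix_transpose[of A z "A *v z"] inner_matrix_transpose[of A z b]
        unfolding h power2_norm_eq_inner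
        by (simp add: inner_add_right inner_diff_left inner_diff_right inner_commute algebra_simps)
      show "gradient h z + (B z + a) = transpose A *v (A *v z) + B z + (a - transpose A *v b)" for z
        unfolding grad by (simp add: matrix_vector_mult_diff_distrib)
    qed (rule subspace_directions)
  qed
qed

text \<open>The quadratic form of a piece may be indefinite on the whole space, but convexity of \<open>P\<close> makes it
  positive semidefinite along the directions of the piece.\<close>

lemma setting_ipiano_model:
  fixes A :: "real^'n^'m"
  assumes "setting_ipiano A h P"
  shows "GDERIV h z :> gradient h z" "\<exists>\<D>. kl_pieces h (gradient h) P \<D>"
proof -
  obtain l where l: "admissible_loss l" "h = (\<lambda>x. l (A *v x))"
    and P: "convex_fun P" "piecewise_linear_quadratic P"
    using assms unfolding setting_ipiano_def by blast
  show "GDERIV h z :> gradient h z"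
    unfolding l(2) using GDERIV_loss[OF l(1), of A z] gradient_eqI by metis
  obtain \<C> where "polyhedral_cover P \<C>"
    using piecewise_linear_quadratic_cover[OF P(2)] by blast
  then show "\<exists>\<D>. kl_pieces h (gradient h) P \<D>"
  proof (rule kl_pieces_of_cover)
    fix D and B :: "real^'n \<Rightarrow> real^'n" and a \<tau>
    assume D: "rel_open D" and B: "selfadjoint B"
      and eq: "\<forall>z\<in>D. P z = ereal (1 / 2 * (z \<bullet> B z) + a \<bullet> z + \<tau>)"
    show "kl_half_along (\<lambda>z. h z + (1 / 2 * (z \<bullet> B z) + a \<bullet> z + \<tau>)) (\<lambda>z. gradient h z + (B z + a))
      (directions D)"
      unfolding l(2)
      using psd_along_directions[OF P(1) D B eq]
      by (intro kl_half_along_loss l(1) B subspace_directions)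
  qed
qed

section \<open>Logistic regression with an l1 penalty\<close>

lemma one_plus_exp_neq_zero: "1 + exp t \<noteq> (0 :: real)"
  using exp_gt_zero[of t] by linarith

lemma ln_one_plus_exp_deriv:
  "((\<lambda>t. ln (1 + exp (c * t))) has_real_derivative c * (exp (c * t) / (1 + exp (c * t)))) (at t)"
  by (auto intro!: derivative_eq_intros simp: add_pos_pos)

lemma sigmoid_deriv:
  "((\<lambda>t. exp (c * t) / (1 + exp (c * t))) has_real_derivative
    c * (exp (c * t) / (1 + exp (c * t))\<^sup>2)) (at t)"
  by (auto intro!: derivative_eq_intros simp: one_plus_exp_neq_zero field_simps power2_eq_square)

lemma logistic_curvature_bounds:
  fixes c t R :: real
  assumes "\<bar>t\<bar> \<le> R"
  shows "exp (- \<bar>c\<bar> * R) / (1 + exp (\<bar>c\<bar> * R))\<^sup>2 \<le> exp (c * t) / (1 + exp (c * t))\<^sup>2"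
proof (rule frac_le)
  have "\<bar>c * t\<bar> \<le> \<bar>c\<bar> * R"
    using assms by (simp add: abs_mult mult_left_mono)
  then show "exp (- \<bar>c\<bar> * R) \<le> exp (c * t)" "(1 + exp (c * t))\<^sup>2 \<le> (1 + exp (\<bar>c\<bar> * R))\<^sup>2"
    by (auto intro!: power_mono add_nonneg_nonneg)
qed (auto simp: one_plus_exp_neq_zero)

lemma logistic_curvature_le_1: "exp t / (1 + exp t)\<^sup>2 \<le> (1 :: real)"
proof -
  have "exp t \<le> (1 + exp t)\<^sup>2"
    by (simp add: power2_eq_square algebra_simps add_increasing)
  moreover have "0 < (1 + exp t)\<^sup>2"
    by (simp add: one_plus_exp_neq_zero)
  ultimately show ?thesis
    by simp
qed

lemma convex_on_separable_sum:
  fixes S :: "(real^'m) set"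
  assumes "convex S" and "\<And>i. convex_on I (\<phi> i)" and "\<And>y i. y \<in> S \<Longrightarrow> y $ i \<in> I"
  shows "convex_on S (\<lambda>y. \<Sum>i\<in>UNIV. \<phi> i (y $ i))"
proof (rule convex_onI)
  fix t :: real and x y assume t: "0 < t" "t < 1" and xy: "x \<in> S" "y \<in> S"
  have "(\<Sum>i\<in>UNIV. \<phi> i (((1 - t) *\<^sub>R x + t *\<^sub>R y) $ i))
      \<le> (\<Sum>i\<in>UNIV. (1 - t) * \<phi> i (x $ i) + t * \<phi> i (y $ i))"
  proof (rule sum_mono)
    fix i
    show "\<phi> i (((1 - t) *\<^sub>R x + t *\<^sub>R y) $ i) \<le> (1 - t) * \<phi> i (x $ i) + t * \<phi> i (y $ i)"
      using convex_onD[OF assms(2)[of i], of t "x $ i" "y $ i"] assms(3) t xy by simp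
  qed
  then show "(\<Sum>i\<in>UNIV. \<phi> i (((1 - t) *\<^sub>R x + t *\<^sub>R y) $ i))
      \<le> (1 - t) * (\<Sum>i\<in>UNIV. \<phi> i (x $ i)) + t * (\<Sum>i\<in>UNIV. \<phi> i (y $ i))"
    by (simp add: sum.distrib sum_distrib_left)
qed (rule assms(1))

text \<open>The second derivative of each summand is positive, and its lower bound on a bounded interval is
  turned into the modulus \<open>\<sigma>\<close>.\<close>

lemma logistic_loss_strongly_convex:
  fixes b :: "real^'m"
  assumes b: "\<And>i. b $ i \<noteq> 0" and S: "compact S" "convex S"
  shows "strongly_convex_on S (logistic_loss b)"
proof -
  obtain R where R: "\<And>y. y \<in> S \<Longrightarrow> norm y \<le> R"
    using compact_imp_bounded[OF S(1)] unfolding bounded_iff by blast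
  define s where "s i = (b $ i)\<^sup>2 * (exp (- \<bar>b $ i\<bar> * R) / (1 + exp (\<bar>b $ i\<bar> * R))\<^sup>2)" for i
  define \<sigma> where "\<sigma> = Min (range s)"
  have "\<sigma> \<in> range s"
    unfolding \<sigma>_def by (rule Min_in) auto
  moreover have "s i > 0" for i
    using b[of i] by (simp add: s_def one_plus_exp_neq_zero)
  ultimately have \<sigma>: "\<sigma> > 0"
    by auto
  have \<sigma>_le: "\<sigma> \<le> s i" for i
    unfolding \<sigma>_def by (rule Min_le) auto
  define \<phi> where "\<phi> i t = ln (1 + exp (b $ i * t)) - \<sigma> / 2 * t\<^sup>2" for i t
  have "convex_on {- R..R} (\<phi> i)" for i
  proof (rule f''_ge0_imp_convex)
    show "(\<phi> i has_real_derivative b $ i * (exp (b $ i * t) / (1 + exp (b $ i * t))) - \<sigma> * t) (at t)" for t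
      unfolding \<phi>_def using ln_one_plus_exp_deriv[of "b $ i" t]
      by (auto intro!: derivative_eq_intros simp: add_pos_pos)
    show "((\<lambda>t. b $ i * (exp (b $ i * t) / (1 + exp (b $ i * t))) - \<sigma> * t) has_real_derivative
        b $ i * (b $ i * (exp (b $ i * t) / (1 + exp (b $ i * t))\<^sup>2)) - \<sigma>) (at t)" for t
      using DERIV_diff[OF DERIV_cmult[OF sigmoid_deriv[of "b $ i" t], of "b $ i"] DERIV_cmult_Id[of \<sigma> t]]
      by simp
    show "0 \<le> b $ i * (b $ i * (exp (b $ i * t) / (1 + exp (b $ i * t))\<^sup>2)) - \<sigma>" if "t \<in> {- R..R}" for t
    proof -
      have "\<bar>t\<bar> \<le> R"
        using that by auto
      then have "s i \<le> (b $ i)\<^sup>2 * (exp (b $ i * t) / (1 + exp (b $ i * t))\<^sup>2)"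
        unfolding s_def by (intro mult_left_mono logistic_curvature_bounds) auto
      with \<sigma>_le[of i] show ?thesis
        by (simp add: power2_eq_square mult.assoc)
    qed
  qed simp
  then have "convex_on S (\<lambda>y. \<Sum>i\<in>UNIV. \<phi> i (y $ i))"
  proof (rule convex_on_separable_sum[OF S(2)])
    fix y i assume "y \<in> S"
    then show "y $ i \<in> {- R..R}"
      using R[of y] component_le_norm_cart[of y i] by (auto simp: abs_le_iff)
  qed
  moreover have "(\<Sum>i\<in>UNIV. \<phi> i (y $ i)) = logistic_loss b y - \<sigma> / 2 * (norm y)\<^sup>2" for y
    unfolding power2_norm_eq_inner
    by (simp add: \<phi>_def logistic_loss_def inner_vec_def sum_subtractf sum_distrib_left power2_eq_square)
  ultimately show ?thesis
    unfolding strongly_convex_on_def using \<sigma> by auto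
qed

lemma admissible_logistic_loss:
  fixes b :: "real^'m"
  assumes b: "\<And>i. b $ i \<noteq> 0"
  shows "admissible_loss (logistic_loss b)"
proof -
  define sg where "sg i t = b $ i * (exp (b $ i * t) / (1 + exp (b $ i * t)))" for i t
  define cv where "cv i t = b $ i * (b $ i * (exp (b $ i * t) / (1 + exp (b $ i * t))\<^sup>2))" for i t
  have sg_deriv: "(sg i has_real_derivative cv i t) (at t)" for i t
    unfolding sg_def cv_def by (intro DERIV_cmult sigmoid_deriv)
  have comp: "((\<lambda>y :: real^'m. f (y $ i)) has_derivative (\<lambda>v. d * v $ i)) (at y)"
    if "(f has_real_derivative d) (at (y $ i))" for f :: "real \<Rightarrow> real" and d i y
    using has_derivative_compose[OF bounded_linear_imp_has_derivative[OF bounded_linear_vec_nth]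
        that[unfolded has_field_derivative_def]] .
  have deriv: "GDERIV (logistic_loss b) y :> (\<chi> i. sg i (y $ i))" for y
  proof -
    have "(logistic_loss b has_derivative (\<lambda>v. \<Sum>i\<in>UNIV. sg i (y $ i) * v $ i)) (at y)"
      unfolding logistic_loss_def sg_def
      by (intro has_derivative_sum comp ln_one_plus_exp_deriv)
    then show ?thesis
      unfolding gderiv_def by (simp add: inner_vec_def mult.commute)
  qed
  have grad: "gradient (logistic_loss b) = (\<lambda>y. \<chi> i. sg i (y $ i))"
    using gradient_eqI[OF deriv] by blast
  define H where "H y = (\<chi> i j. if i = j then cv i (y $ i) else 0)" for y :: "real^'m"
  have Hv: "H y *v v = (\<Sum>i\<in>UNIV. (cv i (y $ i) * v $ i) *\<^sub>R axis i 1)" for y v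
    by (simp add: H_def vec_eq_iff matrix_vector_mult_def axis_def if_distrib[of "\<lambda>z. z * _"]
        if_distrib[of "\<lambda>z. _ * z"] cong: if_cong)
  have "((\<lambda>y. \<chi> i. sg i (y $ i)) has_derivative (\<lambda>v. H y *v v)) (at y)" for y
  proof -
    have "(\<lambda>y :: real^'m. \<chi> i. sg i (y $ i)) = (\<lambda>y. \<Sum>i\<in>UNIV. sg i (y $ i) *\<^sub>R axis i 1)"
      by (auto simp: fun_eq_iff vec_eq_iff axis_def if_distrib[of "\<lambda>z. _ * z"] cong: if_cong)
    moreover have "((\<lambda>y. \<Sum>i\<in>UNIV. sg i (y $ i) *\<^sub>R axis i 1 :: real^'m) has_derivative
        (\<lambda>v. \<Sum>i\<in>UNIV. (cv i (y $ i) * v $ i) *\<^sub>R axis i 1)) (at y)"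
      by (intro has_derivative_sum has_derivative_scaleR_left comp sg_deriv)
    ultimately show ?thesis
      by (simp add: Hv)
  qed
  moreover have "continuous_on UNIV H"
  proof -
    have "continuous_on UNIV (\<lambda>y :: real^'m. cv i (y $ i))" for i
      unfolding cv_def by (auto intro!: continuous_intros simp: one_plus_exp_neq_zero)
    then have "continuous_on UNIV (\<lambda>y :: real^'m. if i = j then cv i (y $ i) else 0)" for i j
      by (cases "i = j") auto
    then show ?thesis
      unfolding H_def by (intro continuous_on_vec_lambda)
  qed
  ultimately have "twice_continuously_differentiable (logistic_loss b)"
    unfolding twice_continuously_differentiable_def grad using deriv by blast
  moreover have "(\<Sum>i\<in>UNIV. (b $ i)\<^sup>2)-lipschitz_on UNIV (gradient (logistic_loss b))"
  proof (rule lipschitz_onI)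
    show "0 \<le> (\<Sum>i\<in>UNIV. (b $ i)\<^sup>2)"
      by (intro sum_nonneg) auto
    fix y z :: "real^'m"
    have "\<bar>sg i (y $ i) - sg i (z $ i)\<bar> \<le> (b $ i)\<^sup>2 * norm (y - z)" for i
    proof -
      have "\<bar>cv i t\<bar> \<le> (b $ i)\<^sup>2" for t
      proof -
        have "cv i t = (b $ i)\<^sup>2 * (exp (b $ i * t) / (1 + exp (b $ i * t))\<^sup>2)"
          by (simp add: cv_def power2_eq_square)
        also have "\<bar>\<dots>\<bar> \<le> (b $ i)\<^sup>2 * 1"
          unfolding abs_mult using logistic_curvature_le_1[of "b $ i * t"]
          by (intro mult_mono) auto
        finally show ?thesis
          by simp
      qed
      then have "norm (sg i (y $ i) - sg i (z $ i)) \<le> (b $ i)\<^sup>2 * norm (y $ i - z $ i)"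
        using sg_deriv by (intro field_differentiable_bound[of UNIV "sg i" "cv i"]) auto
      also have "\<dots> \<le> (b $ i)\<^sup>2 * norm (y - z)"
        using component_le_norm_cart[of "y - z" i] by (intro mult_left_mono) auto
      finally show ?thesis
        by simp
    qed
    then have "norm ((\<chi> i. sg i (y $ i)) - (\<chi> i. sg i (z $ i))) \<le> (\<Sum>i\<in>UNIV. (b $ i)\<^sup>2 * norm (y - z))"
      by (intro order_trans[OF norm_le_l1_cart] sum_mono) simp
    then show "dist (gradient (logistic_loss b) y) (gradient (logistic_loss b) z)
        \<le> (\<Sum>i\<in>UNIV. (b $ i)\<^sup>2) * dist y z"
      unfolding grad dist_norm by (simp add: sum_distrib_right)
  qed
  ultimately show ?thesis
    unfolding admissible_loss_def using logistic_loss_strongly_convex[OF b] by blast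
qed

text \<open>The epigraph of the l1 norm is cut out by one halfspace for every vector of signs.\<close>

lemma polyhedral_l1_regularizer:
  assumes \<mu>: "\<mu> > 0"
  shows "polyhedral_fun (l1_regularizer \<mu> :: real^'n \<Rightarrow> ereal)"
proof -
  define \<S> where "\<S> = {s :: real^'n. \<forall>i. s $ i \<in> {1, -1}}"
  have "\<S> \<subseteq> (\<lambda>f. \<chi> i. f i) ` (UNIV \<rightarrow>\<^sub>E {1, -1})"
  proof
    fix s assume "s \<in> \<S>"
    then have "($) s \<in> UNIV \<rightarrow>\<^sub>E {1, -1}"
      by (auto simp: \<S>_def PiE_def Pi_def)
    then show "s \<in> (\<lambda>f. \<chi> i. f i) ` (UNIV \<rightarrow>\<^sub>E {1, -1})"
      by (intro image_eqI[of _ _ "($) s"]) (auto simp: vec_eq_iff)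
  qed
  then have "finite \<S>"
    by (rule finite_subset) (auto intro!: finite_PiE)
  have "ereal_epigraph (l1_regularizer \<mu>) = (\<Inter>s\<in>\<S>. {p :: (real^'n) \<times> real. (\<mu> *\<^sub>R s, -1) \<bullet> p \<le> 0})"
  proof (rule set_eqI)
    fix p :: "(real^'n) \<times> real"
    obtain x t where p: "p = (x, t)"
      by fastforce
    have "(\<mu> * (\<Sum>i\<in>UNIV. \<bar>x $ i\<bar>) \<le> t) = (\<forall>s\<in>\<S>. \<mu> * (s \<bullet> x) \<le> t)"
    proof (intro iffI ballI)
      fix s assume le: "\<mu> * (\<Sum>i\<in>UNIV. \<bar>x $ i\<bar>) \<le> t" and s: "s \<in> \<S>"
      have "s $ i * x $ i \<le> \<bar>x $ i\<bar>" for i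
      proof -
        have "s $ i = 1 \<or> s $ i = -1"
          using s by (simp add: \<S>_def)
        then show ?thesis
          by auto
      qed
      then have "s \<bullet> x \<le> (\<Sum>i\<in>UNIV. \<bar>x $ i\<bar>)"
        unfolding inner_vec_def by (intro sum_mono) simp
      with \<mu> have "\<mu> * (s \<bullet> x) \<le> \<mu> * (\<Sum>i\<in>UNIV. \<bar>x $ i\<bar>)"
        by (intro mult_left_mono) auto
      with le show "\<mu> * (s \<bullet> x) \<le> t"
        by linarith
    next
      assume all: "\<forall>s\<in>\<S>. \<mu> * (s \<bullet> x) \<le> t"
      define s where "s = (\<chi> i. if 0 \<le> x $ i then (1::real) else -1)"
      have "s \<in> \<S>"
        by (simp add: \<S>_def s_def)
      moreover have "s \<bullet> x = (\<Sum>i\<in>UNIV. \<bar>x $ i\<bar>)"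
        unfolding inner_vec_def by (intro sum.cong) (auto simp: s_def)
      ultimately show "\<mu> * (\<Sum>i\<in>UNIV. \<bar>x $ i\<bar>) \<le> t"
        using all by metis
    qed
    then show "p \<in> ereal_epigraph (l1_regularizer \<mu>)
        \<longleftrightarrow> p \<in> (\<Inter>s\<in>\<S>. {p. (\<mu> *\<^sub>R s, -1) \<bullet> p \<le> 0})"
      by (simp add: p ereal_epigraph_def l1_regularizer_def)
  qed
  then show ?thesis
    unfolding polyhedral_fun_def using \<open>finite \<S>\<close>
    by (auto intro!: polyhedron_Inter polyhedron_halfspace_le)
qed

lemma min_of_polyhedral_l1:
  assumes "\<mu> > 0"
  shows "min_of_polyhedral (l1_regularizer \<mu> :: real^'n \<Rightarrow> ereal)"
proof -
  have "(l1_regularizer \<mu> \<longlongrightarrow> l1_regularizer \<mu> x) (at x)" for x :: "real^'n"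
    unfolding l1_regularizer_def by (intro tendsto_intros)
  then have "closed_fun (l1_regularizer \<mu> :: real^'n \<Rightarrow> ereal)"
    unfolding closed_fun_def using lim_imp_Liminf[OF at_neq_bot] by (metis order_refl)
  moreover have "proper_fun (l1_regularizer \<mu> :: real^'n \<Rightarrow> ereal)"
    by (simp add: proper_fun_def l1_regularizer_def)
  ultimately show ?thesis
    unfolding min_of_polyhedral_def using polyhedral_l1_regularizer[OF assms]
    by (intro exI[of _ 1] exI[of _ "\<lambda>_. l1_regularizer \<mu>"]) auto
qed

theorem mainTheorem14:
  fixes A :: "real^'n^'m"
  shows
    "(\<forall>h P f L \<gamma> x.
        (setting_a A h P \<or> setting_b A h P) \<and>
        f = (\<lambda>z. ereal (h z) + P z) \<and>
        L > 0 \<and> L-lipschitz_on UNIV (gradient h) \<and>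
        0 < (INF k. ereal (\<gamma> k)) \<and> (SUP k. ereal (\<gamma> k)) < ereal (1 / L) \<and>
        prox_gradient_seq h P \<gamma> x \<and>
        (INF z. f z) > -\<infinity> \<and> bounded (range x)
        \<longrightarrow> (\<exists>xbar. stationary_point f xbar \<and> converges_locally_linearly x xbar))
     \<and>
     (\<forall>(b :: real^'m) \<mu>. (\<forall>i. b $ i \<noteq> 0) \<and> \<mu> > 0
        \<longrightarrow> setting_a A (\<lambda>z. logistic_loss b (A *v z)) (l1_regularizer \<mu>))
     \<and>
     (\<forall>h P f L \<alpha> \<beta> x.
        setting_ipiano A h P \<and>
        f = (\<lambda>z. ereal (h z) + P z) \<and> coercive f \<and>
        L > 0 \<and> L-lipschitz_on UNIV (gradient h) \<and>
        0 \<le> \<beta> \<and> \<beta> < 1 \<and> 0 < \<alpha> \<and> \<alpha> < 2 * (1 - \<beta>) / L \<and>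
        ipiano_seq h P \<alpha> \<beta> x
        \<longrightarrow> (\<exists>xbar. stationary_point f xbar \<and> converges_locally_linearly x xbar))"
proof (intro conjI allI impI; elim conjE)
  fix h P f L \<gamma> x
  assume "setting_a A h P \<or> setting_b A h P" and f: "f = (\<lambda>z. ereal (h z) + P z)"
    and L: "L > 0" "L-lipschitz_on UNIV (gradient h)"
    and \<gamma>: "0 < (INF k. ereal (\<gamma> k))" "(SUP k. ereal (\<gamma> k)) < ereal (1 / L)"
    and x: "prox_gradient_seq h P \<gamma> x" "bounded (range x)"
  then have h: "\<And>z. GDERIV h z :> gradient h z" and P: "closed_fun P" "proper_fun P"
    and "\<exists>\<D>. kl_pieces h (gradient h) P \<D>"
    using setting_a_model[of A h P] setting_b_model[of A h P] by blast+
  then obtain \<D> where "kl_pieces h (gradient h) P \<D>"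
    by blast
  from prox_gradient_converges[OF h L this P \<gamma> x]
  show "\<exists>xbar. stationary_point f xbar \<and> converges_locally_linearly x xbar"
    unfolding f .
next
  fix b :: "real^'m" and \<mu> :: real
  assume "\<forall>i. b $ i \<noteq> 0" "\<mu> > 0"
  then have "admissible_loss (logistic_loss b)" "min_of_polyhedral (l1_regularizer \<mu> :: real^'n \<Rightarrow> ereal)"
    using admissible_logistic_loss min_of_polyhedral_l1 by blast+
  then show "setting_a A (\<lambda>z. logistic_loss b (A *v z)) (l1_regularizer \<mu>)"
    unfolding setting_a_def by blast
next
  fix h P f L \<alpha> \<beta> x
  assume setting: "setting_ipiano A h P" and f: "f = (\<lambda>z. ereal (h z) + P z)"
    and coercive: "coercive f" and L: "L > 0" "L-lipschitz_on UNIV (gradient h)"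
    and \<beta>: "0 \<le> \<beta>" and \<alpha>: "0 < \<alpha>" "\<alpha> < 2 * (1 - \<beta>) / L" and x: "ipiano_seq h P \<alpha> \<beta> x"
  have P: "closed_fun P" "proper_fun P" "convex_fun P"
    using setting unfolding setting_ipiano_def by blast+
  obtain \<D> where "kl_pieces h (gradient h) P \<D>"
    using setting_ipiano_model(2)[OF setting] by blast
  from ipiano_converges[OF setting_ipiano_model(1)[OF setting] L this P \<beta> \<alpha> coercive[unfolded f] x]
  show "\<exists>xbar. stationary_point f xbar \<and> converges_locally_linearly x xbar"
    unfolding f .
qed

end
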